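(* Assume that the sequence of random variables $(g_n)_{n=1}^\infty$ satisfies the following condition: there exists $c>0$ such that $$\limsup_{n\to\infty}\mathbb P(\{\omega\in\Omega:|g_n(\omega)|\le c\})<1.$$ Let $1\le\beta\le\alpha<\infty$ and $\sigma\in\mathbb R$. Then $\langle\nabla\rangle^\sigma\gamma_0\langle\nabla\rangle^\sigma\in\mathfrak S^\alpha\setminus\mathfrak S^\beta$ implies $\langle\nabla\rangle^\sigma\gamma_0^{\omega;\sigma}\langle\nabla\rangle^\sigma\in\mathfrak S^\alpha\setminus\mathfrak S^\beta$ for almost all $\omega\in\Omega$.
   Context: $\langle\nabla\rangle=(1-\Delta)^{1/2}$ on $\mathbb R^d$; $\mathfrak S^\alpha$ is the Schatten class on $L^2_x=L^2(\mathbb R^d;\mathbb C)$, $\|A\|_{\mathfrak S^\alpha}=(\mathrm{Tr}|A|^\alpha)^{1/\alpha}$. $(g_n)_{n\ge1}$ are independent mean-zero real-valued random variables on a probability space $(\Omega,\mathcal A,\mathbb P)$ with distributions $\mu_n$, such that for some $C_0>0$, $\int_{\mathbb R}e^{\zeta x}d\mu_n(x)\le e^{C_0\zeta^2}$ for all $\zeta\in\mathbb R$ and all $n$. For compact $\gamma$ with (fixed) singular value decomposition $\gamma=\sum_na_n|u_n\rangle\langle v_n|$ ($a_n\ge0$, $(u_n),(v_n)$ orthonormal systems in $L^2_x$, $|f\rangle\langle g|(\phi)=\langle g|\phi\rangle f$), $\gamma^\omega=\sum_na_ng_n(\omega)|u_n\rangle\langle v_n|$. If $\langle\nabla\rangle^\sigma\gamma_0\langle\nabla\rangle^\sigma$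 is compact, $\gamma_0^{\omega;\sigma}=\langle\nabla\rangle^{-\sigma}(\langle\nabla\rangle^\sigma\gamma_0\langle\nabla\rangle^\sigma)^\omega\langle\nabla\rangle^{-\sigma}$. *)

theory Defs
  imports "HOL-Probability.Probability"
begin

definition square_integrable :: "('a::euclidean_space \<Rightarrow> complex) \<Rightarrow> bool" where
  "square_integrable f \<longleftrightarrow>
     f \<in> borel_measurable lborel \<and> integrable lborel (\<lambda>x. (cmod (f x))\<^sup>2)"

definition L2_rel :: "('a::euclidean_space \<Rightarrow> complex) \<Rightarrow> ('a \<Rightarrow> complex) \<Rightarrow> bool" where
  "L2_rel f g \<longleftrightarrow> square_integrable f \<and> square_integrable g \<and> (AE x in lborel. f x = g x)"

lemma square_integrable_zero: "square_integrable (\<lambda>_. 0)"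
  by (simp add: square_integrable_def)

lemma square_integrable_cmult:
  assumes "square_integrable f" shows "square_integrable (\<lambda>x. c * f x)"
  using assms by (auto simp: square_integrable_def norm_mult power_mult_distrib)

lemma square_integrable_add:
  assumes "square_integrable f" "square_integrable g"
  shows "square_integrable (\<lambda>x. f x + g x)"
proof -
  have [measurable]: "f \<in> borel_measurable lborel" "g \<in> borel_measurable lborel"
    using assms by (auto simp: square_integrable_def)
  have bd: "integrable lborel (\<lambda>x. 2 * (cmod (f x))\<^sup>2 + 2 * (cmod (g x))\<^sup>2)"
    using assms by (auto simp: square_integrable_def)
  have le: "(cmod (f x + g x))\<^sup>2 \<le> 2 * (cmod (f x))\<^sup>2 + 2 * (cmod (g x))\<^sup>2" for x
  proof -
    have "(cmod (f x + g x))\<^sup>2 \<le> (cmod (f x) + cmod (g x))\<^sup>2"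
      by (intro power_mono norm_triangle_ineq) auto
    also have "\<dots> \<le> 2 * (cmod (f x))\<^sup>2 + 2 * (cmod (g x))\<^sup>2"
      using zero_le_power2[of "cmod (f x) - cmod (g x)"]
      by (simp add: power2_eq_square algebra_simps)
    finally show ?thesis .
  qed
  have "integrable lborel (\<lambda>x. (cmod (f x + g x))\<^sup>2)"
    by (rule Bochner_Integration.integrable_bound[OF bd]) (use le in auto)
  then show ?thesis by (simp add: square_integrable_def)
qed

lemma borel_measurable_cnj [measurable]: "cnj \<in> borel_measurable borel"
  by (intro borel_measurable_continuous_onI continuous_intros)

lemma integrable_cnj_mult:
  assumes "square_integrable f" "square_integrable g"
  shows "integrable lborel (\<lambda>x. cnj (f x) * g x)"
proof -
  have [measurable]: "f \<in> borel_measurable lborel" "g \<in> borel_measurable lborel"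
    using assms by (auto simp: square_integrable_def)
  have bd: "integrable lborel (\<lambda>x. (cmod (f x))\<^sup>2 + (cmod (g x))\<^sup>2)"
    using assms by (auto simp: square_integrable_def)
  have le: "cmod (f x) * cmod (g x) \<le> (cmod (f x))\<^sup>2 + (cmod (g x))\<^sup>2" for x
  proof -
    have "0 \<le> (cmod (f x) - cmod (g x))\<^sup>2" "0 \<le> cmod (f x) * cmod (g x)" by simp_all
    then show ?thesis unfolding power2_diff by linarith
  qed
  show ?thesis
    by (rule Bochner_Integration.integrable_bound[OF bd])
      (use le in \<open>auto simp: norm_mult\<close>)
qed

lemma L2_rel_eq:
  assumes "square_integrable f" "\<And>x. f x = g x" shows "L2_rel f g"
proof -
  have "f = g" using assms(2) by (rule ext)
  with assms(1) show ?thesis by (simp add: L2_rel_def)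
qed

lemma part_equivp_L2_rel: "part_equivp (L2_rel :: ('a::euclidean_space \<Rightarrow> complex) \<Rightarrow> _)"
proof (rule part_equivpI)
  show "\<exists>x :: 'a \<Rightarrow> complex. L2_rel x x"
    by (rule exI[of _ "\<lambda>_. 0"]) (simp add: L2_rel_def square_integrable_zero)
  show "symp (L2_rel :: ('a \<Rightarrow> complex) \<Rightarrow> _)"
    by (auto simp: symp_def L2_rel_def elim: AE_mp)
  show "transp (L2_rel :: ('a \<Rightarrow> complex) \<Rightarrow> _)"
  proof (rule transpI)
    fix f g h :: "'a \<Rightarrow> complex" assume "L2_rel f g" "L2_rel g h"
    then have ae: "AE x in lborel. f x = g x" "AE x in lborel. g x = h x"
      and sq: "square_integrable f" "square_integrable h" by (auto simp: L2_rel_def)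
    from ae have "AE x in lborel. f x = h x" by eventually_elim simp
    with sq show "L2_rel f h" by (simp add: L2_rel_def)
  qed
qed

quotient_type (overloaded) 'a L2 = "'a::euclidean_space \<Rightarrow> complex" / partial: L2_rel
  by (rule part_equivp_L2_rel)

lift_definition cinner :: "'a::euclidean_space L2 \<Rightarrow> 'a L2 \<Rightarrow> complex"
  is "\<lambda>f g. \<integral>x. cnj (f x) * g x \<partial>lborel"
proof -
  fix f f' g g' :: "'a \<Rightarrow> complex" assume r: "L2_rel f f'" "L2_rel g g'"
  then have "AE x in lborel. f x = f' x" "AE x in lborel. g x = g' x"
    using r by (auto simp: L2_rel_def)
  then have "AE x in lborel. cnj (f x) * g x = cnj (f' x) * g' x"
    by eventually_elim simp
  moreover have "(\<lambda>x. cnj (f x) * g x) \<in> borel_measurable lborel"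
    "(\<lambda>x. cnj (f' x) * g' x) \<in> borel_measurable lborel"
    using r by (simp_all only: L2_rel_def borel_measurable_integrable integrable_cnj_mult)
  ultimately show "(\<integral>x. cnj (f x) * g x \<partial>lborel) = (\<integral>x. cnj (f' x) * g' x \<partial>lborel)"
    by (intro integral_cong_AE)
qed

lift_definition scaleC :: "complex \<Rightarrow> 'a::euclidean_space L2 \<Rightarrow> 'a L2" (infixr "*\<^sub>C" 75)
  is "\<lambda>c f x. c * f x"
  by (auto simp: L2_rel_def square_integrable_cmult)

instantiation L2 :: (euclidean_space) real_vector
begin

lift_definition zero_L2 :: "'a L2" is "\<lambda>_. 0"
  by (simp add: L2_rel_def square_integrable_zero)

lift_definition plus_L2 :: "'a L2 \<Rightarrow> 'a L2 \<Rightarrow> 'a L2" is "\<lambda>f g x. f x + g x"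
proof -
  fix f f' g g' :: "'a \<Rightarrow> complex" assume r: "L2_rel f f'" "L2_rel g g'"
  then have "AE x in lborel. f x = f' x" "AE x in lborel. g x = g' x"
    by (auto simp: L2_rel_def)
  then have "AE x in lborel. f x + g x = f' x + g' x" by eventually_elim simp
  with r show "L2_rel (\<lambda>x. f x + g x) (\<lambda>x. f' x + g' x)"
    by (simp add: L2_rel_def square_integrable_add)
qed

lemma scaleC_add_right: "c *\<^sub>C (f + g) = c *\<^sub>C f + c *\<^sub>C g" for f g :: "'a L2"
  by transfer (intro L2_rel_eq square_integrable_add square_integrable_cmult;
      simp add: L2_rel_def ring_distribs)

lemma scaleC_add_left: "(c + d) *\<^sub>C f = c *\<^sub>C f + d *\<^sub>C f" for f :: "'a L2"
  by transfer (intro L2_rel_eq square_integrable_cmult; simp add: L2_rel_def ring_distribs)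

lemma scaleC_scaleC: "c *\<^sub>C d *\<^sub>C f = (c * d) *\<^sub>C f" for f :: "'a L2"
  by transfer (intro L2_rel_eq square_integrable_cmult; simp add: L2_rel_def)

definition uminus_L2 :: "'a L2 \<Rightarrow> 'a L2" where "- f = (-1) *\<^sub>C f"

definition minus_L2 :: "'a L2 \<Rightarrow> 'a L2 \<Rightarrow> 'a L2" where "f - g = f + - (g :: 'a L2)"

definition scaleR_L2 :: "real \<Rightarrow> 'a L2 \<Rightarrow> 'a L2" where "r *\<^sub>R f = complex_of_real r *\<^sub>C f"

instance
proof
  fix f g h :: "'a L2" and r s :: real
  show "f + g + h = f + (g + h)"
    by transfer (intro L2_rel_eq square_integrable_add; simp add: L2_rel_def)
  show "f + g = g + f"
    by transfer (intro L2_rel_eq square_integrable_add; simp add: L2_rel_def)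
  show "0 + f = f"
    by transfer (simp add: L2_rel_def)
  show "- f + f = 0" unfolding uminus_L2_def
    by transfer (intro L2_rel_eq square_integrable_add square_integrable_cmult; simp add: L2_rel_def)
  show "f - g = f + - g" by (rule minus_L2_def)
  show "r *\<^sub>R (f + g) = r *\<^sub>R f + r *\<^sub>R g"
    unfolding scaleR_L2_def by (rule scaleC_add_right)
  show "(r + s) *\<^sub>R f = r *\<^sub>R f + s *\<^sub>R f"
    unfolding scaleR_L2_def of_real_add by (rule scaleC_add_left)
  show "r *\<^sub>R s *\<^sub>R f = (r * s) *\<^sub>R f"
    unfolding scaleR_L2_def of_real_mult by (rule scaleC_scaleC)
  show "1 *\<^sub>R f = f" unfolding scaleR_L2_def
    by transfer (simp add: L2_rel_def)
qed

end

lemma cinner_add_left: "cinner (f + g) h = cinner f h + cinner g h"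
  by transfer (simp add: L2_rel_def ring_distribs integrable_cnj_mult)

lemma cinner_add_right: "cinner h (f + g) = cinner h f + cinner h g"
  by transfer (simp add: L2_rel_def ring_distribs integrable_cnj_mult)

lemma cinner_scaleC_left: "cinner (c *\<^sub>C f) h = cnj c * cinner f h"
  by transfer (simp add: mult.assoc)

lemma cinner_scaleC_right: "cinner h (c *\<^sub>C f) = c * cinner h f"
  by transfer (simp add: mult.left_commute)

lemma cinner_commute: "cinner f g = cnj (cinner g f)"
  by transfer (simp add: Bochner_Integration.integral_cnj[symmetric] mult.commute del: Bochner_Integration.integral_cnj)

lemma cinner_self: "cinner f f = complex_of_real (Re (cinner f f))" "Re (cinner f f) \<ge> 0"
proof -
  show "cinner f f = complex_of_real (Re (cinner f f))"
    using cinner_commute[of f f] by (simp add: complex_eq_iff)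
  show "Re (cinner f f) \<ge> 0"
  proof transfer
    fix f :: "'a \<Rightarrow> complex" assume "L2_rel f f"
    have "(\<integral>x. cnj (f x) * f x \<partial>lborel)
        = (\<integral>x. complex_of_real ((cmod (f x))\<^sup>2) \<partial>lborel)"
      by (rule Bochner_Integration.integral_cong)
        (simp_all only: complex_norm_square mult.commute)
    also have "\<dots> = complex_of_real (\<integral>x. (cmod (f x))\<^sup>2 \<partial>lborel)"
      by (rule integral_complex_of_real)
    finally show "0 \<le> Re (\<integral>x. cnj (f x) * f x \<partial>lborel)" by simp
  qed
qed

lemma cinner_self_eq_0:
  assumes "Re (cinner f f) = 0" shows "f = 0"
  using assms
proof transfer
  fix f :: "'a \<Rightarrow> complex" assume r: "L2_rel f f" and z: "Re (\<integral>x. cnj (f x) * f x \<partial>lborel) = 0"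
  have "(\<integral>x. cnj (f x) * f x \<partial>lborel)
      = (\<integral>x. complex_of_real ((cmod (f x))\<^sup>2) \<partial>lborel)"
    by (rule Bochner_Integration.integral_cong)
      (simp_all only: complex_norm_square mult.commute)
  also have "\<dots> = complex_of_real (\<integral>x. (cmod (f x))\<^sup>2 \<partial>lborel)"
    by (rule integral_complex_of_real)
  finally have "(\<integral>x. (cmod (f x))\<^sup>2 \<partial>lborel) = 0" using z by simp
  then have "AE x in lborel. (cmod (f x))\<^sup>2 = 0"
    using r integral_nonneg_eq_0_iff_AE[of lborel "\<lambda>x. (cmod (f x))\<^sup>2"]
    by (auto simp: L2_rel_def square_integrable_def)
  then have "AE x in lborel. f x = 0" by eventually_elim simp
  with r show "L2_rel f (\<lambda>_. 0)" by (simp add: L2_rel_def square_integrable_zero)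
qed

text \<open>
  HOL-Analysis has no class of complex inner product spaces.  The type is an instance of
  \<^class>\<open>real_inner\<close> with the real part of the complex inner product, which induces the
  usual norm.
\<close>

instantiation L2 :: (euclidean_space) real_inner
begin

definition inner_L2 :: "'a L2 \<Rightarrow> 'a L2 \<Rightarrow> real" where "inner f g = Re (cinner f g)"

definition norm_L2 :: "'a L2 \<Rightarrow> real" where "norm f = sqrt (inner f f)" for f :: "'a L2"

definition dist_L2 :: "'a L2 \<Rightarrow> 'a L2 \<Rightarrow> real" where "dist f g = norm (f - g)" for f g :: "'a L2"

definition sgn_L2 :: "'a L2 \<Rightarrow> 'a L2" where "sgn f = f /\<^sub>R norm f" for f :: "'a L2"

definition uniformity_L2 :: "('a L2 \<times> 'a L2) filter" where
  "uniformity = (INF e\<in>{0 <..}. principal {(f :: 'a L2, g). dist f g < e})"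

definition open_L2 :: "'a L2 set \<Rightarrow> bool" where
  "open U = (\<forall>x\<in>U. \<forall>\<^sub>F (x', y) in uniformity. x' = x \<longrightarrow> y \<in> U)" for U :: "'a L2 set"

instance
proof
  fix f g h :: "'a L2" and r :: real and U :: "'a L2 set"
  show "dist f g = norm (f - g)" by (rule dist_L2_def)
  show "sgn f = f /\<^sub>R norm f" by (rule sgn_L2_def)
  show "uniformity = (INF e\<in>{0 <..}. principal {(f :: 'a L2, g). dist f g < e})"
    by (rule uniformity_L2_def)
  show "open U = (\<forall>x\<in>U. \<forall>\<^sub>F (x', y) in uniformity. x' = x \<longrightarrow> y \<in> U)"
    by (rule open_L2_def)
  show "inner f g = inner g f"
    unfolding inner_L2_def by (subst cinner_commute) simp
  show "inner (f + g) h = inner f h + inner g h"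
    by (simp add: inner_L2_def cinner_add_left)
  show "inner (r *\<^sub>R f) g = r * inner f g"
    by (simp add: inner_L2_def scaleR_L2_def cinner_scaleC_left)
  show "0 \<le> inner f f" by (simp add: inner_L2_def cinner_self(2))
  show "inner f f = 0 \<longleftrightarrow> f = 0"
  proof
    assume "inner f f = 0" then show "f = 0" by (simp add: inner_L2_def cinner_self_eq_0)
  next
    assume "f = 0"
    have "cinner (0 :: 'a L2) 0 = 0" by transfer simp
    then show "inner f f = 0" using \<open>f = 0\<close> by (simp add: inner_L2_def)
  qed
  show "norm f = sqrt (inner f f)" by (rule norm_L2_def)
qed

end

lemma norm_scaleC: "norm (c *\<^sub>C f) = cmod c * norm f"
proof -
  have "cinner (c *\<^sub>C f) (c *\<^sub>C f) = complex_of_real ((cmod c)\<^sup>2) * cinner f f"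
    by (simp add: cinner_scaleC_left cinner_scaleC_right complex_norm_square
        del: of_real_power)
  then show ?thesis
    by (simp add: norm_L2_def inner_L2_def real_sqrt_mult)
qed

lemma norm_cinner_le: "cmod (cinner f g) \<le> norm f * norm g"
proof (cases "cinner f g = 0")
  case False
  define c where "c = cnj (cinner f g) / complex_of_real (cmod (cinner f g))"
  have c: "cmod c = 1" using False by (simp add: c_def norm_divide)
  have "c * cinner f g = complex_of_real (cmod (cinner f g))"
  proof -
    have "cnj (cinner f g) * cinner f g = complex_of_real (cmod (cinner f g) * cmod (cinner f g))"
      using complex_norm_square[of "cinner f g"] by (simp add: power2_eq_square mult.commute)
    then show ?thesis using False by (simp add: c_def)
  qed
  then have "cmod (cinner f g) = inner f (c *\<^sub>C g)"
    by (simp add: inner_L2_def cinner_scaleC_right)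
  also have "\<dots> \<le> norm f * norm (c *\<^sub>C g)" by (rule norm_cauchy_schwarz)
  finally show ?thesis by (simp add: norm_scaleC c)
qed auto

lift_definition ketbra :: "'a::euclidean_space L2 \<Rightarrow> 'a L2 \<Rightarrow> 'a L2 \<Rightarrow>\<^sub>L 'a L2"
  is "\<lambda>f g \<phi>. cinner g \<phi> *\<^sub>C f"
proof -
  fix f g :: "'a L2"
  show "bounded_linear (\<lambda>\<phi>. cinner g \<phi> *\<^sub>C f)"
  proof (rule bounded_linear_intro[where K = "norm f * norm g"])
    fix \<phi> \<psi> :: "'a L2" and r :: real
    show "cinner g (\<phi> + \<psi>) *\<^sub>C f = cinner g \<phi> *\<^sub>C f + cinner g \<psi> *\<^sub>C f"
      by (simp add: cinner_add_right scaleC_add_left)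
    show "cinner g (r *\<^sub>R \<phi>) *\<^sub>C f = r *\<^sub>R (cinner g \<phi> *\<^sub>C f)"
      by (simp add: scaleR_L2_def cinner_scaleC_right scaleC_scaleC)
    show "norm (cinner g \<phi> *\<^sub>C f) \<le> norm \<phi> * (norm f * norm g)"
      using mult_right_mono[OF norm_cinner_le[of g \<phi>], of "norm f"]
      by (simp add: norm_scaleC mult_ac)
  qed
qed

definition complex_linear :: "('a::euclidean_space L2 \<Rightarrow>\<^sub>L 'a L2) \<Rightarrow> bool" where
  "complex_linear A \<longleftrightarrow> (\<forall>c f. A (c *\<^sub>C f) = c *\<^sub>C A f)"

definition compact_operator :: "('a::euclidean_space L2 \<Rightarrow>\<^sub>L 'a L2) \<Rightarrow> bool" where
  "compact_operator A \<longleftrightarrow> complex_linear A \<and> compact (closure (blinfun_apply A ` cball 0 1))"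

definition orthonormal_basis :: "'a::euclidean_space L2 set \<Rightarrow> bool" where
  "orthonormal_basis E \<longleftrightarrow>
     (\<forall>e\<in>E. \<forall>e'\<in>E. cinner e e' = (if e = e' then 1 else 0)) \<and>
     (\<forall>f. (\<forall>e\<in>E. cinner e f = 0) \<longrightarrow> f = 0)"

text \<open>
  \<open>is_abs A P\<close> says \<open>P = |A|\<close>, the positive square root of \<open>A\<^sup>*A\<close>.  For complex linear \<open>A\<close>
  the adjoint with respect to the real inner product, \<^const>\<open>adjoint\<close>, is the complex adjoint.
\<close>

definition is_abs :: "('a::euclidean_space L2 \<Rightarrow>\<^sub>L 'a L2) \<Rightarrow> ('a L2 \<Rightarrow>\<^sub>L 'a L2) \<Rightarrow> bool" where
  "is_abs A P \<longleftrightarrow>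
     complex_linear P \<and> (\<forall>f. cinner f (P f) \<in> \<real> \<and> 0 \<le> Re (cinner f (P f))) \<and>
     (\<forall>f. P (P f) = adjoint (blinfun_apply A) (A f))"

text \<open>
  \<open>is_op_powr P r Q\<close> says \<open>Q = P\<^sup>r\<close> in the functional calculus of \<open>P\<close>, for positive \<open>P\<close>
  and \<open>r > 0\<close>, in the case where \<open>P\<close> is diagonal in some orthonormal basis.  Every positive
  compact operator is of this kind, by the spectral theorem.
\<close>

definition is_op_powr ::
  "('a::euclidean_space L2 \<Rightarrow>\<^sub>L 'a L2) \<Rightarrow> real \<Rightarrow> ('a L2 \<Rightarrow>\<^sub>L 'a L2) \<Rightarrow> bool" where
  "is_op_powr P r Q \<longleftrightarrow>
     complex_linear Q \<and>
     (\<exists>E l. orthonormal_basis E \<and>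
       (\<forall>e\<in>E. 0 \<le> l e \<and> P e = l e *\<^sub>R e \<and> Q e = (l e powr r) *\<^sub>R e))"

definition has_trace :: "('a::euclidean_space L2 \<Rightarrow>\<^sub>L 'a L2) \<Rightarrow> complex \<Rightarrow> bool" where
  "has_trace Q t \<longleftrightarrow> (\<forall>E. orthonormal_basis E \<longrightarrow> ((\<lambda>e. cinner e (Q e)) has_sum t) E)"

text \<open>The compact operators \<open>A\<close> with \<open>Tr |A|\<^sup>r < \<infinity>\<close>, that is, of finite Schatten norm.\<close>

definition schatten :: "real \<Rightarrow> ('a::euclidean_space L2 \<Rightarrow>\<^sub>L 'a L2) set" where
  "schatten r = {A. compact_operator A \<and>
     (\<exists>P Q t. is_abs A P \<and> is_op_powr P r Q \<and> has_trace Q t)}"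

definition orthonormal_system :: "(nat \<Rightarrow> 'a::euclidean_space L2) \<Rightarrow> bool" where
  "orthonormal_system u \<longleftrightarrow> (\<forall>m n. cinner (u m) (u n) = (if m = n then 1 else 0))"

text \<open>
  Sequences are indexed from \<open>0\<close>.  Convergence is in operator norm.  Since zero values are
  allowed, operators of finite rank are covered.
\<close>

definition is_svd :: "('a::euclidean_space L2 \<Rightarrow>\<^sub>L 'a L2) \<Rightarrow>
    (nat \<Rightarrow> real) \<Rightarrow> (nat \<Rightarrow> 'a L2) \<Rightarrow> (nat \<Rightarrow> 'a L2) \<Rightarrow> bool" where
  "is_svd A a u v \<longleftrightarrow>
     (\<forall>n. 0 \<le> a n) \<and> orthonormal_system u \<and> orthonormal_system v \<and>
     (\<lambda>n. a n *\<^sub>R ketbra (u n) (v n)) sums A"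

text \<open>
  The operator \<open>\<gamma>\<^sup>\<omega>\<close>, for \<open>\<gamma>\<close> with singular value decomposition \<open>a, u, v\<close>.  Its value is
  unspecified for those \<open>\<omega>\<close> for which the series does not converge in operator norm.
\<close>

definition randomize :: "(nat \<Rightarrow> 'w \<Rightarrow> real) \<Rightarrow> (nat \<Rightarrow> real) \<Rightarrow>
    (nat \<Rightarrow> 'a::euclidean_space L2) \<Rightarrow> (nat \<Rightarrow> 'a L2) \<Rightarrow> 'w \<Rightarrow> 'a L2 \<Rightarrow>\<^sub>L 'a L2" where
  "randomize g a u v \<omega> = (\<Sum>n. (a n * g n \<omega>) *\<^sub>R ketbra (u n) (v n))"

primrec partial_deriv :: "'a::euclidean_space list \<Rightarrow> ('a \<Rightarrow> complex) \<Rightarrow> 'a \<Rightarrow> complex" where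
  "partial_deriv [] \<phi> = \<phi>"
| "partial_deriv (b # bs) \<phi> = (\<lambda>x. frechet_derivative (partial_deriv bs \<phi>) (at x) b)"

definition schwartz :: "('a::euclidean_space \<Rightarrow> complex) set" where
  "schwartz = {\<phi>. \<forall>bs\<in>lists Basis. partial_deriv bs \<phi> differentiable_on UNIV \<and>
     (\<forall>k::nat. bounded (range (\<lambda>x. norm x ^ k *\<^sub>R partial_deriv bs \<phi> x)))}"

definition fourier :: "('a::euclidean_space \<Rightarrow> complex) \<Rightarrow> 'a \<Rightarrow> complex" where
  "fourier \<phi> \<xi> = (\<integral>x. cis (- (\<xi> \<bullet> x)) * \<phi> x \<partial>lborel)"

definition inverse_fourier :: "('a::euclidean_space \<Rightarrow> complex) \<Rightarrow> 'a \<Rightarrow> complex" where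
  "inverse_fourier \<phi> x =
     (\<integral>\<xi>. cis (\<xi> \<bullet> x) * \<phi> \<xi> \<partial>lborel) / complex_of_real ((2 * pi) ^ DIM('a))"

text \<open>The operator \<open>\<langle>\<nabla>\<rangle>\<^sup>s = (1 - \<Delta>)\<^bsup>s/2\<^esup>\<close> on Schwartz functions.\<close>

definition bracket_nabla_fun ::
  "real \<Rightarrow> ('a::euclidean_space \<Rightarrow> complex) \<Rightarrow> 'a \<Rightarrow> complex" where
  "bracket_nabla_fun s \<phi> =
     inverse_fourier (\<lambda>\<xi>. complex_of_real ((1 + (norm \<xi>)\<^sup>2) powr (s / 2)) * fourier \<phi> \<xi>)"

text \<open>
  For a positive exponent this operator maps square integrable functions out of that space, and
  it is needed for exponents of both signs; so it is extended to distributions.  These are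
  functionals on \<^const>\<open>schwartz\<close>, \<^const>\<open>undefined\<close> elsewhere.  The pairing is
  bilinear and the symbol is even, so the extension is by transposition without conjugates.
\<close>

type_synonym 'a distribution = "('a \<Rightarrow> complex) \<Rightarrow> complex"

definition bracket_nabla ::
  "real \<Rightarrow> 'a::euclidean_space distribution \<Rightarrow> 'a distribution" ("\<langle>\<nabla>\<rangle>") where
  "\<langle>\<nabla>\<rangle> s T = (\<lambda>\<phi>\<in>schwartz. T (bracket_nabla_fun s \<phi>))"

lift_definition L2_distribution :: "'a::euclidean_space L2 \<Rightarrow> 'a distribution"
  is "\<lambda>f. \<lambda>\<phi>\<in>schwartz. \<integral>x. f x * \<phi> x \<partial>lborel"
proof (rule restrict_ext)
  fix f g \<phi> :: "'a \<Rightarrow> complex" assume r: "L2_rel f g" and "\<phi> \<in> schwartz"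
  then have "partial_deriv [] \<phi> differentiable_on UNIV" unfolding schwartz_def by blast
  then have "continuous_on UNIV \<phi>"
    by (simp add: differentiable_imp_continuous_on)
  then have [measurable]: "\<phi> \<in> borel_measurable borel" by (rule borel_measurable_continuous_onI)
  have [measurable]: "f \<in> borel_measurable lborel" "g \<in> borel_measurable lborel"
    using r by (auto simp: L2_rel_def square_integrable_def)
  have "AE x in lborel. f x = g x" using r by (simp add: L2_rel_def)
  then have "AE x in lborel. f x * \<phi> x = g x * \<phi> x" by eventually_elim simp
  then show "(\<integral>x. f x * \<phi> x \<partial>lborel) = (\<integral>x. g x * \<phi> x \<partial>lborel)"
    by (intro integral_cong_AE) auto
qed

text \<open>
  \<open>acts_as X A\<close>: the operator \<open>X\<close> on distributions maps square integrable functions to square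
  integrable functions, and there it is the bounded operator \<open>A\<close>.  Only these values of \<open>X\<close>
  are used.  In particular, in \<open>\<langle>\<nabla>\<rangle> \<sigma> \<circ> \<gamma> \<circ> \<langle>\<nabla>\<rangle> \<sigma>\<close> only the values of \<open>\<gamma>\<close> on the Sobolev space
  of order \<open>-\<sigma>\<close> matter, and they lie in the Sobolev space of order \<open>\<sigma>\<close>.
\<close>

definition acts_as ::
  "('a::euclidean_space distribution \<Rightarrow> 'a distribution) \<Rightarrow> ('a L2 \<Rightarrow>\<^sub>L 'a L2) \<Rightarrow> bool" where
  "acts_as X A \<longleftrightarrow> (\<forall>f. X (L2_distribution f) = L2_distribution (A f))"

definition Schatten :: "real \<Rightarrow> ('a::euclidean_space distribution \<Rightarrow> 'a distribution) set" where
  "Schatten r = {X. \<exists>A\<in>schatten r. acts_as X A}"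

definition has_svd :: "('a::euclidean_space distribution \<Rightarrow> 'a distribution) \<Rightarrow>
    (nat \<Rightarrow> real) \<Rightarrow> (nat \<Rightarrow> 'a L2) \<Rightarrow> (nat \<Rightarrow> 'a L2) \<Rightarrow> bool" where
  "has_svd X a u v \<longleftrightarrow> (\<exists>A. acts_as X A \<and> is_svd A a u v)"

text \<open>Meaningful on the range of \<^const>\<open>L2_distribution\<close> only.\<close>

definition on_distributions ::
  "('a::euclidean_space L2 \<Rightarrow>\<^sub>L 'a L2) \<Rightarrow> 'a distribution \<Rightarrow> 'a distribution" where
  "on_distributions A = L2_distribution \<circ> blinfun_apply A \<circ> inv L2_distribution"

text \<open>
  The operator \<open>\<gamma>\<^sub>0\<^bsup>\<omega>;\<sigma>\<^esup>\<close>, where \<open>a, u, v\<close> is the chosen singular value decomposition of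
  \<open>\<langle>\<nabla>\<rangle> \<sigma> \<circ> \<gamma>\<^sub>0 \<circ> \<langle>\<nabla>\<rangle> \<sigma>\<close>.
\<close>

definition randomized_data :: "real \<Rightarrow> (nat \<Rightarrow> 'w \<Rightarrow> real) \<Rightarrow> (nat \<Rightarrow> real) \<Rightarrow>
    (nat \<Rightarrow> 'a::euclidean_space L2) \<Rightarrow> (nat \<Rightarrow> 'a L2) \<Rightarrow> 'w \<Rightarrow> 'a distribution \<Rightarrow> 'a distribution" where
  "randomized_data \<sigma> g a u v \<omega> =
     \<langle>\<nabla>\<rangle> (- \<sigma>) \<circ> on_distributions (randomize g a u v \<omega>) \<circ> \<langle>\<nabla>\<rangle> (- \<sigma>)"

end

theory Submission
  imports Defs
begin

text \<open>
  For an operator with singular value decomposition \<open>\<Sum>n. b n |u n\<rangle>\<langle>v n|\<close>, membership in the Schatten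
  class of exponent \<open>r\<close> means \<open>\<Sum>n. \<bar>b n\<bar>\<^sup>r < \<infinity>\<close>, so the claim is about the random series
  \<open>\<Sum>n. \<bar>a n g n\<bar>\<^sup>r\<close>.  For \<open>r = \<alpha>\<close> it has finite expectation, since the subgaussian bound controls the
  absolute moments of the \<open>g n\<close> uniformly.  For \<open>r = \<beta>\<close> the expectation of the exponential of minus
  its partial sums is a product by independence; for large \<open>n\<close> a fixed proportion of the mass of
  \<open>g n\<close> lies away from \<open>0\<close>, so this product tends to \<open>0\<close> and the series diverges almost surely.

  That the operators \<open>\<langle>\<nabla>\<rangle> \<sigma>\<close> and \<open>\<langle>\<nabla>\<rangle> (- \<sigma>)\<close> on distributions cancel follows from Fourier inversion
  on Schwartz functions, and the operator on square integrable functions is determined by its action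
  on distributions because Gaussians already separate square integrable functions.
\<close>

section \<open>Square integrable functions as a Hilbert space\<close>

text \<open>\<open>Schatten\<close> and \<open>randomize\<close> both contain choices that have to
  be pinned down. Membership in \<open>Schatten\<close> asks for some bounded operator that the map
  of distributions acts as, so non-membership can be tested on one operator only if that operator is
  unique. This, and the \<open>inv L2_distribution\<close> inside \<open>on_distributions\<close>,
  is what injectivity of \<open>L2_distribution\<close> is for. The series in
  \<open>randomize\<close> has a meaning only where it converges in operator norm; for a diagonal
  series this amounts to coefficients tending to 0, which summability for \<alpha> supplies almost
  surely.

  Completeness of \<open>L2\<close> carries the operator side: Parseval's identity in every
  orthonormal basis, over which \<open>has_trace\<close> quantifies, operator norm convergence of
  diagonal series, and compactness through total boundedness.

  For the divergence, the exponential of minus the series is preferred to truncation arguments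
  because it turns independence into a product of expectations at once, with all factors between 0
  and 1.\<close>

lemma square_integrable_rep_L2: "square_integrable (rep_L2 f)"
  using Quotient_rep_reflp[OF Quotient_L2, of f] by (simp add: L2_rel_def)

lemma borel_measurable_rep_L2 [measurable]: "rep_L2 f \<in> borel_measurable borel"
  using square_integrable_rep_L2[of f] by (simp add: square_integrable_def)

lemma L2_relI: "square_integrable f \<Longrightarrow> L2_rel f f"
  by (simp add: L2_rel_def)

lemma L2_rel_rep_abs: "square_integrable f \<Longrightarrow> L2_rel (rep_L2 (abs_L2 f)) f"
  using Quotient_rep_abs[OF Quotient_L2] L2_relI by blast

lemma cinner_eq_integral: "cinner f g = (\<integral>x. cnj (rep_L2 f x) * rep_L2 g x \<partial>lborel)"
  by (simp add: cinner_def)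

lemma norm_L2_square: "(norm f)\<^sup>2 = (\<integral>x. (cmod (rep_L2 f x))\<^sup>2 \<partial>lborel)"
proof -
  have "cinner f f = (\<integral>x. complex_of_real ((cmod (rep_L2 f x))\<^sup>2) \<partial>lborel)"
    unfolding cinner_eq_integral
    by (rule Bochner_Integration.integral_cong)
      (simp_all only: complex_norm_square mult.commute)
  also have "\<dots> = complex_of_real (\<integral>x. (cmod (rep_L2 f x))\<^sup>2 \<partial>lborel)"
    by (rule integral_complex_of_real)
  finally show ?thesis by (simp add: norm_L2_def inner_L2_def)
qed

lemma ennreal_norm_L2_square:
  "ennreal ((norm f)\<^sup>2) = (\<integral>\<^sup>+x. ennreal ((cmod (rep_L2 f x))\<^sup>2) \<partial>lborel)"
  unfolding norm_L2_square using square_integrable_rep_L2[of f]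
  by (intro nn_integral_eq_integral[symmetric]) (auto simp: square_integrable_def)

lemma rep_L2_add: "AE x in lborel. rep_L2 (f + g) x = rep_L2 f x + rep_L2 g x"
proof -
  have "L2_rel (rep_L2 (abs_L2 (\<lambda>x. rep_L2 f x + rep_L2 g x))) (\<lambda>x. rep_L2 f x + rep_L2 g x)"
    by (intro L2_rel_rep_abs square_integrable_add square_integrable_rep_L2)
  moreover have "abs_L2 (\<lambda>x. rep_L2 f x + rep_L2 g x) = f + g"
    by (simp add: plus_L2_def)
  ultimately show ?thesis by (simp add: L2_rel_def)
qed

lemma rep_L2_scaleC: "AE x in lborel. rep_L2 (c *\<^sub>C f) x = c * rep_L2 f x"
proof -
  have "L2_rel (rep_L2 (abs_L2 (\<lambda>x. c * rep_L2 f x))) (\<lambda>x. c * rep_L2 f x)"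
    by (intro L2_rel_rep_abs square_integrable_cmult square_integrable_rep_L2)
  moreover have "abs_L2 (\<lambda>x. c * rep_L2 f x) = c *\<^sub>C f"
    by (simp add: scaleC_def)
  ultimately show ?thesis by (simp add: L2_rel_def)
qed

lemma rep_L2_diff: "AE x in lborel. rep_L2 (f - g) x = rep_L2 f x - rep_L2 g x"
proof -
  have "f - g = f + (-1) *\<^sub>C g" by (simp add: minus_L2_def uminus_L2_def)
  moreover from rep_L2_add[of f "(-1) *\<^sub>C g"] rep_L2_scaleC[of "-1" g]
  have "AE x in lborel. rep_L2 (f + (-1) *\<^sub>C g) x = rep_L2 f x - rep_L2 g x"
    by eventually_elim simp
  ultimately show ?thesis by (simp only:)
qed

lemma rep_L2_abs: "square_integrable f \<Longrightarrow> AE x in lborel. rep_L2 (abs_L2 f) x = f x"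
  using L2_rel_rep_abs[of f] by (simp add: L2_rel_def)

text \<open>With extended nonnegative integrals, monotone convergence and Fatou's lemma apply before
  the limit is known to be square integrable.\<close>

lemma ennreal_norm_diff_square:
  "ennreal ((norm (f - g))\<^sup>2) = (\<integral>\<^sup>+x. ennreal ((cmod (rep_L2 f x - rep_L2 g x))\<^sup>2) \<partial>lborel)"
  unfolding ennreal_norm_L2_square
  by (rule nn_integral_cong_AE, use rep_L2_diff[of f g] in eventually_elim) simp

text \<open>
  A sequence with distances at most \<open>2\<^sup>-\<^sup>k\<close> converges almost everywhere, because the weighted sum of
  squares \<open>\<Sum>k. 2\<^sup>k \<bar>f\<^sub>k\<^sub>+\<^sub>1 - f\<^sub>k\<bar>\<^sup>2\<close> has finite integral; Fatou's lemma gives convergence in norm.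
\<close>

lemma L2_fast_Cauchy_convergent:
  fixes X :: "nat \<Rightarrow> 'a::euclidean_space L2"
  assumes X: "\<And>k. norm (X (Suc k) - X k) \<le> (1 / 2) ^ k" and C: "Cauchy X"
  shows "convergent X"
proof -
  define d where "d k x = cmod (rep_L2 (X (Suc k)) x - rep_L2 (X k) x)" for k x
  have [measurable]: "d k \<in> borel_measurable borel" for k unfolding d_def by measurable
  have "(\<integral>\<^sup>+x. (\<Sum>k. ennreal (2 ^ k * (d k x)\<^sup>2)) \<partial>lborel)
      = (\<Sum>k. ennreal (2 ^ k) * ennreal ((norm (X (Suc k) - X k))\<^sup>2))"
    by (subst nn_integral_suminf)
      (auto simp: ennreal_mult d_def ennreal_norm_diff_square nn_integral_cmult)
  also have "\<dots> \<le> (\<Sum>k. ennreal ((1 / 2) ^ k))"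
  proof (intro suminf_le summableI)
    fix k
    have "2 ^ k * (norm (X (Suc k) - X k))\<^sup>2 \<le> 2 ^ k * ((1 / 2) ^ k)\<^sup>2"
      using X[of k] by (intro mult_left_mono power_mono) auto
    also have "\<dots> = (1 / 2) ^ k"
      by (simp add: power2_eq_square power_divide)
    finally show "ennreal (2 ^ k) * ennreal ((norm (X (Suc k) - X k))\<^sup>2) \<le> ennreal ((1 / 2) ^ k)"
      by (simp add: ennreal_mult'[symmetric] ennreal_leI)
  qed
  also have "\<dots> < \<infinity>"
    by (subst suminf_ennreal2) (auto simp: summable_geometric)
  finally have "AE x in lborel. (\<Sum>k. ennreal (2 ^ k * (d k x)\<^sup>2)) \<noteq> \<infinity>"
    by (intro nn_integral_noteq_infinite) auto
  then have conv: "AE x in lborel. convergent (\<lambda>k. rep_L2 (X k) x)"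
  proof eventually_elim
    fix x assume "(\<Sum>k. ennreal (2 ^ k * (d k x)\<^sup>2)) \<noteq> \<infinity>"
    then have s: "summable (\<lambda>k. 2 ^ k * (d k x)\<^sup>2)"
      by (intro summable_suminf_not_top) auto
    have "summable (\<lambda>k. d k x)"
    proof (rule summable_comparison_test')
      show "summable (\<lambda>k. 2 ^ k * (d k x)\<^sup>2 + (1 / 2 :: real) ^ k)"
        by (intro summable_add s) (simp add: summable_geometric)
      fix k :: nat
      \<comment> \<open>Expanding this square bounds \<open>d k x\<close> by
        \<open>2 ^ k * (d k x)\<^sup>2 + (1 / 2) ^ k\<close>, which turns weighted square
        summability into absolute summability.\<close>
      have "0 \<le> (2 ^ k * d k x - 1)\<^sup>2" by simp
      then have "2 * (2 ^ k * d k x) \<le> (2 ^ k * d k x)\<^sup>2 + 1"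
        by (simp add: power2_eq_square algebra_simps)
      then have "2 * d k x \<le> 2 ^ k * (d k x)\<^sup>2 + (1 / 2) ^ k"
        by (simp add: field_simps power2_eq_square)
      moreover have "0 \<le> d k x" by (simp add: d_def)
      ultimately show "norm (d k x) \<le> 2 ^ k * (d k x)\<^sup>2 + (1 / 2) ^ k" by simp
    qed
    then have "summable (\<lambda>k. rep_L2 (X (Suc k)) x - rep_L2 (X k) x)"
      unfolding d_def by (rule summable_norm_cancel)
    then have "convergent (\<lambda>n. \<Sum>k<n. rep_L2 (X (Suc k)) x - rep_L2 (X k) x)"
      by (simp add: summable_iff_convergent)
    then have "convergent (\<lambda>n. rep_L2 (X n) x - rep_L2 (X 0) x)"
      by (subst (asm) sum_lessThan_telescope)
    then show "convergent (\<lambda>k. rep_L2 (X k) x)"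
      using convergent_add_const_right_iff[of "\<lambda>n. rep_L2 (X n) x" "- rep_L2 (X 0) x"] by simp
  qed
  \<comment> \<open>Where the sequence diverges, \<open>lim\<close> is an unspecified value; these
    points form a null set, and \<open>F\<close> is measurable all the same.\<close>
  define F where "F x = lim (\<lambda>k. rep_L2 (X k) x)" for x
  have [measurable]: "F \<in> borel_measurable borel" unfolding F_def by measurable
  have lim: "AE x in lborel. (\<lambda>k. rep_L2 (X k) x) \<longlonglongrightarrow> F x"
    using conv by eventually_elim (simp add: F_def convergent_LIMSEQ_iff)
  have fatou: "(\<integral>\<^sup>+x. ennreal ((cmod (F x - rep_L2 (X k) x))\<^sup>2) \<partial>lborel) \<le> ennreal (e\<^sup>2)"
    if "\<And>m. k \<le> m \<Longrightarrow> norm (X m - X k) \<le> e" for k e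
  proof -
    have "(\<integral>\<^sup>+x. ennreal ((cmod (F x - rep_L2 (X k) x))\<^sup>2) \<partial>lborel)
       = (\<integral>\<^sup>+x. liminf (\<lambda>m. ennreal ((cmod (rep_L2 (X m) x - rep_L2 (X k) x))\<^sup>2)) \<partial>lborel)"
    proof (rule nn_integral_cong_AE, use lim in eventually_elim)
      fix x assume "(\<lambda>k. rep_L2 (X k) x) \<longlonglongrightarrow> F x"
      then have "(\<lambda>m. ennreal ((cmod (rep_L2 (X m) x - rep_L2 (X k) x))\<^sup>2))
          \<longlonglongrightarrow> ennreal ((cmod (F x - rep_L2 (X k) x))\<^sup>2)"
        by (intro tendsto_intros)
      then show "ennreal ((cmod (F x - rep_L2 (X k) x))\<^sup>2)
          = liminf (\<lambda>m. ennreal ((cmod (rep_L2 (X m) x - rep_L2 (X k) x))\<^sup>2))"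
        by (intro lim_imp_Liminf[symmetric]) auto
    qed
    also have "\<dots> \<le> liminf (\<lambda>m. \<integral>\<^sup>+x. ennreal ((cmod (rep_L2 (X m) x - rep_L2 (X k) x))\<^sup>2) \<partial>lborel)"
      by (rule nn_integral_liminf) auto
    also have "\<dots> = liminf (\<lambda>m. ennreal ((norm (X m - X k))\<^sup>2))"
      by (simp add: ennreal_norm_diff_square)
    also have "\<dots> \<le> ennreal (e\<^sup>2)"
    proof (rule order_trans[OF Liminf_mono])
      show "eventually (\<lambda>m. ennreal ((norm (X m - X k))\<^sup>2) \<le> ennreal (e\<^sup>2)) sequentially"
        using that by (auto simp: eventually_sequentially intro!: exI[of _ k] ennreal_leI power_mono)
    qed (simp add: Liminf_const)
    finally show ?thesis .
  qed
  have Ce: "\<exists>N. \<forall>k\<ge>N. \<forall>m\<ge>N. norm (X m - X k) < e" if "e > 0" for e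
    using CauchyD[OF C that] by blast
  obtain N where N: "\<And>m. N \<le> m \<Longrightarrow> norm (X m - X N) \<le> 1"
    using Ce[of 1] by (auto intro: less_imp_le)
  \<comment> \<open>Fatou's lemma controls only the distance from \<open>F\<close> to members of the
    sequence; adding \<open>X N\<close> back gives square integrability of \<open>F\<close>
    itself.\<close>
  have "square_integrable (\<lambda>x. F x - rep_L2 (X N) x)"
    unfolding square_integrable_def integrable_iff_bounded
    using fatou[OF N] by (auto simp: less_top[symmetric] top_unique)
  from square_integrable_add[OF this square_integrable_rep_L2[of "X N"]]
  have sqF: "square_integrable F" by simp
  have "X \<longlonglongrightarrow> abs_L2 F"
  proof (rule LIMSEQ_I)
    fix e :: real assume "e > 0"
    then obtain N where N: "\<And>k m. N \<le> k \<Longrightarrow> N \<le> m \<Longrightarrow> norm (X m - X k) < e / 2"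
      using Ce[of "e / 2"] by auto
    show "\<exists>N. \<forall>n\<ge>N. norm (X n - abs_L2 F) < e"
    proof (intro exI allI impI)
      fix k assume "N \<le> k"
      then have "(\<integral>\<^sup>+x. ennreal ((cmod (F x - rep_L2 (X k) x))\<^sup>2) \<partial>lborel) \<le> ennreal ((e / 2)\<^sup>2)"
        using N by (intro fatou less_imp_le) auto
      also have "(\<integral>\<^sup>+x. ennreal ((cmod (F x - rep_L2 (X k) x))\<^sup>2) \<partial>lborel)
          = ennreal ((norm (abs_L2 F - X k))\<^sup>2)"
        unfolding ennreal_norm_diff_square
        by (rule nn_integral_cong_AE, use rep_L2_abs[OF sqF] in eventually_elim) simp
      finally have "norm (abs_L2 F - X k) \<le> e / 2"
        using \<open>e > 0\<close> by (simp add: ennreal_le_iff power2_le_iff_abs_le)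
      then show "norm (X k - abs_L2 F) < e"
        using \<open>e > 0\<close> by (simp add: norm_minus_commute)
    qed
  qed
  then show ?thesis by (rule convergentI)
qed

instance L2 :: (euclidean_space) banach
proof
  fix X :: "nat \<Rightarrow> 'a L2" assume C: "Cauchy X"
  have "\<exists>N. \<forall>m\<ge>N. \<forall>n\<ge>N. norm (X m - X n) < (1 / 2) ^ k" for k :: nat
    using CauchyD[OF C] by (simp add: zero_less_power)
  then obtain N where N: "\<And>k m n. N k \<le> m \<Longrightarrow> N k \<le> n \<Longrightarrow> norm (X m - X n) < (1 / 2) ^ k"
    by metis
  \<comment> \<open>The sum makes the indices strictly increasing and at least \<open>N k\<close>,
    although \<open>N\<close> need not be monotone.\<close>
  define r where "r k = (\<Sum>j\<le>k. Suc (N j))" for k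
  have r: "strict_mono r" unfolding strict_mono_Suc_iff by (simp add: r_def)
  have Nr: "N k \<le> r k" for k
    unfolding r_def using member_le_sum[of k "{..k}" "\<lambda>j. Suc (N j)"] by simp
  have "N k \<le> r (Suc k)" for k using Nr[of k] by (simp add: r_def)
  with Nr N have "norm ((X \<circ> r) (Suc k) - (X \<circ> r) k) \<le> (1 / 2) ^ k" for k
    by (auto intro!: less_imp_le)
  then have "convergent (X \<circ> r)"
    by (rule L2_fast_Cauchy_convergent) (rule Cauchy_subseq_Cauchy[OF C r])
  then obtain l where "(X \<circ> r) \<longlonglongrightarrow> l" by (auto simp: convergent_def)
  then have "X \<longlonglongrightarrow> l" by (rule Cauchy_converges_subseq[OF C r])
  then show "convergent X" by (rule convergentI)
qed

section \<open>Orthonormal families: Bessel, Parseval and extension to a basis\<close>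

definition orthonormal_on :: "('i \<Rightarrow> 'a::euclidean_space L2) \<Rightarrow> 'i set \<Rightarrow> bool" where
  "orthonormal_on e I \<longleftrightarrow> (\<forall>i\<in>I. \<forall>j\<in>I. cinner (e i) (e j) = (if i = j then 1 else 0))"

lemma orthonormal_onD:
  "orthonormal_on e I \<Longrightarrow> i \<in> I \<Longrightarrow> j \<in> I \<Longrightarrow> cinner (e i) (e j) = (if i = j then 1 else 0)"
  by (simp add: orthonormal_on_def)

lemma orthonormal_on_subset: "orthonormal_on e I \<Longrightarrow> J \<subseteq> I \<Longrightarrow> orthonormal_on e J"
  unfolding orthonormal_on_def by blast

text \<open>One notion with an index set covers the singular sequences and, with the family
  \<open>id\<close>, bases given as sets.\<close>

lemma orthonormal_system_iff: "orthonormal_system u \<longleftrightarrow> orthonormal_on u UNIV"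
  by (simp add: orthonormal_system_def orthonormal_on_def)

lemma orthonormal_basis_iff:
  "orthonormal_basis E \<longleftrightarrow> orthonormal_on id E \<and> (\<forall>f. (\<forall>e\<in>E. cinner e f = 0) \<longrightarrow> f = 0)"
  by (simp add: orthonormal_basis_def orthonormal_on_def)

lemma cinner_zero_right [simp]: "cinner f 0 = 0"
  using cinner_add_right[of f 0 0] by simp

lemma cinner_sum_right: "cinner f (sum X I) = (\<Sum>i\<in>I. cinner f (X i))"
  by (induction I rule: infinite_finite_induct) (auto simp: cinner_add_right)

lemma cinner_scaleR_right: "cinner f (r *\<^sub>R g) = of_real r * cinner f g"
  by (simp add: scaleR_L2_def cinner_scaleC_right)

lemma cinner_diff_right: "cinner f (g - h) = cinner f g - cinner f h"
  using cinner_add_right[of f "g - h" h] by simp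

lemma cinner_self_norm: "cinner f f = complex_of_real ((norm f)\<^sup>2)"
  using cinner_self[of f] by (simp add: norm_L2_def inner_L2_def)

lemma bounded_linear_cinner_right: "bounded_linear (cinner f)"
  by (rule bounded_linear_intro[where K = "norm f"])
    (auto simp: cinner_add_right cinner_scaleR_right scaleR_conv_of_real
      intro: order_trans[OF norm_cinner_le] simp: mult.commute)

lemma scaleC_0_left [simp]: "0 *\<^sub>C f = 0" for f :: "'a::euclidean_space L2"
  using scaleC_add_left[of 0 0 f] by simp

lemma scaleC_diff_left: "(c - d) *\<^sub>C f = c *\<^sub>C f - d *\<^sub>C f" for f :: "'a::euclidean_space L2"
  using scaleC_add_left[of "c - d" d f] by simp

lemma bounded_linear_scaleC_right: "bounded_linear (\<lambda>f :: 'a::euclidean_space L2. c *\<^sub>C f)"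
  by (rule bounded_linear_intro[where K = "cmod c"])
    (auto simp: scaleC_add_right scaleR_L2_def scaleC_scaleC mult.commute norm_scaleC)

lemma bounded_linear_scaleC_left: "bounded_linear (\<lambda>c. c *\<^sub>C (f :: 'a::euclidean_space L2))"
  by (rule bounded_linear_intro[where K = "norm f"])
    (auto simp: scaleC_add_left scaleR_L2_def scaleC_scaleC norm_scaleC scaleR_conv_of_real)

text \<open>The real inner product is the real part of the complex one, so orthogonality in the
  complex sense is enough for the real form of Pythagoras' theorem.\<close>

lemma norm_orthonormal_sum:
  assumes "orthonormal_on e I" "finite I"
  shows "(norm (\<Sum>i\<in>I. c i *\<^sub>C e i))\<^sup>2 = (\<Sum>i\<in>I. (cmod (c i))\<^sup>2)"
proof -
  have "(norm (\<Sum>i\<in>I. c i *\<^sub>C e i))\<^sup>2 = (\<Sum>i\<in>I. (norm (c i *\<^sub>C e i))\<^sup>2)"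
    using assms by (intro norm_sum_Pythagorean)
      (auto simp: pairwise_def orthogonal_def inner_L2_def orthonormal_on_def
        cinner_scaleC_left cinner_scaleC_right)
  also have "\<dots> = (\<Sum>i\<in>I. (cmod (c i))\<^sup>2)"
  proof (rule sum.cong[OF refl])
    fix i assume "i \<in> I"
    then have "norm (e i) = 1"
      using assms by (simp add: norm_L2_def inner_L2_def orthonormal_on_def)
    then show "(norm (c i *\<^sub>C e i))\<^sup>2 = (cmod (c i))\<^sup>2" by (simp add: norm_scaleC)
  qed
  finally show ?thesis .
qed

lemma cinner_orthonormal_sum:
  assumes "orthonormal_on e I" "finite J" "J \<subseteq> I" "i \<in> I"
  shows "cinner (e i) (\<Sum>j\<in>J. c j *\<^sub>C e j) = (if i \<in> J then c i else 0)"
proof -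
  have "cinner (e i) (\<Sum>j\<in>J. c j *\<^sub>C e j) = (\<Sum>j\<in>J. if i = j then c j else 0)"
    unfolding cinner_sum_right cinner_scaleC_right using assms
    by (intro sum.cong) (auto simp: orthonormal_on_def)
  also have "\<dots> = (if i \<in> J then c i else 0)" using assms by simp
  finally show ?thesis .
qed

lemma norm_orthonormal_residual:
  assumes "orthonormal_on e I" "finite I"
  shows "(norm (f - (\<Sum>i\<in>I. cinner (e i) f *\<^sub>C e i)))\<^sup>2 = (norm f)\<^sup>2 - (\<Sum>i\<in>I. (cmod (cinner (e i) f))\<^sup>2)"
proof -
  define s where "s = (\<Sum>i\<in>I. cinner (e i) f *\<^sub>C e i)"
  have "cinner f s = (\<Sum>i\<in>I. complex_of_real ((cmod (cinner (e i) f))\<^sup>2))"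
    unfolding s_def cinner_sum_right cinner_scaleC_right
    by (intro sum.cong refl) (subst (2) cinner_commute, simp only: complex_norm_square)
  then have "inner f s = (norm s)\<^sup>2"
    using norm_orthonormal_sum[OF assms] by (simp add: inner_L2_def s_def)
  then have "(norm (f - s))\<^sup>2 = (norm f)\<^sup>2 - (norm s)\<^sup>2"
    by (simp add: power2_norm_eq_inner inner_diff_left inner_diff_right inner_commute)
  also have "(norm s)\<^sup>2 = (\<Sum>i\<in>I. (cmod (cinner (e i) f))\<^sup>2)"
    unfolding s_def by (rule norm_orthonormal_sum[OF assms])
  finally show ?thesis unfolding s_def .
qed

lemma Bessel_finite:
  assumes "orthonormal_on e I" "finite I"
  shows "(\<Sum>i\<in>I. (cmod (cinner (e i) f))\<^sup>2) \<le> (norm f)\<^sup>2"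
  using norm_orthonormal_residual[OF assms, of f]
    zero_le_power2[of "norm (f - (\<Sum>i\<in>I. cinner (e i) f *\<^sub>C e i))"] by linarith

lemma Bessel:
  assumes "orthonormal_on e I"
  shows "(\<lambda>i. (cmod (cinner (e i) f))\<^sup>2) summable_on I"
    and "(\<Sum>\<^sub>\<infinity>i\<in>I. (cmod (cinner (e i) f))\<^sup>2) \<le> (norm f)\<^sup>2"
proof -
  have le: "(\<Sum>i\<in>F. (cmod (cinner (e i) f))\<^sup>2) \<le> (norm f)\<^sup>2" if "finite F" "F \<subseteq> I" for F
    using Bessel_finite[OF orthonormal_on_subset[OF assms]] that by blast
  then show s: "(\<lambda>i. (cmod (cinner (e i) f))\<^sup>2) summable_on I"
    by (intro nonneg_bdd_above_summable_on) (auto simp: bdd_above_def)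
  show "(\<Sum>\<^sub>\<infinity>i\<in>I. (cmod (cinner (e i) f))\<^sup>2) \<le> (norm f)\<^sup>2"
    by (rule infsum_le_finite_sums[OF s le])
qed

text \<open>
  If the finite partial sums along \<open>F n\<close> exhaust the Bessel sum, the residuals form a Cauchy
  sequence whose limit is orthogonal to the whole basis.
\<close>

lemma Parseval:
  assumes "orthonormal_basis E"
  shows "((\<lambda>e. (cmod (cinner e f))\<^sup>2) has_sum (norm f)\<^sup>2) E"
proof -
  have on: "orthonormal_on id E" and tot: "\<And>f. (\<And>e. e \<in> E \<Longrightarrow> cinner e f = 0) \<Longrightarrow> f = 0"
    using assms by (auto simp: orthonormal_basis_iff)
  define w where "w e = (cmod (cinner e f))\<^sup>2" for e
  define s where "s = (\<Sum>\<^sub>\<infinity>e\<in>E. w e)"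
  have summ: "w summable_on E" using Bessel(1)[OF on, of f] by (simp add: w_def[abs_def])
  then have hs: "(w has_sum s) E" by (simp add: s_def has_sum_infsum)
  have le: "sum w F \<le> s" if "finite F" "F \<subseteq> E" for F
    unfolding s_def using that by (intro finite_sum_le_infsum summ) (auto simp: w_def)
  have "\<exists>F. finite F \<and> F \<subseteq> E \<and> s - 1 / Suc n < sum w F" for n
  proof -
    have "eventually (\<lambda>F. s - 1 / Suc n < sum w F) (finite_subsets_at_top E)"
      using hs unfolding has_sum_def by (rule order_tendstoD) simp
    then show ?thesis by (auto simp: eventually_finite_subsets_at_top)
  qed
  then obtain F where F: "\<And>n. finite (F n)" "\<And>n. F n \<subseteq> E" "\<And>n. s - 1 / Suc n < sum w (F n)"
    by metis
  define r where "r J = f - (\<Sum>e\<in>J. cinner e f *\<^sub>C e)" for J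
  have nr: "(norm (r J))\<^sup>2 = (norm f)\<^sup>2 - sum w J" if "finite J" "J \<subseteq> E" for J
    using norm_orthonormal_residual[OF orthonormal_on_subset[OF on that(2)] that(1), of f]
    by (simp add: r_def w_def)
  \<comment> \<open>Inside \<open>F n\<close> the coefficient has been subtracted; outside, its
    square is part of what the sum over \<open>F n\<close> misses of \<open>s\<close>, hence below
    \<open>1 / Suc n\<close>.\<close>
  have cr: "(cmod (cinner e (r (F n))))\<^sup>2 \<le> 1 / Suc n" if "e \<in> E" for e n
  proof (cases "e \<in> F n")
    case True
    then have "cinner e (r (F n)) = 0"
      using cinner_orthonormal_sum[OF on F(1) F(2) that, of "\<lambda>e. cinner e f" n]
      by (simp add: r_def cinner_diff_right)
    then show ?thesis by simp
  next
    case False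
    then have "cinner e (r (F n)) = cinner e f"
      using cinner_orthonormal_sum[OF on F(1) F(2) that, of "\<lambda>e. cinner e f" n]
      by (simp add: r_def cinner_diff_right)
    moreover have "w e + sum w (F n) \<le> s"
      using le[of "insert e (F n)"] False F that by simp
    ultimately show ?thesis using F(3)[of n] by (simp add: w_def)
  qed
  have dist: "(norm (r (F m) - r (F n)))\<^sup>2 \<le> 1 / Suc m + 1 / Suc n" for m n
  proof -
    define J where "J = (F m - F n) \<union> (F n - F m)"
    \<comment> \<open>The two residuals differ only on the symmetric difference of
      \<open>F m\<close> and \<open>F n\<close>, where the coefficient is that of \<open>f\<close>
      up to sign; hence the form of the squared modulus below.\<close>
    define c where "c e = (if e \<in> F n then cinner e f else 0) - (if e \<in> F m then cinner e f else 0)" for e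
    have "(\<Sum>e\<in>F k. cinner e f *\<^sub>C e) = (\<Sum>e\<in>F m \<union> F n. (if e \<in> F k then cinner e f else 0) *\<^sub>C e)"
      if "k = m \<or> k = n" for k
      using that F(1) by (intro sum.mono_neutral_cong_left) auto
    then have "r (F m) - r (F n) = (\<Sum>e\<in>F m \<union> F n. c e *\<^sub>C id e)"
      by (simp add: r_def c_def scaleC_diff_left sum_subtractf)
    then have "(norm (r (F m) - r (F n)))\<^sup>2 = (\<Sum>e\<in>F m \<union> F n. (cmod (c e))\<^sup>2)"
      using norm_orthonormal_sum[OF orthonormal_on_subset[OF on], of "F m \<union> F n" c] F by simp
    also have "\<dots> = (\<Sum>e\<in>F m \<union> F n. 2 * w e - (if e \<in> F n then w e else 0) - (if e \<in> F m then w e else 0))"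
      by (intro sum.cong) (auto simp: c_def w_def)
    also have "\<dots> = 2 * sum w (F m \<union> F n) - sum w (F n) - sum w (F m)"
      using F(1) by (simp add: sum_subtractf sum_distrib_left sum.If_cases Int_absorb1 Int_absorb2 Un_Int_distrib2)
    also have "\<dots> \<le> 1 / Suc m + 1 / Suc n"
      using le[of "F m \<union> F n"] F(1,2) F(3)[of m] F(3)[of n] by simp
    finally show ?thesis .
  qed
  have inv0: "(\<lambda>n. 1 / real (Suc n)) \<longlonglongrightarrow> 0"
    using LIMSEQ_inverse_real_of_nat by (simp add: inverse_eq_divide)
  have "Cauchy (\<lambda>n. r (F n))"
  proof (rule CauchyI)
    fix d :: real assume "d > 0"
    then obtain N where N: "\<And>n. N \<le> n \<Longrightarrow> 1 / real (Suc n) < d\<^sup>2 / 2"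
      using order_tendstoD(2)[OF inv0, of "d\<^sup>2 / 2"] by (auto simp: eventually_sequentially)
    have "norm (r (F m) - r (F n)) < d" if "N \<le> m" "N \<le> n" for m n
    proof (rule power2_less_imp_less)
      show "(norm (r (F m) - r (F n)))\<^sup>2 < d\<^sup>2"
        using dist[of m n] N[OF that(1)] N[OF that(2)] by linarith
    qed (use \<open>d > 0\<close> in auto)
    then show "\<exists>M. \<forall>m\<ge>M. \<forall>n\<ge>M. norm (r (F m) - r (F n)) < d" by blast
  qed
  then obtain g where g: "(\<lambda>n. r (F n)) \<longlonglongrightarrow> g"
    using Cauchy_convergent convergent_def by blast
  have "cinner e g = 0" if "e \<in> E" for e
  proof -
    have "(\<lambda>n. (cmod (cinner e (r (F n))))\<^sup>2) \<longlonglongrightarrow> (cmod (cinner e g))\<^sup>2"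
      by (intro tendsto_intros bounded_linear.tendsto[OF bounded_linear_cinner_right] g)
    then have "(cmod (cinner e g))\<^sup>2 \<le> 0"
      by (rule LIMSEQ_le[OF _ inv0]) (use cr[OF that] in auto)
    then show ?thesis by simp
  qed
  then have "g = 0" by (rule tot)
  have "(\<lambda>n. (norm (r (F n)))\<^sup>2) \<longlonglongrightarrow> (norm g)\<^sup>2" by (intro tendsto_intros g)
  moreover have "(norm f)\<^sup>2 - s \<le> (norm (r (F n)))\<^sup>2" for n
    using nr[of "F n"] le[of "F n"] F by simp
  ultimately have "(norm f)\<^sup>2 - s \<le> (norm g)\<^sup>2"
    by (intro LIMSEQ_le_const) auto
  then have "(norm f)\<^sup>2 \<le> s" using \<open>g = 0\<close> by simp
  moreover have "s \<le> (norm f)\<^sup>2" using Bessel(2)[OF on, of f] by (simp add: s_def w_def)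
  ultimately show ?thesis using hs by (simp add: w_def[abs_def])
qed

text \<open>By Zorn's lemma. A basis is here a system to which only 0 is orthogonal, so a maximal
  system qualifies directly: a nonzero orthogonal vector could be normalised and added, with no
  projection onto a closed span.\<close>

lemma orthonormal_basis_extend:
  assumes "orthonormal_on id S"
  obtains E where "orthonormal_basis E" "S \<subseteq> E"
proof -
  define A where "A = {E. orthonormal_on id E \<and> S \<subseteq> E}"
  have "\<exists>E\<in>A. \<forall>X\<in>A. E \<subseteq> X \<longrightarrow> X = E"
  proof (rule subset_Zorn_nonempty)
    show "A \<noteq> {}" using assms by (auto simp: A_def)
    fix C assume C: "C \<noteq> {}" "subset.chain A C"
    have "orthonormal_on id (\<Union>C)"
      unfolding orthonormal_on_def
    proof (intro ballI)
      fix e e' assume "e \<in> \<Union>C" "e' \<in> \<Union>C"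
      then obtain X where "X \<in> C" "e \<in> X" "e' \<in> X"
        using C(2) by (auto simp: subset_chain_def) (metis subsetD)
      moreover have "orthonormal_on id X"
        using \<open>X \<in> C\<close> C(2) by (auto simp: subset_chain_def A_def)
      ultimately show "cinner (id e) (id e') = (if e = e' then 1 else 0)"
        by (auto simp: orthonormal_on_def)
    qed
    moreover have "S \<subseteq> \<Union>C" using C unfolding subset_chain_def A_def by blast
    ultimately show "\<Union>C \<in> A" by (simp add: A_def)
  qed
  then obtain E where E: "E \<in> A" "\<And>X. X \<in> A \<Longrightarrow> E \<subseteq> X \<Longrightarrow> X = E" by blast
  have "f = 0" if f: "\<forall>e\<in>E. cinner e f = 0" for f
  proof (rule ccontr)
    assume "f \<noteq> 0"
    define h where "h = f /\<^sub>R norm f"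
    have hh: "cinner h h = 1" using \<open>f \<noteq> 0\<close> by (simp add: h_def cinner_self_norm)
    have h: "cinner e h = 0" "cinner h e = 0" if "e \<in> E" for e
      using f that cinner_commute[of h e]
      by (auto simp: h_def cinner_scaleR_right)
    have "insert h E \<in> A"
      using E(1) hh h by (auto simp: A_def orthonormal_on_def)
    then have "h \<in> E" using E(2) by blast
    then show False using h hh by auto
  qed
  then have "orthonormal_basis E" using E(1) by (auto simp: orthonormal_basis_iff A_def)
  then show ?thesis using E(1) that by (auto simp: A_def)
qed

section \<open>Schatten classes and singular values\<close>

text \<open>In contrast to \<open>is_svd\<close>, the coefficients may have either sign, as the
  random factors do; the absolute values \<open>\<bar>b n\<bar>\<close> then play the part of the
  singular values.\<close>

definition diag_series :: "(nat \<Rightarrow> real) \<Rightarrow> (nat \<Rightarrow> 'a::euclidean_space L2) \<Rightarrow> (nat \<Rightarrow> 'a L2)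
    \<Rightarrow> nat \<Rightarrow> 'a L2 \<Rightarrow>\<^sub>L 'a L2" where
  "diag_series b u v n = b n *\<^sub>R ketbra (u n) (v n)"

lemma diag_series_apply: "blinfun_apply (diag_series b u v n) f = (of_real (b n) * cinner (v n) f) *\<^sub>C u n"
  by (simp add: diag_series_def scaleR_blinfun.rep_eq ketbra.rep_eq scaleR_L2_def scaleC_scaleC)

lemma is_svd_iff:
  "is_svd A a u v \<longleftrightarrow>
    (\<forall>n. 0 \<le> a n) \<and> orthonormal_on u UNIV \<and> orthonormal_on v UNIV \<and> diag_series a u v sums A"
  by (simp add: is_svd_def orthonormal_system_iff diag_series_def[abs_def])

lemma orthonormal_on_norm: "orthonormal_on e I \<Longrightarrow> i \<in> I \<Longrightarrow> norm (e i) = 1"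
  by (simp add: norm_L2_def inner_L2_def orthonormal_on_def)

lemma diag_sums_apply:
  assumes "diag_series b u v sums A"
  shows "(\<lambda>n. (of_real (b n) * cinner (v n) f) *\<^sub>C u n) sums A f"
  using bounded_linear.sums[OF blinfun.bounded_linear_left assms, of f]
  by (simp add: diag_series_apply)

lemma diag_sums_cinner:
  assumes "diag_series b u v sums A"
  shows "(\<lambda>n. of_real (b n) * cinner (v n) f * cinner h (u n)) sums cinner h (A f)"
  using bounded_linear.sums[OF bounded_linear_cinner_right diag_sums_apply[OF assms], of h f]
  by (simp add: cinner_scaleC_right)

lemma diag_coordinate:
  assumes "diag_series b u v sums A" "orthonormal_on u UNIV"
  shows "cinner (u m) (A f) = of_real (b m) * cinner (v m) f"
proof -
  have "(\<lambda>n. of_real (b n) * cinner (v n) f * cinner (u m) (u n)) sums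
      (\<Sum>n\<in>{m}. of_real (b n) * cinner (v n) f * cinner (u m) (u n))"
    using assms(2) by (intro sums_finite) (auto simp: orthonormal_on_def)
  from sums_unique2[OF this diag_sums_cinner[OF assms(1)]] show ?thesis
    using assms(2) by (simp add: orthonormal_on_def)
qed

text \<open>Testing the n-th term on \<open>v n\<close> shows that its operator norm is at least
  \<open>\<bar>b n\<bar>\<close>.\<close>

lemma diag_coefficients_tendsto_0:
  assumes "diag_series b u v sums A" "orthonormal_on u UNIV" "orthonormal_on v UNIV"
  shows "b \<longlonglongrightarrow> 0"
proof -
  have "(\<lambda>n. norm (diag_series b u v n)) \<longlonglongrightarrow> 0"
    using summable_LIMSEQ_zero[OF sums_summable[OF assms(1)]] by (rule tendsto_norm_zero)
  moreover have "\<bar>b n\<bar> \<le> norm (diag_series b u v n)" for n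
  proof -
    have "\<bar>b n\<bar> = norm (diag_series b u v n (v n))"
      using assms(3) orthonormal_on_norm[OF assms(2), of n]
      by (simp add: diag_series_apply norm_scaleC norm_mult orthonormal_on_def)
    also have "\<dots> \<le> norm (diag_series b u v n) * norm (v n)" by (rule norm_blinfun)
    finally show ?thesis using orthonormal_on_norm[OF assms(3), of n] by simp
  qed
  ultimately show ?thesis by (intro Lim_null_comparison[of b]) auto
qed

text \<open>Pythagoras for \<open>u\<close> followed by Bessel for \<open>v\<close>. The bound is by
  the largest coefficient and not by their sum, so coefficients tending to 0 already give
  convergence in operator norm.\<close>

lemma norm_diag_partial_sum_le:
  assumes "orthonormal_on u UNIV" "orthonormal_on v UNIV" "finite I"
    and "\<And>n. n \<in> I \<Longrightarrow> \<bar>b n\<bar> \<le> e" "0 \<le> e"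
  shows "norm (\<Sum>n\<in>I. diag_series b u v n) \<le> e"
proof (rule norm_blinfun_bound[OF \<open>0 \<le> e\<close>])
  fix f
  have eq: "(\<Sum>n\<in>I. diag_series b u v n) f = (\<Sum>n\<in>I. (of_real (b n) * cinner (v n) f) *\<^sub>C u n)"
    by (simp add: blinfun.sum_left diag_series_apply)
  have "(norm ((\<Sum>n\<in>I. diag_series b u v n) f))\<^sup>2 = (\<Sum>n\<in>I. (cmod (of_real (b n) * cinner (v n) f))\<^sup>2)"
    unfolding eq using assms orthonormal_on_subset by (intro norm_orthonormal_sum) blast+
  also have "\<dots> \<le> (\<Sum>n\<in>I. e\<^sup>2 * (cmod (cinner (v n) f))\<^sup>2)"
    using assms by (intro sum_mono)
      (auto simp: norm_mult power_mult_distrib abs_le_square_iff[symmetric] intro!: mult_right_mono)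
  also have "\<dots> = e\<^sup>2 * (\<Sum>n\<in>I. (cmod (cinner (v n) f))\<^sup>2)" by (simp add: sum_distrib_left)
  also have "\<dots> \<le> e\<^sup>2 * (norm f)\<^sup>2"
    using assms orthonormal_on_subset[OF assms(2)] by (intro mult_left_mono Bessel_finite) auto
  finally have "(norm ((\<Sum>n\<in>I. diag_series b u v n) f))\<^sup>2 \<le> (e * norm f)\<^sup>2"
    by (simp add: power_mult_distrib)
  then show "norm ((\<Sum>n\<in>I. diag_series b u v n) f) \<le> e * norm f"
    by (rule power2_le_imp_le) (use \<open>0 \<le> e\<close> in auto)
qed

lemma diag_series_summable:
  assumes "orthonormal_on u UNIV" "orthonormal_on v UNIV" "b \<longlonglongrightarrow> 0"
  shows "summable (diag_series b u v)"
  unfolding summable_Cauchy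
proof (intro allI impI)
  fix e :: real assume "e > 0"
  then have "eventually (\<lambda>n. \<bar>b n\<bar> < e / 2) sequentially"
    using order_tendstoD(2)[OF tendsto_rabs_zero[OF assms(3)], of "e / 2"] by simp
  then obtain N where N: "\<And>n. N \<le> n \<Longrightarrow> \<bar>b n\<bar> < e / 2" by (auto simp: eventually_sequentially)
  have "norm (sum (diag_series b u v) {m..<n}) < e" if "N \<le> m" for m n
  proof -
    have "norm (sum (diag_series b u v) {m..<n}) \<le> e / 2"
      using N that \<open>e > 0\<close> by (intro norm_diag_partial_sum_le assms) (auto intro!: less_imp_le)
    then show ?thesis using \<open>e > 0\<close> by simp
  qed
  then show "\<exists>N. \<forall>m\<ge>N. \<forall>n. norm (sum (diag_series b u v) {m..<n}) < e" by blast
qed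

text \<open>\<open>adjoint\<close> is defined by choice, so it is identified by testing a candidate,
  the series with the two systems exchanged. The complex identity is proved termwise and its real
  part taken.\<close>

lemma diag_adjoint:
  assumes "diag_series b u v sums A" "diag_series b v u sums B"
  shows "adjoint (blinfun_apply A) = blinfun_apply B"
proof (rule adjoint_unique, intro allI)
  fix f h
  have "(\<lambda>n. cnj (of_real (b n) * cinner (v n) f * cinner h (u n))) sums cnj (cinner h (A f))"
    using diag_sums_cinner[OF assms(1)] by (simp only: sums_cnj)
  also have "(\<lambda>n. cnj (of_real (b n) * cinner (v n) f * cinner h (u n)))
      = (\<lambda>n. of_real (b n) * cinner (u n) h * cinner f (v n))"
    by (simp add: cinner_commute[of f] cinner_commute[of _ h] fun_eq_iff)
  finally have "cnj (cinner h (A f)) = cinner f (B h)"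
    by (rule sums_unique2[OF _ diag_sums_cinner[OF assms(2)]])
  then have "cinner (A f) h = cinner f (B h)" by (simp add: cinner_commute[of "A f"])
  then show "inner (A f) h = inner f (B h)" by (simp add: inner_L2_def)
qed

lemma diag_compose:
  assumes "diag_series b u v sums A" "diag_series c w u sums B" "orthonormal_on u UNIV"
  shows "(\<lambda>n. (of_real (c n * b n) * cinner (v n) f) *\<^sub>C w n) sums B (A f)"
  using diag_sums_apply[OF assms(2), of "A f"] diag_coordinate[OF assms(1,3)]
  by (simp add: mult.assoc)

lemma diag_complex_linear:
  assumes "diag_series b u v sums A"
  shows "complex_linear A"
  unfolding complex_linear_def
proof (intro allI)
  fix c f
  have "(\<lambda>n. (of_real (b n) * cinner (v n) (c *\<^sub>C f)) *\<^sub>C u n) sums (c *\<^sub>C A f)"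
    using bounded_linear.sums[OF bounded_linear_scaleC_right diag_sums_apply[OF assms, of f], of c]
    by (simp add: scaleC_scaleC cinner_scaleC_right mult_ac)
  then show "A (c *\<^sub>C f) = c *\<^sub>C A f"
    by (rule sums_unique2[OF diag_sums_apply[OF assms]])
qed

text \<open>Each further vector contributes a compact disc of coefficients, so the set is a
  continuous image of a product of compact sets. It contains the images of the unit ball under
  truncated diagonal series.\<close>

lemma compact_bounded_combinations:
  "compact {\<Sum>i<N. c i *\<^sub>C u i |c. \<forall>i<N. cmod (c i) \<le> B}"
  for u :: "nat \<Rightarrow> 'a::euclidean_space L2"
proof (induction N)
  case 0
  then show ?case by simp
next
  case (Suc N)
  let ?K = "\<lambda>N. {\<Sum>i<N. c i *\<^sub>C u i |c. \<forall>i<N. cmod (c i) \<le> B}"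
  have "?K (Suc N) = (\<lambda>(f, z). f + z *\<^sub>C u N) ` (?K N \<times> cball 0 B)"
  proof (intro equalityI subsetI)
    fix f assume "f \<in> ?K (Suc N)"
    then obtain c where c: "f = (\<Sum>i<N. c i *\<^sub>C u i) + c N *\<^sub>C u N" "\<forall>i<Suc N. cmod (c i) \<le> B"
      by auto
    then have "(\<Sum>i<N. c i *\<^sub>C u i, c N) \<in> ?K N \<times> cball 0 B" by auto
    then show "f \<in> (\<lambda>(f, z). f + z *\<^sub>C u N) ` (?K N \<times> cball 0 B)"
      by (rule rev_image_eqI) (simp add: c)
  next
    fix f assume "f \<in> (\<lambda>(f, z). f + z *\<^sub>C u N) ` (?K N \<times> cball 0 B)"
    then obtain c z where c: "f = (\<Sum>i<N. c i *\<^sub>C u i) + z *\<^sub>C u N"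
      "\<forall>i<N. cmod (c i) \<le> B" "cmod z \<le> B" by auto
    then show "f \<in> ?K (Suc N)"
      by (intro CollectI exI[of _ "c(N := z)"]) (auto simp: less_Suc_eq)
  qed
  moreover have "continuous_on (?K N \<times> cball 0 B) (\<lambda>(f, z). f + z *\<^sub>C u N)"
    unfolding case_prod_unfold
    by (intro continuous_intros bounded_linear.continuous_on[OF bounded_linear_scaleC_left])
  ultimately show ?case
    using Suc by (auto intro!: compact_continuous_image compact_Times)
qed

lemma diag_compact:
  assumes "diag_series b u v sums A" "orthonormal_on u UNIV" "orthonormal_on v UNIV"
  shows "compact_operator A"
proof -
  obtain B where B: "B > 0" "\<And>n. \<bar>b n\<bar> \<le> B"
    using convergent_imp_Bseq[OF convergentI[OF diag_coefficients_tendsto_0[OF assms]]]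
    by (auto simp: Bseq_def)
  have "\<exists>F. finite F \<and> closure (A ` cball 0 1) \<subseteq> (\<Union>x\<in>F. ball x e)" if "e > 0" for e
  proof -
    obtain N where N: "norm ((\<Sum>n<N. diag_series b u v n) - A) < e / 4"
      using LIMSEQ_D[OF assms(1)[unfolded sums_def], of "e / 4"] \<open>e > 0\<close> by auto
    define K where "K = {\<Sum>i<N. c i *\<^sub>C u i |c. \<forall>i<N. cmod (c i) \<le> B}"
    have "compact K" unfolding K_def by (rule compact_bounded_combinations)
    then obtain F where F: "finite F" "K \<subseteq> (\<Union>x\<in>F. ball x (e / 4))"
      unfolding compact_eq_totally_bounded using \<open>e > 0\<close> by (meson zero_less_divide_iff zero_less_numeral)
    \<comment> \<open>Truncation and the finite net cost \<open>e / 4\<close> each. Closed balls of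
      radius \<open>e / 2\<close> survive taking the closure and still fit into open balls of radius
      \<open>e\<close>.\<close>
    have "A ` cball 0 1 \<subseteq> (\<Union>x\<in>F. cball x (e / 2))"
    proof
      fix y assume "y \<in> A ` cball 0 1"
      then obtain f where f: "y = A f" "norm f \<le> 1" by auto
      define z where "z = (\<Sum>n<N. diag_series b u v n) f"
      have "cmod (of_real (b n) * cinner (v n) f) \<le> B" for n
      proof -
        have "cmod (cinner (v n) f) \<le> 1"
          using norm_cinner_le[of "v n" f] orthonormal_on_norm[OF assms(3), of n] f by simp
        then have "\<bar>b n\<bar> * cmod (cinner (v n) f) \<le> B * 1"
          using B by (intro mult_mono) auto
        then show ?thesis by (simp add: norm_mult)
      qed
      then have "z \<in> K"
        unfolding K_def z_def blinfun.sum_left diag_series_apply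
        by (intro CollectI exI[of _ "\<lambda>n. of_real (b n) * cinner (v n) f"] conjI allI impI refl)
      then obtain x where x: "x \<in> F" "dist x z < e / 4" using F by auto
      have "norm (z - A f) \<le> norm ((\<Sum>n<N. diag_series b u v n) - A) * norm f"
        unfolding z_def blinfun.diff_left[symmetric] by (rule norm_blinfun)
      also have "\<dots> \<le> e / 4 * 1" using N f \<open>e > 0\<close> by (intro mult_mono) auto
      finally have "dist z y \<le> e / 4" by (simp add: f dist_norm)
      with x have "dist x y \<le> e / 2" using dist_triangle[of x y z] by simp
      with x show "y \<in> (\<Union>x\<in>F. cball x (e / 2))" by auto
    qed
    then have "closure (A ` cball 0 1) \<subseteq> (\<Union>x\<in>F. cball x (e / 2))"
      using F by (intro closure_minimal closed_UN) auto
    also have "\<dots> \<subseteq> (\<Union>x\<in>F. ball x e)" using \<open>e > 0\<close> by fastforce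
    finally show ?thesis using F by blast
  qed
  then have "compact (closure (A ` cball 0 1))"
    unfolding compact_eq_totally_bounded by (auto simp: complete_eq_closed)
  then show ?thesis
    using diag_complex_linear[OF assms(1)] by (simp add: compact_operator_def)
qed

section \<open>Traces and powers of diagonal operators, and the Schatten criterion\<close>

lemma diag_quadratic_form:
  assumes "diag_series c v v sums P" "\<And>n. 0 \<le> c n"
  shows "cinner f (P f) = complex_of_real (Re (cinner f (P f)))"
    and "((\<lambda>n. c n * (cmod (cinner f (v n)))\<^sup>2) has_sum Re (cinner f (P f))) UNIV"
    and "0 \<le> Re (cinner f (P f))"
proof -
  have "of_real (c n) * cinner (v n) f * cinner f (v n) = of_real (c n * (cmod (cinner f (v n)))\<^sup>2)" for n
    by (simp add: cinner_commute[of "v n"] complex_norm_square mult_ac del: of_real_power)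
  with diag_sums_cinner[OF assms(1), of f f]
  have s: "(\<lambda>n. complex_of_real (c n * (cmod (cinner f (v n)))\<^sup>2)) sums cinner f (P f)" by simp
  have "(\<lambda>n. 0) sums Im (cinner f (P f))" using sums_Im[OF s] by simp
  then have "Im (cinner f (P f)) = 0" using sums_unique2 sums_zero by blast
  then show "cinner f (P f) = complex_of_real (Re (cinner f (P f)))" by (simp add: complex_eq_iff)
  have "(\<lambda>n. c n * (cmod (cinner f (v n)))\<^sup>2) sums Re (cinner f (P f))" using sums_Re[OF s] by simp
  then show hs: "((\<lambda>n. c n * (cmod (cinner f (v n)))\<^sup>2) has_sum Re (cinner f (P f))) UNIV"
    using assms(2) by (intro norm_summable_imp_has_sum) (auto simp: sums_iff)
  show "0 \<le> Re (cinner f (P f))" by (rule has_sum_nonneg[OF hs]) (simp add: assms)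
qed

lemma has_sum_sum:
  fixes f :: "'i \<Rightarrow> 'b \<Rightarrow> 'c::topological_comm_monoid_add"
  assumes "finite I" "\<And>i. i \<in> I \<Longrightarrow> (f i has_sum s i) X"
  shows "((\<lambda>x. \<Sum>i\<in>I. f i x) has_sum (\<Sum>i\<in>I. s i)) X"
  using assms by (induction I rule: finite_induct) (auto intro: has_sum_add)

text \<open>Any basis gives the same value because the double series of
  \<open>c n * (cmod (cinner e (v n)))\<^sup>2\<close> has nonnegative terms and may be summed in
  either order: over \<open>e\<close> it gives \<open>c n\<close> by Parseval, over \<open>n\<close>
  it gives the quadratic form at \<open>e\<close>.\<close>

lemma diag_has_trace:
  assumes "diag_series c v v sums Q" "orthonormal_on v UNIV" "\<And>n. 0 \<le> c n" "summable c"
  shows "has_trace Q (of_real (suminf c))"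
  unfolding has_trace_def
proof (intro allI impI)
  fix E :: "'a L2 set" assume E: "orthonormal_basis E"
  define h where "h p = c (fst p) * (cmod (cinner (snd p) (v (fst p))))\<^sup>2" for p
  have row: "((\<lambda>e. h (n, e)) has_sum c n) E" for n
    using has_sum_cmult_right[OF Parseval[OF E, of "v n"], of "c n"]
      orthonormal_on_norm[OF assms(2), of n]
    by (simp add: h_def)
  have c: "(c has_sum suminf c) UNIV"
    using assms(3,4) by (intro norm_summable_imp_has_sum) (auto simp: summable_sums)
  have "h summable_on UNIV \<times> E"
    by (rule summable_on_SigmaI[OF row has_sum_imp_summable[OF c]]) (auto simp: h_def assms(3))
  with row c have "(h has_sum suminf c) (UNIV \<times> E)" by (rule has_sum_SigmaI)
  then have "((\<lambda>(e, n). h (n, e)) has_sum suminf c) (E \<times> UNIV)" by (subst (asm) has_sum_swap)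
  then have "((\<lambda>e. Re (cinner e (Q e))) has_sum suminf c) E"
    by (rule has_sum_SigmaD) (use diag_quadratic_form(2)[OF assms(1,3)] in \<open>simp add: h_def\<close>)
  then have "((\<lambda>e. complex_of_real (Re (cinner e (Q e)))) has_sum complex_of_real (suminf c)) E"
    by (rule has_sum_of_real)
  then show "((\<lambda>e. cinner e (Q e)) has_sum complex_of_real (suminf c)) E"
    using diag_quadratic_form(1)[OF assms(1,3)] by simp
qed

lemma diag_eigenvector:
  assumes "diag_series b v v sums P" "orthonormal_on v UNIV"
  shows "P (v m) = b m *\<^sub>R v m"
proof -
  have "(\<lambda>n. (of_real (b n) * cinner (v n) (v m)) *\<^sub>C v n) sums
      (\<Sum>n\<in>{m}. (of_real (b n) * cinner (v n) (v m)) *\<^sub>C v n)"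
    using assms(2) by (intro sums_finite) (auto simp: orthonormal_on_def)
  from sums_unique2[OF diag_sums_apply[OF assms(1)] this] show ?thesis
    using assms(2) by (simp add: orthonormal_on_def scaleR_L2_def)
qed

lemma diag_orthogonal_kernel:
  assumes "diag_series b u v sums A" "\<And>n. cinner (v n) f = 0"
  shows "A f = 0"
proof -
  have "(\<lambda>n. 0) sums A f" using diag_sums_apply[OF assms(1), of f] assms(2) by simp
  then show ?thesis by (rule sums_unique2[OF _ sums_zero])
qed

text \<open>The absolute value and its power are written down explicitly, as diagonal series along
  \<open>v\<close> with coefficients \<open>\<bar>b n\<bar>\<close> and
  \<open>\<bar>b n\<bar> powr r\<close>. Since \<open>is_op_powr\<close> wants a full basis of
  eigenvectors, \<open>range v\<close> is extended to one.\<close>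

lemma schatten_diagI:
  assumes "diag_series b u v sums A" "orthonormal_on u UNIV" "orthonormal_on v UNIV"
    and "0 < r" "summable (\<lambda>n. \<bar>b n\<bar> powr r)"
  shows "A \<in> schatten r"
proof -
  have b0: "b \<longlonglongrightarrow> 0" by (rule diag_coefficients_tendsto_0[OF assms(1-3)])
  obtain B where B: "diag_series b v u sums B"
    using diag_series_summable[OF assms(3,2) b0] by (auto simp: summable_def)
  obtain P where P: "diag_series (\<lambda>n. \<bar>b n\<bar>) v v sums P"
    using diag_series_summable[OF assms(3,3) tendsto_rabs_zero[OF b0]] by (auto simp: summable_def)
  obtain Q where Q: "diag_series (\<lambda>n. \<bar>b n\<bar> powr r) v v sums Q"
    using diag_series_summable[OF assms(3,3) summable_LIMSEQ_zero[OF assms(5)]]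
    by (auto simp: summable_def)
  have "P (P f) = B (A f)" for f
  proof (rule sums_unique2[OF diag_compose[OF P P assms(3)]])
    show "(\<lambda>n. (of_real (\<bar>b n\<bar> * \<bar>b n\<bar>) * cinner (v n) f) *\<^sub>C v n) sums B (A f)"
      using diag_compose[OF assms(1) B assms(2), of f] by simp
  qed
  then have "is_abs A P"
    unfolding is_abs_def diag_adjoint[OF assms(1) B]
    using diag_complex_linear[OF P] diag_quadratic_form[OF P]
    by (metis abs_ge_zero Reals_of_real)
  moreover have "is_op_powr P r Q"
    unfolding is_op_powr_def
  proof (intro conjI diag_complex_linear[OF Q])
    have inj: "v m = v n \<longleftrightarrow> m = n" for m n
      using orthonormal_onD[OF assms(3), of m n] orthonormal_onD[OF assms(3), of n n]
      by (auto split: if_splits)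
    have "orthonormal_on id (range v)"
      using assms(3) by (auto simp: orthonormal_on_def inj)
    then obtain E where E: "orthonormal_basis E" "range v \<subseteq> E" by (rule orthonormal_basis_extend)
    \<comment> \<open>The added basis vectors are orthogonal to every \<open>v n\<close>, so
      \<open>P\<close> and \<open>Q\<close> annihilate them; the eigenvalue 0 fits both because
      \<open>0 powr r\<close> is 0.\<close>
    define l where "l e = (if e \<in> range v then \<bar>b (inv v e)\<bar> else 0)" for e
    have lv: "l (v n) = \<bar>b n\<bar>" for n
      by (simp add: l_def inv_f_f inj_def inj)
    have "0 \<le> l e \<and> P e = l e *\<^sub>R e \<and> Q e = (l e powr r) *\<^sub>R e" if "e \<in> E" for e
    proof (cases "e \<in> range v")
      case True
      then show ?thesis
        using diag_eigenvector[OF P assms(3)] diag_eigenvector[OF Q assms(3)] by (auto simp: lv)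
    next
      case False
      have "cinner (v n) e = 0" for n
      proof -
        have "v n \<in> E" "v n \<noteq> e" using E that False by auto
        then show ?thesis
          using E(1) that orthonormal_onD[of id E "v n" e] by (simp add: orthonormal_basis_iff)
      qed
      then show ?thesis
        using False diag_orthogonal_kernel[OF P] diag_orthogonal_kernel[OF Q] by (simp add: l_def)
    qed
    with E show "\<exists>E l. orthonormal_basis E \<and>
        (\<forall>e\<in>E. 0 \<le> l e \<and> P e = l e *\<^sub>R e \<and> Q e = (l e powr r) *\<^sub>R e)" by blast
  qed
  moreover have "has_trace Q (of_real (\<Sum>n. \<bar>b n\<bar> powr r))"
    by (rule diag_has_trace[OF Q assms(3) _ assms(5)]) simp
  ultimately show ?thesis
    using diag_compact[OF assms(1-3)] by (auto simp: schatten_def)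
qed

text \<open>
  If \<open>|A|\<close> is diagonal in the basis \<open>E\<close> with eigenvalues \<open>l\<close>, then \<open>l e\<close> equals \<open>\<bar>b n\<bar>\<close> whenever
  \<open>v n\<close> and \<open>e\<close> are not orthogonal, so no uniqueness of the positive square root is needed.
\<close>

lemma schatten_diagD:
  assumes "diag_series b u v sums A" "orthonormal_on u UNIV" "orthonormal_on v UNIV"
    and "0 < r" "A \<in> schatten r"
  shows "summable (\<lambda>n. \<bar>b n\<bar> powr r)"
proof -
  obtain P Q t E l where P: "is_abs A P" and t: "has_trace Q t" and E: "orthonormal_basis E"
    and l: "\<And>e. e \<in> E \<Longrightarrow> 0 \<le> l e" "\<And>e. e \<in> E \<Longrightarrow> P e = l e *\<^sub>R e"
      "\<And>e. e \<in> E \<Longrightarrow> Q e = (l e powr r) *\<^sub>R e"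
    using assms(5) unfolding schatten_def is_op_powr_def by blast
  obtain B where B: "diag_series b v u sums B"
    using diag_series_summable[OF assms(3,2) diag_coefficients_tendsto_0[OF assms(1-3)]]
    by (auto simp: summable_def)
  have ee: "cinner e e = 1" if "e \<in> E" for e
    using E that orthonormal_onD[of id E e e] by (simp add: orthonormal_basis_iff)
  have "((\<lambda>e. cinner e (Q e)) has_sum t) E" using t E by (simp add: has_trace_def)
  then have "((\<lambda>e. complex_of_real (l e powr r)) has_sum t) E"
    by (subst (asm) has_sum_cong) (auto simp: l cinner_scaleR_right ee)
  then have "((\<lambda>e. l e powr r) has_sum Re t) E"
    using has_sum_Re by fastforce
  have eig: "l e powr r * (cmod (cinner e (v n)))\<^sup>2 = \<bar>b n\<bar> powr r * (cmod (cinner e (v n)))\<^sup>2"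
    if "e \<in> E" for e n
  proof (cases "cinner e (v n) = 0")
    case False
    \<comment> \<open>The \<open>v n\<close> coordinate of \<open>P (P e)\<close> is computed twice:
      \<open>e\<close> is an eigenvector with eigenvalue \<open>(l e)\<^sup>2\<close>, and the
      diagonal form of adjoint times \<open>A\<close> multiplies the coordinate by
      \<open>(b n)\<^sup>2\<close>.\<close>
    have "complex_of_real ((l e)\<^sup>2) * cinner (v n) e = cinner (v n) (P (P e))"
      using that by (simp add: l blinfun.scaleR_right cinner_scaleR_right power2_eq_square)
    also have "P (P e) = B (A e)"
      using P by (simp add: is_abs_def diag_adjoint[OF assms(1) B])
    also have "cinner (v n) (B (A e)) = of_real ((b n)\<^sup>2) * cinner (v n) e"
      by (simp add: diag_coordinate[OF B assms(3)] diag_coordinate[OF assms(1,2)] power2_eq_square)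
    finally have "complex_of_real ((l e)\<^sup>2) * cinner (v n) e = of_real ((b n)\<^sup>2) * cinner (v n) e" .
    then have "(l e)\<^sup>2 = (b n)\<^sup>2"
      using False cinner_commute[of e "v n"] by (simp only: mult_cancel_right of_real_eq_iff) simp
    then have "(l e)\<^sup>2 = \<bar>b n\<bar>\<^sup>2" by simp
    then have "l e = \<bar>b n\<bar>" by (rule power2_eq_imp_eq) (simp_all add: l that)
    then show ?thesis by simp
  qed simp
  \<comment> \<open>Parseval in \<open>E\<close> distributes each
    \<open>\<bar>b n\<bar> powr r\<close> over the basis vectors; \<open>eig\<close> replaces the
    factor by \<open>l e powr r\<close>, and Bessel for \<open>v\<close> shows that \<open>e\<close>
    receives at most \<open>l e powr r\<close> in total.\<close>
  have "(\<Sum>n<N. \<bar>b n\<bar> powr r) \<le> Re t" for N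
  proof (rule has_sum_mono[OF _ \<open>((\<lambda>e. l e powr r) has_sum Re t) E\<close>])
    have "((\<lambda>e. \<bar>b n\<bar> powr r * (cmod (cinner e (v n)))\<^sup>2) has_sum \<bar>b n\<bar> powr r) E" for n
      using has_sum_cmult_right[OF Parseval[OF E, of "v n"], of "\<bar>b n\<bar> powr r"]
        orthonormal_on_norm[OF assms(3), of n] by simp
    then show "((\<lambda>e. \<Sum>n<N. \<bar>b n\<bar> powr r * (cmod (cinner e (v n)))\<^sup>2) has_sum (\<Sum>n<N. \<bar>b n\<bar> powr r)) E"
      by (intro has_sum_sum finite_lessThan)
    fix e assume e: "e \<in> E"
    have "(\<Sum>n<N. \<bar>b n\<bar> powr r * (cmod (cinner e (v n)))\<^sup>2) = l e powr r * (\<Sum>n<N. (cmod (cinner (v n) e))\<^sup>2)"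
      by (simp add: eig[OF e, symmetric] sum_distrib_left cinner_commute[of "v _" e])
    also have "\<dots> \<le> l e powr r * (norm e)\<^sup>2"
      using orthonormal_on_subset[OF assms(3)] by (intro mult_left_mono Bessel_finite) auto
    also have "(norm e)\<^sup>2 = 1" using ee[OF e] by (simp add: norm_L2_def inner_L2_def)
    finally show "(\<Sum>n<N. \<bar>b n\<bar> powr r * (cmod (cinner e (v n)))\<^sup>2) \<le> l e powr r" by simp
  qed
  then show ?thesis by (intro summableI_nonneg_bounded) auto
qed

section \<open>Random coefficients\<close>

text \<open>With \<open>k\<close> the ceiling of \<open>r\<close>, the constant comes from
  \<open>1 + t \<le> exp t\<close> at \<open>t = \<bar>x\<bar> / k\<close>: raising to the power
  \<open>r\<close> leaves the exponent \<open>\<bar>x\<bar> * (r / k)\<close>, which is at most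
  \<open>\<bar>x\<bar>\<close>.\<close>

lemma abs_powr_le_exp:
  fixes x r :: real
  assumes "0 < r"
  shows "\<bar>x\<bar> powr r \<le> (real (nat \<lceil>r\<rceil>)) powr r * (exp x + exp (- x))"
proof (cases "x = 0")
  case True then show ?thesis by simp
next
  case False
  define k where "k = real (nat \<lceil>r\<rceil>)"
  have k: "r \<le> k" "k > 0" using assms by (auto simp: k_def) 
  have "1 + \<bar>x\<bar> / k \<le> exp (\<bar>x\<bar> / k)" by (rule exp_ge_add_one_self)
  then have "\<bar>x\<bar> \<le> k * exp (\<bar>x\<bar> / k)" using k by (simp add: field_simps)
  then have "\<bar>x\<bar> powr r \<le> (k * exp (\<bar>x\<bar> / k)) powr r"
    using assms by (intro powr_mono2) auto
  also have "\<dots> = k powr r * exp (\<bar>x\<bar> * (r / k))"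
    using k by (simp add: powr_mult powr_def ln_mult algebra_simps flip: exp_add)
  also have "\<dots> \<le> k powr r * exp \<bar>x\<bar>"
    using k assms by (intro mult_left_mono) (auto simp: field_simps intro!: mult_right_mono)
  also have "exp \<bar>x\<bar> \<le> exp x + exp (- x)" by (cases "x \<ge> 0") auto
  finally show ?thesis unfolding k_def by (simp add: mult_left_mono)
qed

context prob_space begin

lemma AE_summable_random_coefficients:
  fixes g :: "nat \<Rightarrow> 'a \<Rightarrow> real"
  assumes g [measurable]: "\<And>n. g n \<in> borel_measurable M"
    and mgf: "\<And>n \<zeta>. (\<integral>\<^sup>+\<omega>. ennreal (exp (\<zeta> * g n \<omega>)) \<partial>M) \<le> ennreal (exp (C * \<zeta>\<^sup>2))"
    and a: "summable (\<lambda>n. \<bar>a n\<bar> powr r)" and r: "0 < r"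
  shows "AE \<omega> in M. summable (\<lambda>n. \<bar>a n * g n \<omega>\<bar> powr r)"
proof -
  define K where "K = real (nat \<lceil>r\<rceil>) powr r"
  have K: "0 \<le> K" by (simp add: K_def)
  \<comment> \<open>The subgaussian bound at \<zeta> = 1 and \<zeta> = -1 contributes
    \<open>exp C\<close> each, so the moments are bounded uniformly in \<open>n\<close>.\<close>
  have moment: "(\<integral>\<^sup>+\<omega>. ennreal (\<bar>g n \<omega>\<bar> powr r) \<partial>M) \<le> ennreal (K * (2 * exp C))" for n
  proof -
    have "(\<integral>\<^sup>+\<omega>. ennreal (\<bar>g n \<omega>\<bar> powr r) \<partial>M)
        \<le> (\<integral>\<^sup>+\<omega>. ennreal K * (ennreal (exp (1 * g n \<omega>)) + ennreal (exp ((- 1) * g n \<omega>))) \<partial>M)"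
      using abs_powr_le_exp[OF r] K
      by (intro nn_integral_mono) (simp add: K_def ennreal_mult'[symmetric] flip: ennreal_plus)
    also have "\<dots> = ennreal K * ((\<integral>\<^sup>+\<omega>. ennreal (exp (1 * g n \<omega>)) \<partial>M)
        + (\<integral>\<^sup>+\<omega>. ennreal (exp ((- 1) * g n \<omega>)) \<partial>M))"
      by (subst nn_integral_cmult, simp, subst nn_integral_add) auto
    also have "\<dots> \<le> ennreal K * (ennreal (exp (C * 1\<^sup>2)) + ennreal (exp (C * (-1)\<^sup>2)))"
      by (intro mult_left_mono add_mono mgf) auto
    also have "\<dots> = ennreal (K * (2 * exp C))"
      using K by (simp add: ennreal_mult' flip: ennreal_plus)
    finally show ?thesis .
  qed
  have "(\<integral>\<^sup>+\<omega>. (\<Sum>n. ennreal (\<bar>a n * g n \<omega>\<bar> powr r)) \<partial>M)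
      = (\<Sum>n. \<integral>\<^sup>+\<omega>. ennreal (\<bar>a n\<bar> powr r) * ennreal (\<bar>g n \<omega>\<bar> powr r) \<partial>M)"
    by (subst nn_integral_suminf) (auto simp: abs_mult powr_mult ennreal_mult)
  also have "\<dots> \<le> (\<Sum>n. ennreal (\<bar>a n\<bar> powr r) * ennreal (K * (2 * exp C)))"
    by (intro suminf_le summableI) (auto simp: nn_integral_cmult intro!: mult_left_mono moment)
  also have "\<dots> = ennreal (\<Sum>n. \<bar>a n\<bar> powr r) * ennreal (K * (2 * exp C))"
    using a by (simp add: suminf_ennreal2)
  also have "\<dots> < \<infinity>" by (simp add: ennreal_mult_less_top)
  finally have "AE \<omega> in M. (\<Sum>n. ennreal (\<bar>a n * g n \<omega>\<bar> powr r)) \<noteq> \<infinity>"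
    by (intro nn_integral_noteq_infinite) auto
  then show ?thesis
    by eventually_elim (rule summable_suminf_not_top, auto)
qed

lemma AE_not_summable_random_coefficients:
  fixes g :: "nat \<Rightarrow> 'a \<Rightarrow> real"
  assumes indep: "indep_vars (\<lambda>_. borel) g UNIV"
    and c: "0 < c" "limsup (\<lambda>n. ereal (prob {\<omega> \<in> space M. \<bar>g n \<omega>\<bar> \<le> c})) < 1"
    and a: "\<not> summable (\<lambda>n. \<bar>a n\<bar> powr r)" "Bseq a" and r: "0 < r"
  shows "AE \<omega> in M. \<not> summable (\<lambda>n. \<bar>a n * g n \<omega>\<bar> powr r)"
proof -
  have g [measurable]: "g n \<in> borel_measurable M" for n
    using indep by (auto simp: indep_vars_def2)
  obtain q where q: "limsup (\<lambda>n. ereal (prob {\<omega> \<in> space M. \<bar>g n \<omega>\<bar> \<le> c})) < ereal q" "q < 1"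
    using ereal_dense2[OF c(2)] by auto
  have "eventually (\<lambda>n. ereal (prob {\<omega> \<in> space M. \<bar>g n \<omega>\<bar> \<le> c}) < ereal q) sequentially"
    using q(1) by (rule Limsup_lessD)
  then obtain N where N: "prob {\<omega> \<in> space M. \<bar>g n \<omega>\<bar> \<le> c} \<le> q" if "N \<le> n" for n
    by (auto simp: eventually_sequentially intro: less_imp_le)
  obtain B where B: "B > 0" "\<bar>a n\<bar> \<le> B" for n
    using a(2) by (auto simp: Bseq_def)
  define y where "y n = \<bar>a n\<bar> powr r * c powr r" for n
  define Y where "Y = B powr r * c powr r"
  have y: "0 \<le> y n" "y n \<le> Y" for n
    using B r by (auto simp: y_def Y_def intro!: mult_right_mono powr_mono2)
  \<comment> \<open>For \<open>0 \<le> y \<le> Y\<close> one has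
    \<open>1 - exp (- y) \<ge> y / (1 + y) \<ge> y / (1 + Y)\<close>, and
    \<open>\<bar>g n\<bar>\<close> exceeds \<open>c\<close> with probability at least
    \<open>1 - q\<close>; \<open>e\<close> is the product of the two constants. Boundedness of
    \<open>a\<close> enters through \<open>Y\<close>: for large \<open>y\<close> the left side
    saturates at 1.\<close>
  define e where "e = (1 - q) / (1 + Y)"
  have Y: "Y \<ge> 0" using y[of 0] by linarith
  then have e: "e > 0" using q by (simp add: e_def)
  define E where "E n \<omega> = exp (- (\<bar>a n * g n \<omega>\<bar> powr r))" for n \<omega>
  have [measurable]: "E n \<in> borel_measurable M" for n unfolding E_def by measurable
  have E: "0 \<le> E n \<omega>" "E n \<omega> \<le> 1" for n \<omega> by (auto simp: E_def)
  have intE: "integrable M (E n)" for n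
    by (rule integrable_const_bound[where B = 1]) (use E in auto)
  have EE: "expectation (E n) \<le> exp (- (e * y n))" if "N \<le> n" for n
  proof -
    define A where "A = {\<omega> \<in> space M. \<bar>g n \<omega>\<bar> \<le> c}"
    have [measurable]: "A \<in> sets M" unfolding A_def by measurable
    have iA: "integrable M (indicat_real A)"
      by (intro integrable_real_indicator) (auto simp: emeasure_eq_measure)
    \<comment> \<open>The right side is the step function equal to 1 on \<open>A\<close> and to
      \<open>exp (- y n)\<close> off \<open>A\<close>.\<close>
    have le: "E n \<omega> \<le> exp (- y n) + (1 - exp (- y n)) * indicator A \<omega>" if "\<omega> \<in> space M" for \<omega>
    proof (cases "\<omega> \<in> A")
      case True then show ?thesis using E by simp
    next
      case False
      then have "c \<le> \<bar>g n \<omega>\<bar>" using that by (auto simp: A_def)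
      then have "c powr r \<le> \<bar>g n \<omega>\<bar> powr r" using c r by (intro powr_mono2) auto
      then have "y n \<le> \<bar>a n * g n \<omega>\<bar> powr r"
        by (auto simp: y_def abs_mult powr_mult intro!: mult_left_mono)
      then show ?thesis using False by (simp add: E_def)
    qed
    have "expectation (E n) \<le> (\<integral>\<omega>. exp (- y n) + (1 - exp (- y n)) * indicator A \<omega> \<partial>M)"
      using le by (intro integral_mono intE integrable_const_bound[where B = 1])
        (use y[of n] in \<open>auto split: split_indicator\<close>)
    also have "\<dots> = exp (- y n) + (1 - exp (- y n)) * prob A"
      using sets.sets_into_space[OF \<open>A \<in> sets M\<close>]
      by (subst Bochner_Integration.integral_add) (auto simp: prob_space Int_absorb2 iA)
    also have "\<dots> \<le> exp (- y n) + (1 - exp (- y n)) * q"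
      using N[OF that] y by (intro add_left_mono mult_left_mono) (auto simp: A_def)
    also have "\<dots> = 1 - (1 - q) * (1 - exp (- y n))" by (simp add: algebra_simps)
    also have "\<dots> \<le> 1 - (1 - q) * (y n / (1 + Y))"
    proof -
      have "exp (- y n) \<le> 1 / (1 + y n)"
        using exp_ge_add_one_self[of "y n"] y[of n] by (simp add: exp_minus field_simps)
      then have "y n / (1 + y n) \<le> 1 - exp (- y n)" using y(1)[of n] by (simp add: field_simps)
      moreover have "y n / (1 + Y) \<le> y n / (1 + y n)"
        using y[of n] by (intro divide_left_mono) auto
      ultimately have "y n / (1 + Y) \<le> 1 - exp (- y n)" by linarith
      then show ?thesis using q by (intro diff_left_mono mult_left_mono) auto
    qed
    also have "\<dots> = 1 - e * y n" by (simp add: e_def)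
    also have "\<dots> \<le> exp (- (e * y n))" using exp_ge_add_one_self[of "- (e * y n)"] by simp
    finally show ?thesis .
  qed
  have ns: "\<not> summable (\<lambda>n. y (n + N))"
  proof
    assume "summable (\<lambda>n. y (n + N))"
    then have "summable y" by (subst (asm) summable_iff_shift)
    then have "summable (\<lambda>n. \<bar>a n\<bar> powr r)"
      using c summable_mult2[of y "inverse (c powr r)"] by (simp add: y_def mult.assoc)
    then show False using a by simp
  qed
  have prod: "expectation (\<lambda>\<omega>. \<Prod>n\<in>{N..<m+N}. E n \<omega>) \<le> exp (- (e * (\<Sum>n<m. y (n + N))))" for m
  proof -
    have "expectation (\<lambda>\<omega>. \<Prod>n\<in>{N..<m+N}. E n \<omega>) = (\<Prod>n\<in>{N..<m+N}. expectation (E n))"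
      using intE unfolding E_def 
      by (intro indep_vars_lebesgue_integral indep_vars_compose2[OF indep_vars_subset[OF indep]]) auto
    also have "\<dots> \<le> (\<Prod>n\<in>{N..<m+N}. exp (- (e * y n)))"
      using EE by (intro prod_mono) (auto intro!: Bochner_Integration.integral_nonneg E)
    also have "\<dots> = exp (- (e * (\<Sum>n\<in>{N..<m+N}. y n)))"
      by (simp add: exp_sum sum_negf sum_distrib_left flip: exp_sum)
    also have "(\<Sum>n\<in>{N..<m+N}. y n) = (\<Sum>n<m. y (n + N))"
      using sum.shift_bounds_nat_ivl[of y 0 N m] by (simp add: lessThan_atLeast0)
    finally show ?thesis .
  qed
  define S where "S = {\<omega> \<in> space M. summable (\<lambda>n. \<bar>a n * g n \<omega>\<bar> powr r)}"
  \<comment> \<open>The infinite product of the \<open>E n\<close>, cut off to 0 where the series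
    diverges and \<open>suminf\<close> is unspecified. It lies below every finite product and is
    positive exactly on \<open>S\<close>, so \<open>expectation Z = 0\<close> makes \<open>S\<close>
    a null set.\<close>
  define Z where "Z \<omega> = indicator S \<omega> * exp (- (\<Sum>n. \<bar>a n * g n \<omega>\<bar> powr r))" for \<omega>
  \<comment> \<open>Finiteness of the extended sum makes the convergence set visibly
    measurable.\<close>
  have S_eq: "S = {\<omega> \<in> space M. (\<Sum>n. ennreal (\<bar>a n * g n \<omega>\<bar> powr r)) \<noteq> \<top>}"
    unfolding S_def by (auto simp: suminf_ennreal2 intro!: summable_suminf_not_top)
  have [measurable]: "S \<in> sets M" unfolding S_eq by measurable
  have [measurable]: "Z \<in> borel_measurable M" unfolding Z_def by measurable
  have Z: "0 \<le> Z \<omega>" "Z \<omega> \<le> (\<Prod>n\<in>{N..<m+N}. E n \<omega>)" for \<omega> m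
  proof -
    show "0 \<le> Z \<omega>" by (simp add: Z_def)
    show "Z \<omega> \<le> (\<Prod>n\<in>{N..<m+N}. E n \<omega>)"
    proof (cases "\<omega> \<in> S")
      case True
      then have "(\<Sum>n\<in>{N..<m+N}. \<bar>a n * g n \<omega>\<bar> powr r) \<le> (\<Sum>n. \<bar>a n * g n \<omega>\<bar> powr r)"
        by (intro sum_le_suminf) (auto simp: S_def)
      then show ?thesis using True by (simp add: Z_def E_def sum_negf flip: exp_sum)
    next
      case False then show ?thesis by (simp add: Z_def prod_nonneg E)
    qed
  qed
  have intZ: "integrable M Z"
    by (rule integrable_const_bound[where B = 1]) (use Z(1) Z(2)[of _ 0] in auto)
  have le: "expectation Z \<le> exp (- (e * (\<Sum>n<m. y (n + N))))" for m
  proof -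
    have "expectation Z \<le> expectation (\<lambda>\<omega>. \<Prod>n\<in>{N..<m+N}. E n \<omega>)"
      using Z by (intro integral_mono intZ integrable_const_bound[where B = 1])
        (auto simp: prod_nonneg E abs_prod intro!: prod_le_1 AE_I2)
    with prod[of m] show ?thesis by linarith
  qed
  have "expectation Z \<le> 0"
  proof (rule ccontr)
    assume "\<not> expectation Z \<le> 0"
    \<comment> \<open>If the expectation were positive, its logarithm would bound all partial sums
      of the divergent series of the \<open>y (n + N)\<close>.\<close>
    then have ln: "ln (expectation Z) \<le> - (e * (\<Sum>n<m. y (n + N)))" for m
      using le[of m] by (subst ln_exp[symmetric], subst ln_le_cancel_iff) auto
    have "(\<Sum>n<m. y (n + N)) \<le> - ln (expectation Z) / e" for m
      using ln[of m] unfolding pos_le_divide_eq[OF e] by (simp add: mult.commute)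
    then have "summable (\<lambda>n. y (n + N))"
      by (intro summableI_nonneg_bounded y)
    with ns show False ..
  qed
  moreover have "0 \<le> expectation Z" using Z by (intro Bochner_Integration.integral_nonneg) auto
  ultimately have "AE \<omega> in M. Z \<omega> = 0"
    using integral_nonneg_eq_0_iff_AE[OF intZ] Z by auto
  then show ?thesis
    using AE_space by eventually_elim (auto simp: Z_def S_def split: split_indicator_asm)
qed

end

section \<open>Schwartz functions\<close>

definition dir_deriv :: "'a::euclidean_space \<Rightarrow> ('a \<Rightarrow> complex) \<Rightarrow> 'a \<Rightarrow> complex" where
  "dir_deriv b f x = frechet_derivative f (at x) b"

lemma dir_deriv_eqI: "(\<And>x. (f has_derivative f' x) (at x)) \<Longrightarrow> dir_deriv b f = (\<lambda>x. f' x b)"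
proof (rule ext)
  fix x assume "\<And>x. (f has_derivative f' x) (at x)"
  then have "f' x = frechet_derivative f (at x)" by (intro frechet_derivative_at)
  then show "dir_deriv b f x = f' x b" by (simp add: dir_deriv_def)
qed

text \<open>The growth condition is a parameter so that one theory serves both \<open>rapid\<close>,
  which gives the Schwartz functions, and \<open>moderate\<close>, which gives their
  multipliers.\<close>

definition smooth_class :: "('a::euclidean_space \<Rightarrow> complex) set \<Rightarrow> ('a \<Rightarrow> complex) set" where
  "smooth_class G = {f. \<forall>bs\<in>lists Basis. partial_deriv bs f differentiable_on UNIV \<and> partial_deriv bs f \<in> G}"

text \<open>\<open>partial_deriv\<close> takes the derivative for the head of the list last. The end
  of the list is the derivative taken first, and splitting it off shows that a class is closed under
  differentiation.\<close>

lemma partial_deriv_snoc: "partial_deriv (bs @ [b]) f = partial_deriv bs (dir_deriv b f)"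
  by (induction bs) (simp_all add: dir_deriv_def[abs_def])

text \<open>
  Membership is proved by coinduction: it suffices to find a set of functions that satisfy the
  growth condition and whose partial derivatives lie in the set again.
\<close>

lemma smooth_class_coinduct:
  assumes "\<phi> \<in> X"
    and step: "\<And>f. f \<in> X \<Longrightarrow> f \<in> G \<and>
      (\<exists>f'. (\<forall>x. (f has_derivative f' x) (at x)) \<and> (\<forall>b\<in>Basis. (\<lambda>x. f' x b) \<in> X))"
  shows "\<phi> \<in> smooth_class G"
proof -
  have "partial_deriv bs \<phi> \<in> X" if "bs \<in> lists Basis" for bs
    using that
  proof (induction bs)
    case (Cons b bs)
    from step[OF Cons.IH] obtain f' where
      f': "\<And>x. (partial_deriv bs \<phi> has_derivative f' x) (at x)" "(\<lambda>x. f' x b) \<in> X"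
      using Cons by blast
    have "partial_deriv (b # bs) \<phi> = (\<lambda>x. f' x b)"
      using dir_deriv_eqI[OF f'(1), of b] by (simp add: dir_deriv_def fun_eq_iff)
    with f' show ?case by simp
  qed (simp add: assms)
  moreover have "f differentiable_on UNIV" if "f \<in> X" for f
    using step[OF that] unfolding differentiable_on_def differentiable_def by auto
  ultimately show ?thesis using step by (auto simp: smooth_class_def)
qed

lemma smooth_class_stepI:
  "f \<in> G \<Longrightarrow> (\<And>x. (f has_derivative f' x) (at x)) \<Longrightarrow> (\<And>b. b \<in> Basis \<Longrightarrow> (\<lambda>x. f' x b) \<in> X) \<Longrightarrow>
    f \<in> G \<and> (\<exists>f'. (\<forall>x. (f has_derivative f' x) (at x)) \<and> (\<forall>b\<in>Basis. (\<lambda>x. f' x b) \<in> X))"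
  by blast

lemma smooth_classD:
  assumes "f \<in> smooth_class G"
  shows "f \<in> G" and "(f has_derivative frechet_derivative f (at x)) (at x)"
    and "b \<in> Basis \<Longrightarrow> dir_deriv b f \<in> smooth_class G"
proof -
  have *: "partial_deriv bs f differentiable_on UNIV" "partial_deriv bs f \<in> G"
    if "bs \<in> lists Basis" for bs using assms that by (auto simp: smooth_class_def)
  show "f \<in> G" using *(2)[of "[]"] by simp
  show "(f has_derivative frechet_derivative f (at x)) (at x)"
    using *(1)[of "[]"] by (simp add: differentiable_on_def frechet_derivative_works)
  assume b: "b \<in> Basis"
  show "dir_deriv b f \<in> smooth_class G"
    unfolding smooth_class_def
  proof (intro CollectI ballI)
    fix bs :: "'a list" assume "bs \<in> lists Basis"
    with b have "bs @ [b] \<in> lists Basis" by simp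
    from *[OF this] show "partial_deriv bs (dir_deriv b f) differentiable_on UNIV \<and>
        partial_deriv bs (dir_deriv b f) \<in> G"
      unfolding partial_deriv_snoc by blast
  qed
qed

lemma smooth_class_continuous: "f \<in> smooth_class G \<Longrightarrow> continuous_on S f"
  by (meson continuous_at_imp_continuous_on has_derivative_continuous smooth_classD(2))

lemma smooth_class_measurable: "f \<in> smooth_class G \<Longrightarrow> f \<in> borel_measurable borel"
  by (intro borel_measurable_continuous_onI smooth_class_continuous)

lemma smooth_class_add:
  assumes "\<And>f g. f \<in> G \<Longrightarrow> g \<in> G \<Longrightarrow> (\<lambda>x. f x + g x) \<in> G"
    and "f \<in> smooth_class G" "g \<in> smooth_class G"
  shows "(\<lambda>x. f x + g x) \<in> smooth_class G"
proof (rule smooth_class_coinduct)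
  define X where "X = {\<lambda>x. f x + g x |f g. f \<in> smooth_class G \<and> g \<in> smooth_class G}"
  show "(\<lambda>x. f x + g x) \<in> X" using assms by (auto simp: X_def)
  fix k assume "k \<in> X"
  then obtain f g where k: "k = (\<lambda>x. f x + g x)" "f \<in> smooth_class G" "g \<in> smooth_class G"
    by (auto simp: X_def)
  have "(\<lambda>x. frechet_derivative f (at x) b + frechet_derivative g (at x) b) \<in> X" if "b \<in> Basis" for b
    using smooth_classD(3)[OF k(2) that] smooth_classD(3)[OF k(3) that]
    unfolding X_def dir_deriv_def[abs_def]
    by (intro CollectI exI[of _ "\<lambda>x. frechet_derivative f (at x) b"]
        exI[of _ "\<lambda>x. frechet_derivative g (at x) b"] conjI refl)
  moreover have "k \<in> G" using k assms(1) smooth_classD(1) by blast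
  ultimately show "k \<in> G \<and> (\<exists>f'. (\<forall>x. (k has_derivative f' x) (at x)) \<and> (\<forall>b\<in>Basis. (\<lambda>x. f' x b) \<in> X))"
    unfolding k(1)
    by (intro conjI exI[of _ "\<lambda>x h. frechet_derivative f (at x) h + frechet_derivative g (at x) h"])
      (auto intro!: has_derivative_add smooth_classD(2)[OF k(2)] smooth_classD(2)[OF k(3)])
qed

text \<open>The product rule turns one product into a sum of two; allowing finite sums gives a set
  that is invariant under differentiation, as the coinduction requires.\<close>

inductive_set product_sums :: "('a \<Rightarrow> complex) set \<Rightarrow> ('a \<Rightarrow> complex) set \<Rightarrow> ('a \<Rightarrow> complex) set"
  for A B where
  "f \<in> A \<Longrightarrow> g \<in> B \<Longrightarrow> (\<lambda>x. f x * g x) \<in> product_sums A B"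
| "f \<in> product_sums A B \<Longrightarrow> g \<in> product_sums A B \<Longrightarrow> (\<lambda>x. f x + g x) \<in> product_sums A B"

text \<open>Three growth conditions, because a moderate factor times a rapid one is needed as well
  as moderate times moderate.\<close>

lemma smooth_class_mult:
  assumes mult: "\<And>f g. f \<in> G \<Longrightarrow> g \<in> H \<Longrightarrow> (\<lambda>x. f x * g x) \<in> K"
    and add: "\<And>f g. f \<in> K \<Longrightarrow> g \<in> K \<Longrightarrow> (\<lambda>x. f x + g x) \<in> K"
    and f: "f \<in> smooth_class G" and g: "g \<in> smooth_class H"
  shows "(\<lambda>x. f x * g x) \<in> smooth_class K"
proof (rule smooth_class_coinduct)
  define X where "X = product_sums (smooth_class G) (smooth_class H)"
  show "(\<lambda>x. f x * g x) \<in> X" unfolding X_def by (intro product_sums.intros f g)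
  fix k assume "k \<in> X"
  then show "k \<in> K \<and> (\<exists>f'. (\<forall>x. (k has_derivative f' x) (at x)) \<and> (\<forall>b\<in>Basis. (\<lambda>x. f' x b) \<in> X))"
    unfolding X_def
  proof (induction rule: product_sums.induct)
    case (1 f g)
    let ?k' = "\<lambda>x h. f x * frechet_derivative g (at x) h + frechet_derivative f (at x) h * g x"
    have "(\<lambda>x. ?k' x b) \<in> product_sums (smooth_class G) (smooth_class H)" if "b \<in> Basis" for b
      using smooth_classD(3)[OF 1(1) that] smooth_classD(3)[OF 1(2) that] 1
      by (intro product_sums.intros) (auto simp: dir_deriv_def[abs_def])
    then show ?case
      using 1 by (intro conjI exI[of _ ?k'] allI ballI has_derivative_mult mult) (auto dest: smooth_classD)
  next
    case (2 f g)
    then obtain f' g' where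
      f': "\<And>x. (f has_derivative f' x) (at x)" "\<And>b. b \<in> Basis \<Longrightarrow> (\<lambda>x. f' x b) \<in> product_sums (smooth_class G) (smooth_class H)" and
      g': "\<And>x. (g has_derivative g' x) (at x)" "\<And>b. b \<in> Basis \<Longrightarrow> (\<lambda>x. g' x b) \<in> product_sums (smooth_class G) (smooth_class H)"
      by metis
    then show ?case
      using 2 by (intro conjI exI[of _ "\<lambda>x h. f' x h + g' x h"] allI ballI has_derivative_add product_sums.intros add)
        auto
  qed
qed

section \<open>Polynomial growth and rapid decay\<close>

definition moderate :: "('a::euclidean_space \<Rightarrow> complex) set" where
  "moderate = {f. \<exists>C k. \<forall>x. cmod (f x) \<le> C * (1 + norm x) ^ k}"

text \<open>The weight \<open>1 + norm x\<close> is at least 1, so its powers increase with the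
  exponent and can be divided out; \<open>rapid_iff\<close> relates it to the plain powers of
  \<open>norm x\<close> in \<open>schwartz\<close>.\<close>

definition rapid :: "('a::euclidean_space \<Rightarrow> complex) set" where
  "rapid = {f. \<forall>k. \<exists>C. \<forall>x. (1 + norm x) ^ k * cmod (f x) \<le> C}"

lemma rapid_iff: "f \<in> rapid \<longleftrightarrow> (\<forall>k::nat. bounded (range (\<lambda>x. norm x ^ k *\<^sub>R f x)))"
proof
  assume f: "f \<in> rapid"
  show "\<forall>k::nat. bounded (range (\<lambda>x. norm x ^ k *\<^sub>R f x))"
  proof
    fix k
    obtain C where C: "\<And>x. (1 + norm x) ^ k * cmod (f x) \<le> C" using f by (auto simp: rapid_def)
    have "norm x ^ k * cmod (f x) \<le> C" for x
      using C[of x] mult_right_mono[OF power_mono[of "norm x" "1 + norm x" k], of "cmod (f x)"] by simp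
    then show "bounded (range (\<lambda>x. norm x ^ k *\<^sub>R f x))"
      by (auto simp: bounded_iff abs_mult)
  qed
next
  assume f: "\<forall>k::nat. bounded (range (\<lambda>x. norm x ^ k *\<^sub>R f x))"
  have "\<exists>C. \<forall>x. (1 + norm x) ^ k * cmod (f x) \<le> C" for k
  proof -
    obtain C where C: "\<And>x. norm x ^ k * cmod (f x) \<le> C"
      using f[rule_format, of k] by (auto simp: bounded_iff)
    obtain C' where C': "\<And>x. cmod (f x) \<le> C'"
      using f[rule_format, of 0] by (auto simp: bounded_iff)
    have "(1 + norm x) ^ k * cmod (f x) \<le> 2 ^ k * (C + C')" for x
    proof -
      have "(1 + norm x) ^ k \<le> (2 * max 1 (norm x)) ^ k" by (intro power_mono) auto
      also have "\<dots> \<le> 2 ^ k * (norm x ^ k + 1)"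
        by (auto simp: power_mult_distrib max_def)
      finally have "(1 + norm x) ^ k * cmod (f x) \<le> (2 ^ k * (norm x ^ k + 1)) * cmod (f x)"
        by (intro mult_right_mono) auto
      also have "\<dots> = 2 ^ k * (norm x ^ k * cmod (f x) + cmod (f x))" by (simp add: algebra_simps)
      also have "\<dots> \<le> 2 ^ k * (C + C')" using C C' by (intro mult_left_mono add_mono) auto
      finally show ?thesis .
    qed
    then show ?thesis by blast
  qed
  then show "f \<in> rapid" by (simp add: rapid_def)
qed

lemma schwartz_eq: "schwartz = smooth_class rapid"
  unfolding schwartz_def smooth_class_def rapid_iff ..

lemma rapid_add: "f \<in> rapid \<Longrightarrow> g \<in> rapid \<Longrightarrow> (\<lambda>x. f x + g x) \<in> rapid"
  unfolding rapid_def
proof (intro CollectI allI)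
  fix k
  assume "f \<in> {f. \<forall>k. \<exists>C. \<forall>x. (1 + norm x) ^ k * cmod (f x) \<le> C}"
    "g \<in> {f. \<forall>k. \<exists>C. \<forall>x. (1 + norm x) ^ k * cmod (f x) \<le> C}"
  then obtain C C' where C: "\<And>x. (1 + norm x) ^ k * cmod (f x) \<le> C"
    "\<And>x. (1 + norm x) ^ k * cmod (g x) \<le> C'" by blast
  have "(1 + norm x) ^ k * cmod (f x + g x) \<le> C + C'" for x
  proof -
    have "(1 + norm x) ^ k * cmod (f x + g x) \<le> (1 + norm x) ^ k * (cmod (f x) + cmod (g x))"
      by (intro mult_left_mono norm_triangle_ineq) auto
    then show ?thesis using C[of x] by (simp add: algebra_simps)
  qed
  then show "\<exists>C. \<forall>x. (1 + norm x) ^ k * cmod (f x + g x) \<le> C" by blast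
qed

lemma moderate_add: "f \<in> moderate \<Longrightarrow> g \<in> moderate \<Longrightarrow> (\<lambda>x. f x + g x) \<in> moderate"
proof -
  assume "f \<in> moderate" "g \<in> moderate"
  then obtain C k C' k' where C: "\<And>x. cmod (f x) \<le> C * (1 + norm x) ^ k"
    "\<And>x. cmod (g x) \<le> C' * (1 + norm x) ^ k'" by (auto simp: moderate_def)
  have pos: "0 \<le> C" "0 \<le> C'"
    using order_trans[OF norm_ge_zero C(1)[of 0]] order_trans[OF norm_ge_zero C(2)[of 0]] by auto
  have "cmod (f x + g x) \<le> (C + C') * (1 + norm x) ^ (k + k')" for x
  proof -
    have "cmod (f x + g x) \<le> C * (1 + norm x) ^ k + C' * (1 + norm x) ^ k'"
      by (intro norm_triangle_le add_mono C)
    also have "\<dots> \<le> C * (1 + norm x) ^ (k + k') + C' * (1 + norm x) ^ (k + k')"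
      using pos by (intro add_mono mult_left_mono power_increasing) auto
    finally show ?thesis by (simp add: algebra_simps)
  qed
  then show ?thesis by (auto simp: moderate_def)
qed

lemma moderate_mult: "f \<in> moderate \<Longrightarrow> g \<in> moderate \<Longrightarrow> (\<lambda>x. f x * g x) \<in> moderate"
proof -
  assume "f \<in> moderate" "g \<in> moderate"
  then obtain C k C' k' where C: "\<And>x. cmod (f x) \<le> C * (1 + norm x) ^ k"
    "\<And>x. cmod (g x) \<le> C' * (1 + norm x) ^ k'" by (auto simp: moderate_def)
  have "cmod (f x * g x) \<le> (C * C') * (1 + norm x) ^ (k + k')" for x
  proof -
    have "cmod (f x * g x) \<le> (C * (1 + norm x) ^ k) * (C' * (1 + norm x) ^ k')"
      unfolding norm_mult using order_trans[OF norm_ge_zero C(1)] by (intro mult_mono C) auto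
    then show ?thesis by (simp add: power_add mult_ac)
  qed
  then show ?thesis by (auto simp: moderate_def)
qed

lemma moderate_mult_rapid: "f \<in> moderate \<Longrightarrow> g \<in> rapid \<Longrightarrow> (\<lambda>x. f x * g x) \<in> rapid"
proof -
  assume "f \<in> moderate" and g: "g \<in> rapid"
  then obtain C k where C: "\<And>x. cmod (f x) \<le> C * (1 + norm x) ^ k" by (auto simp: moderate_def)
  have pos: "0 \<le> C" using order_trans[OF norm_ge_zero C(1)[of 0]] by auto
  have "\<exists>B. \<forall>x. (1 + norm x) ^ j * cmod (f x * g x) \<le> B" for j
  proof -
    obtain C' where C': "\<And>x. (1 + norm x) ^ (k + j) * cmod (g x) \<le> C'"
      using g by (auto simp: rapid_def)
    have "(1 + norm x) ^ j * cmod (f x * g x) \<le> C * C'" for x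
    proof -
      have "(1 + norm x) ^ j * cmod (f x * g x) \<le> (1 + norm x) ^ j * ((C * (1 + norm x) ^ k) * cmod (g x))"
        unfolding norm_mult by (intro mult_left_mono mult_right_mono C) auto
      also have "\<dots> = C * ((1 + norm x) ^ (k + j) * cmod (g x))" by (simp add: power_add mult_ac)
      also have "\<dots> \<le> C * C'" by (intro mult_left_mono C' pos)
      finally show ?thesis .
    qed
    then show ?thesis by blast
  qed
  then show ?thesis by (simp add: rapid_def)
qed

lemma moderate_smooth_add:
  "f \<in> smooth_class moderate \<Longrightarrow> g \<in> smooth_class moderate \<Longrightarrow> (\<lambda>x. f x + g x) \<in> smooth_class moderate"
  by (rule smooth_class_add[OF moderate_add])

lemma moderate_smooth_mult:
  "f \<in> smooth_class moderate \<Longrightarrow> g \<in> smooth_class moderate \<Longrightarrow> (\<lambda>x. f x * g x) \<in> smooth_class moderate"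
  by (rule smooth_class_mult[OF moderate_mult moderate_add])

text \<open>\<open>smooth_class moderate\<close> is the classical multiplier space of Schwartz
  functions. Fourier phases, coordinates and the symbol of the bracket operator are shown to belong
  to it.\<close>

lemma schwartz_mult: "f \<in> smooth_class moderate \<Longrightarrow> g \<in> schwartz \<Longrightarrow> (\<lambda>x. f x * g x) \<in> schwartz"
  unfolding schwartz_eq by (rule smooth_class_mult[OF moderate_mult_rapid rapid_add])

lemma moderate_smooth_const: "(\<lambda>_. c) \<in> smooth_class moderate"
proof (rule smooth_class_coinduct)
  show "(\<lambda>_. c) \<in> range (\<lambda>c _. c)" by blast
  fix f :: "'a \<Rightarrow> complex" assume "f \<in> range (\<lambda>c _. c)"
  then obtain c where f: "f = (\<lambda>_. c)" by blast
  have "f \<in> moderate" unfolding moderate_def f by (intro CollectI exI[of _ "cmod c"] exI[of _ 0]) simp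
  then show "f \<in> moderate \<and> (\<exists>f'. (\<forall>x. (f has_derivative f' x) (at x)) \<and>
      (\<forall>b\<in>Basis. (\<lambda>x. f' x b) \<in> range (\<lambda>c _. c)))"
    unfolding f by (intro conjI exI[of _ "\<lambda>_ _. 0"]) auto
qed

lemma moderate_smooth_inner: "(\<lambda>x. complex_of_real (x \<bullet> y)) \<in> smooth_class moderate"
proof (rule smooth_class_coinduct)
  let ?X = "insert (\<lambda>x. complex_of_real (x \<bullet> y)) (smooth_class moderate)"
  show "(\<lambda>x. complex_of_real (x \<bullet> y)) \<in> ?X" by blast
  fix f assume "f \<in> ?X"
  then consider "f = (\<lambda>x. complex_of_real (x \<bullet> y))" | "f \<in> smooth_class moderate" by blast
  then show "f \<in> moderate \<and> (\<exists>f'. (\<forall>x. (f has_derivative f' x) (at x)) \<and> (\<forall>b\<in>Basis. (\<lambda>x. f' x b) \<in> ?X))"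
  proof cases
    case 1
    have "\<bar>x \<bullet> y\<bar> \<le> norm y * (1 + norm x) ^ 1" for x
      using Cauchy_Schwarz_ineq2[of x y] by (simp add: algebra_simps add_increasing)
    then have "f \<in> moderate" unfolding 1 moderate_def
      by (intro CollectI exI[of _ "norm y"] exI[of _ 1]) simp
    moreover have "((\<lambda>x. complex_of_real (x \<bullet> y)) has_derivative (\<lambda>h. complex_of_real (h \<bullet> y))) (at x)" for x
      by (auto intro!: derivative_eq_intros)
    ultimately show ?thesis unfolding 1
      by (intro conjI exI[of _ "\<lambda>x h. complex_of_real (h \<bullet> y)"]) (auto simp: moderate_smooth_const)
  next
    case 2
    then have "(\<lambda>x. frechet_derivative f (at x) b) \<in> smooth_class moderate" if "b \<in> Basis" for b
      using smooth_classD(3)[of f, OF _ that] by (simp add: dir_deriv_def[abs_def])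
    then show ?thesis
      using smooth_classD(1,2)[OF 2] by (intro conjI exI[of _ "\<lambda>x. frechet_derivative f (at x)"]) auto
  qed
qed

lemma moderate_smooth_cis: "(\<lambda>x. cis (- (y \<bullet> x))) \<in> smooth_class moderate"
proof (rule smooth_class_coinduct)
  let ?X = "range (\<lambda>c x. c * cis (- (y \<bullet> x)))"
  show "(\<lambda>x. cis (- (y \<bullet> x))) \<in> ?X" by (rule range_eqI[of _ _ 1]) simp
  fix f assume "f \<in> ?X"
  then obtain c where f: "f = (\<lambda>x. c * cis (- (y \<bullet> x)))" by blast
  have "f \<in> moderate" unfolding moderate_def f
    by (intro CollectI exI[of _ "cmod c"] exI[of _ 0]) (simp add: norm_mult)
  moreover have "(f has_derivative (\<lambda>h. (- \<i> * (y \<bullet> h) * c) * cis (- (y \<bullet> x)))) (at x)" for x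
  proof -
    have "((\<lambda>x. \<i> * complex_of_real (- (y \<bullet> x))) has_derivative (\<lambda>h. \<i> * complex_of_real (- (y \<bullet> h)))) (at x)"
      by (auto intro!: derivative_eq_intros)
    from has_derivative_mult_right[OF has_derivative_compose[OF this DERIV_exp[unfolded has_field_derivative_def]], of c]
    show ?thesis by (simp add: f cis_conv_exp mult_ac)
  qed
  ultimately show "f \<in> moderate \<and> (\<exists>f'. (\<forall>x. (f has_derivative f' x) (at x)) \<and> (\<forall>b\<in>Basis. (\<lambda>x. f' x b) \<in> ?X))"
    by (rule smooth_class_stepI) (rule range_eqI, rule refl)
qed

text \<open>Differentiating the symbol of order \<open>s\<close> in direction \<open>b\<close> gives
  \<open>s * (x \<bullet> b)\<close> times the symbol of order \<open>s - 2\<close>. The coinduction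
  therefore runs over symbols of all orders at once, with moderate coefficients. Replacing
  \<open>s\<close> by \<open>\<bar>s\<bar>\<close> in the growth bound treats both signs.\<close>

lemma moderate_smooth_bracket:
  "(\<lambda>x::'a::euclidean_space. complex_of_real ((1 + (norm x)\<^sup>2) powr (s / 2))) \<in> smooth_class moderate"
proof -
  define m where "m s x = complex_of_real ((1 + (norm x)\<^sup>2) powr (s / 2))" for s and x :: 'a
  define X where "X = product_sums (smooth_class moderate) (range m)"
  have "m s \<in> moderate" for s
  proof -
    have "(1 + (norm x)\<^sup>2) powr (s / 2) \<le> (1 + norm x) ^ nat \<lceil>\<bar>s\<bar>\<rceil>" for x :: 'a
    proof -
      have "(1 + (norm x)\<^sup>2) powr (s / 2) \<le> (1 + (norm x)\<^sup>2) powr (\<bar>s\<bar> / 2)"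
        by (intro powr_mono) auto
      also have "\<dots> \<le> ((1 + norm x)\<^sup>2) powr (\<bar>s\<bar> / 2)"
        by (intro powr_mono2) (auto simp: power2_sum)
      also have "\<dots> = (1 + norm x) powr \<bar>s\<bar>"
        by (simp add: powr_powr add_pos_nonneg flip: powr_numeral)
      also have "\<dots> \<le> (1 + norm x) powr real (nat \<lceil>\<bar>s\<bar>\<rceil>)"
        by (intro powr_mono) auto
      also have "\<dots> = (1 + norm x) ^ nat \<lceil>\<bar>s\<bar>\<rceil>"
        by (intro powr_realpow) (simp add: add_pos_nonneg)
      finally show ?thesis .
    qed
    then show ?thesis
      unfolding moderate_def m_def by (intro CollectI exI[of _ 1] exI[of _ "nat \<lceil>\<bar>s\<bar>\<rceil>"]) simp
  qed
  then have mG: "\<And>g. g \<in> range m \<Longrightarrow> g \<in> moderate" by blast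
  have dm: "(m s has_derivative (\<lambda>h. complex_of_real s * complex_of_real (x \<bullet> h) * m (s - 2) x)) (at x)" for s x
  proof -
    have p: "0 < 1 + x \<bullet> x" by (simp add: add_pos_nonneg)
    have "((\<lambda>x. (1 + x \<bullet> x) powr (s / 2)) has_derivative
        (\<lambda>h. s * (x \<bullet> h) * (1 + x \<bullet> x) powr ((s - 2) / 2))) (at x)"
    proof -
      have "((\<lambda>x. 1 + x \<bullet> x) has_derivative (\<lambda>h. 2 * (x \<bullet> h))) (at x)"
        by (auto intro!: derivative_eq_intros simp: inner_commute)
      from DERIV_compose_FDERIV[OF has_real_derivative_powr[OF p, of "s / 2"] this]
      show ?thesis by (simp add: diff_divide_distrib mult_ac)
    qed
    from has_derivative_of_real[OF this, where 'a = complex] show ?thesis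
      by (simp add: m_def[abs_def] power2_norm_eq_inner)
  qed
  have "m s \<in> smooth_class moderate"
  proof (rule smooth_class_coinduct)
    have "(\<lambda>x. (\<lambda>_. 1) x * m s x) \<in> X"
      unfolding X_def by (intro product_sums.intros moderate_smooth_const rangeI)
    then show "m s \<in> X" by simp
    fix k assume "k \<in> X"
    then show "k \<in> moderate \<and> (\<exists>f'. (\<forall>x. (k has_derivative f' x) (at x)) \<and> (\<forall>b\<in>Basis. (\<lambda>x. f' x b) \<in> X))"
      unfolding X_def
    proof (induction rule: product_sums.induct)
      case (1 f g)
      then obtain s where g: "g = m s" by blast
      let ?k' = "\<lambda>x h. f x * (complex_of_real s * complex_of_real (x \<bullet> h) * m (s - 2) x) + frechet_derivative f (at x) h * g x"
      have "(\<lambda>x. ?k' x b) \<in> product_sums (smooth_class moderate) (range m)" if b: "b \<in> Basis" for b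
      proof -
        have "(\<lambda>x. (f x * (complex_of_real s * complex_of_real (x \<bullet> b))) * m (s - 2) x + dir_deriv b f x * g x)
            \<in> product_sums (smooth_class moderate) (range m)"
          using smooth_classD(3)[OF 1(1) b] 1
          by (intro product_sums.intros rangeI moderate_smooth_mult moderate_smooth_const moderate_smooth_inner) auto
        then show ?thesis by (simp add: dir_deriv_def mult.assoc)
      qed
      moreover have "((\<lambda>x. f x * g x) has_derivative ?k' x) (at x)" for x
        unfolding g by (intro has_derivative_mult smooth_classD(2)[OF 1(1)] dm)
      moreover have "(\<lambda>x. f x * g x) \<in> moderate"
        by (intro moderate_mult mG 1 smooth_classD(1)[OF 1(1)])
      ultimately show ?case by (intro smooth_class_stepI[where f' = ?k'])
    next
      case (2 f g)
      then obtain f' g' where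
        f': "\<And>x. (f has_derivative f' x) (at x)" "\<And>b. b \<in> Basis \<Longrightarrow> (\<lambda>x. f' x b) \<in> product_sums (smooth_class moderate) (range m)" and
        g': "\<And>x. (g has_derivative g' x) (at x)" "\<And>b. b \<in> Basis \<Longrightarrow> (\<lambda>x. g' x b) \<in> product_sums (smooth_class moderate) (range m)"
        by metis
      then show ?case
        using 2 by (intro conjI exI[of _ "\<lambda>x h. f' x h + g' x h"] allI ballI has_derivative_add product_sums.intros moderate_add)
          auto
    qed
  qed
  then show ?thesis by (simp add: m_def[abs_def])
qed

text \<open>With \<open>r = norm (x - y)\<close>, the weight is at most
  \<open>(1 + norm y) ^ k * exp (k * r)\<close>; completing the square in
  \<open>k * r - t * r\<^sup>2\<close> gives the maximum \<open>k\<^sup>2 / (4 * t)\<close> that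
  appears in the constant.\<close>

lemma gaussian_rapid:
  assumes "0 < t"
  shows "(\<lambda>x. complex_of_real (exp (- t * (norm (x - y))\<^sup>2))) \<in> rapid"
proof -
  have "(1 + norm x) ^ k * exp (- t * (norm (x - y))\<^sup>2) \<le> (1 + norm y) ^ k * exp ((real k)\<^sup>2 / (4 * t))" for x k
  proof -
    define r where "r = norm (x - y)"
    have r: "0 \<le> r" by (simp add: r_def)
    have "1 + norm x \<le> 1 + norm y + r" using norm_triangle_ineq2[of x y] by (simp add: r_def)
    also have "\<dots> \<le> (1 + norm y) * (1 + r)" using r by (simp add: algebra_simps)
    finally have "(1 + norm x) ^ k \<le> (1 + norm y) ^ k * (1 + r) ^ k"
      by (subst power_mult_distrib[symmetric]) (intro power_mono, auto)
    also have "(1 + r) ^ k \<le> exp (k * r)"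
      unfolding exp_of_nat_mult using r by (intro power_mono exp_ge_add_one_self) auto
    finally have *: "(1 + norm x) ^ k \<le> (1 + norm y) ^ k * exp (k * r)"
      by (simp add: mult_left_mono)
    have "0 \<le> (2 * t * r - k)\<^sup>2 / (4 * t)" using assms by simp
    also have "(2 * t * r - k)\<^sup>2 / (4 * t) = t * r\<^sup>2 - k * r + k\<^sup>2 / (4 * t)"
      using assms by (simp add: power2_eq_square field_simps)
    finally have "exp (k * r) * exp (- t * r\<^sup>2) \<le> exp ((real k)\<^sup>2 / (4 * t))"
      by (simp flip: exp_add)
    then have "(1 + norm y) ^ k * (exp (k * r) * exp (- t * r\<^sup>2)) \<le> (1 + norm y) ^ k * exp ((real k)\<^sup>2 / (4 * t))"
      by (intro mult_left_mono) auto
    moreover from * have "(1 + norm x) ^ k * exp (- t * r\<^sup>2) \<le> (1 + norm y) ^ k * exp (k * r) * exp (- t * r\<^sup>2)"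
      by (intro mult_right_mono) auto
    ultimately show ?thesis unfolding r_def mult.assoc by (rule order_trans[rotated])
  qed
  then show ?thesis unfolding rapid_def by (auto intro: exI)
qed

text \<open>A derivative of the Gaussian is the Gaussian times a polynomial, so the functions
  \<open>p * G\<close> with moderate smooth \<open>p\<close> form an invariant set.\<close>

lemma gaussian_schwartz:
  assumes "0 < t"
  shows "(\<lambda>x. complex_of_real (exp (- t * (norm (x - y))\<^sup>2))) \<in> schwartz"
  unfolding schwartz_eq
proof (rule smooth_class_coinduct)
  define G where "G x = complex_of_real (exp (- t * (norm (x - y))\<^sup>2))" for x
  define X where "X = {\<lambda>x. p x * G x |p. p \<in> smooth_class moderate}"
  show "(\<lambda>x. complex_of_real (exp (- t * (norm (x - y))\<^sup>2))) \<in> X"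
    unfolding X_def by (intro CollectI exI[of _ "\<lambda>_. 1"]) (simp add: G_def moderate_smooth_const)
  have dG: "(G has_derivative (\<lambda>h. complex_of_real (- (2 * t)) * (x \<bullet> h - y \<bullet> h) * G x)) (at x)" for x
  proof -
    have "((\<lambda>x. exp (- t * ((x - y) \<bullet> (x - y)))) has_derivative
        (\<lambda>h. (- (2 * t)) * (x \<bullet> h - y \<bullet> h) * exp (- t * ((x - y) \<bullet> (x - y))))) (at x)"
      by (auto intro!: derivative_eq_intros simp: fun_eq_iff algebra_simps inner_commute)
    from has_derivative_of_real[OF this, where 'a = complex] show ?thesis
      by (simp add: G_def[abs_def] power2_norm_eq_inner)
  qed
  fix f assume "f \<in> X"
  then obtain p where f: "f = (\<lambda>x. p x * G x)" and p: "p \<in> smooth_class moderate" by (auto simp: X_def)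
  let ?f' = "\<lambda>x h. p x * (complex_of_real (- (2 * t)) * (x \<bullet> h - y \<bullet> h) * G x) + frechet_derivative p (at x) h * G x"
  have "(\<lambda>x. ?f' x b) \<in> X" if b: "b \<in> Basis" for b
  proof -
    define q where "q x = complex_of_real (- (2 * t)) * (complex_of_real (x \<bullet> b) + complex_of_real (- (y \<bullet> b)))" for x
    have "q \<in> smooth_class moderate"
      unfolding q_def[abs_def]
      by (rule moderate_smooth_mult[OF moderate_smooth_const
          moderate_smooth_add[OF moderate_smooth_inner moderate_smooth_const]])
    then have "(\<lambda>x. p x * q x + dir_deriv b p x) \<in> smooth_class moderate"
      by (rule moderate_smooth_add[OF moderate_smooth_mult[OF p] smooth_classD(3)[OF p b]])
    then show ?thesis unfolding X_def
      by (intro CollectI exI[of _ "\<lambda>x. p x * q x + dir_deriv b p x"] conjI)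
        (simp_all add: q_def dir_deriv_def algebra_simps)
  qed
  moreover have "(f has_derivative ?f' x) (at x)" for x
    unfolding f by (intro has_derivative_mult smooth_classD(2)[OF p] dG)
  moreover have "f \<in> rapid"
    unfolding f G_def by (intro moderate_mult_rapid smooth_classD(1)[OF p] gaussian_rapid assms)
  ultimately show "f \<in> rapid \<and> (\<exists>f'. (\<forall>x. (f has_derivative f' x) (at x)) \<and> (\<forall>b\<in>Basis. (\<lambda>x. f' x b) \<in> X))"
    by (intro smooth_class_stepI[where f' = ?f'])
qed

section \<open>Lebesgue integrals of Schwartz functions and affine substitutions\<close>

lemma lborel_integral_affine:
  fixes f :: "'a::euclidean_space \<Rightarrow> complex"
  assumes "c \<noteq> 0" and [measurable]: "f \<in> borel_measurable borel"
  shows "(\<integral>x. f (t + c *\<^sub>R x) \<partial>lborel) = (\<integral>x. f x \<partial>lborel) / complex_of_real (\<bar>c\<bar> ^ DIM('a))"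
proof -
  have "(\<integral>x. f x \<partial>lborel)
      = (\<integral>x. f x \<partial>density (distr lborel borel (\<lambda>x. t + c *\<^sub>R x)) (\<lambda>_. ennreal (\<bar>c\<bar> ^ DIM('a))))"
    using lborel_affine[OF assms(1), of t] by simp
  also have "\<dots> = (\<integral>x. \<bar>c\<bar> ^ DIM('a) *\<^sub>R f x \<partial>distr lborel borel (\<lambda>x. t + c *\<^sub>R x))"
    by (rule integral_density) auto
  also have "\<dots> = \<bar>c\<bar> ^ DIM('a) *\<^sub>R (\<integral>x. f (t + c *\<^sub>R x) \<partial>lborel)"
    by (simp add: integral_distr)
  finally show ?thesis using assms(1) by (simp add: scaleR_conv_of_real)
qed

lemma lborel_integral_translate:
  fixes f :: "'a::euclidean_space \<Rightarrow> complex"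
  assumes "f \<in> borel_measurable borel"
  shows "(\<integral>x. f (x + t) \<partial>lborel) = (\<integral>x. f x \<partial>lborel)"
  using lborel_integral_affine[of 1 f t] assms by (simp add: add.commute)

text \<open>Two powers per coordinate: \<open>(1 + norm x)\<^sup>2\<close> dominates each
  \<open>1 + (x \<bullet> b)\<^sup>2\<close>, so the integral is bounded by a product of
  one-dimensional integrals of \<open>inverse (1 + t\<^sup>2)\<close>.\<close>

lemma integrable_inverse_power_norm:
  "integrable lborel (\<lambda>x::'a::euclidean_space. inverse ((1 + norm x) ^ (2 * DIM('a))))"
proof -
  have fin: "(\<integral>\<^sup>+t. ennreal (inverse (1 + t\<^sup>2)) \<partial>(lborel :: real measure)) < \<infinity>"
    using integrable_inverse_1_plus_square
    by (auto simp: set_integrable_def integrable_iff_bounded)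
  have le: "inverse ((1 + norm x) ^ (2 * DIM('a))) \<le> (\<Prod>b\<in>Basis. inverse (1 + (x \<bullet> b)\<^sup>2))" for x :: 'a
  proof -
    have "(\<Prod>b\<in>Basis. 1 + (x \<bullet> b)\<^sup>2) \<le> (\<Prod>b\<in>(Basis::'a set). (1 + norm x)\<^sup>2)"
    proof (intro prod_mono conjI)
      fix b :: 'a assume "b \<in> Basis"
      then have "(x \<bullet> b)\<^sup>2 \<le> (norm x)\<^sup>2" using Basis_le_norm[of b x] by (simp add: abs_le_square_iff[symmetric])
      then show "1 + (x \<bullet> b)\<^sup>2 \<le> (1 + norm x)\<^sup>2" by (simp add: power2_sum add_increasing2)
    qed simp
    then have "inverse ((1 + norm x) ^ (2 * DIM('a))) \<le> inverse (\<Prod>b\<in>Basis. 1 + (x \<bullet> b)\<^sup>2)"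
      by (intro le_imp_inverse_le) (auto simp: power_mult intro!: prod_pos add_pos_nonneg)
    then show ?thesis by (simp add: prod_inversef[symmetric] comp_def)
  qed
  have "(\<integral>\<^sup>+x. ennreal (inverse ((1 + norm x) ^ (2 * DIM('a)))) \<partial>(lborel :: 'a measure))
      \<le> (\<integral>\<^sup>+x. (\<Prod>b\<in>Basis. ennreal (inverse (1 + (x \<bullet> b)\<^sup>2))) \<partial>(lborel :: 'a measure))"
    using le by (intro nn_integral_mono) (simp add: prod_ennreal ennreal_leI)
  also have "\<dots> = (\<Prod>b\<in>(Basis::'a set). \<integral>\<^sup>+t. ennreal (inverse (1 + t\<^sup>2)) \<partial>(lborel :: real measure))"
    by (subst nn_integral_lborel_prod) auto
  also have "\<dots> < \<infinity>" using fin by (simp add: power_eq_top_ennreal less_top[symmetric])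
  finally show ?thesis by (auto simp: integrable_iff_bounded)
qed

lemma schwartz_measurable [measurable_dest]: "f \<in> schwartz \<Longrightarrow> f \<in> borel_measurable borel"
  unfolding schwartz_eq by (rule smooth_class_measurable)

lemma schwartz_decay:
  assumes "f \<in> schwartz"
  obtains C where "0 \<le> C" "\<And>x. cmod (f x) \<le> C * inverse ((1 + norm x) ^ k)"
proof -
  obtain C where C: "\<And>x. (1 + norm x) ^ k * cmod (f x) \<le> C"
    using smooth_classD(1)[OF assms[unfolded schwartz_eq]] by (auto simp: rapid_def)
  have "cmod (f x) \<le> C * inverse ((1 + norm x) ^ k)" for x
    using C[of x] by (simp add: field_simps add_pos_nonneg)
  moreover have "0 \<le> C" using C[of 0] by (auto intro: order_trans[rotated])
  ultimately show ?thesis using that by blast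
qed

lemma schwartz_integrable:
  assumes "f \<in> schwartz"
  shows "integrable lborel f"
proof -
  obtain C where "\<And>x. cmod (f x) \<le> C * inverse ((1 + norm x) ^ (2 * DIM('a)))"
    using schwartz_decay[OF assms] by metis
  then show ?thesis
    using integrable_mult_right[OF integrable_inverse_power_norm, of C] assms
    by (intro Bochner_Integration.integrable_bound[of lborel "\<lambda>x. C * inverse ((1 + norm x) ^ (2 * DIM('a)))" f])
      (auto intro!: AE_I2 order_trans[OF _ abs_ge_self])
qed

lemma schwartz_dir_deriv: "f \<in> schwartz \<Longrightarrow> b \<in> Basis \<Longrightarrow> dir_deriv b f \<in> schwartz"
  unfolding schwartz_eq by (rule smooth_classD)

lemma schwartz_has_derivative:
  "f \<in> schwartz \<Longrightarrow> (f has_derivative frechet_derivative f (at x)) (at x)"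
  unfolding schwartz_eq by (rule smooth_classD)

lemma schwartz_cmult: "f \<in> schwartz \<Longrightarrow> (\<lambda>x. c * f x) \<in> schwartz"
  by (rule schwartz_mult[OF moderate_smooth_const])

lemma schwartz_continuous: "f \<in> schwartz \<Longrightarrow> continuous_on S f"
  unfolding schwartz_eq by (rule smooth_class_continuous)

lemma schwartz_affine:
  fixes f :: "'a::euclidean_space \<Rightarrow> complex"
  assumes f: "f \<in> schwartz" and c: "c \<noteq> 0"
  shows "(\<lambda>x. f (t + c *\<^sub>R x)) \<in> schwartz"
  unfolding schwartz_eq
proof (rule smooth_class_coinduct)
  define X where "X = {\<lambda>x. f (t + c *\<^sub>R x) |f :: 'a \<Rightarrow> complex. f \<in> schwartz}"
  show "(\<lambda>x. f (t + c *\<^sub>R x)) \<in> X" using f by (auto simp: X_def)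
  fix g assume "g \<in> X"
  then obtain f :: "'a \<Rightarrow> complex" where g: "g = (\<lambda>x. f (t + c *\<^sub>R x))" and f: "f \<in> schwartz" by (auto simp: X_def)
  \<comment> \<open>\<open>K\<close> compares the weights at \<open>x\<close> and at
    \<open>t + c *\<^sub>R x\<close>: the triangle inequality bounds
    \<open>\<bar>c\<bar> * norm x\<close> by
    \<open>norm (t + c *\<^sub>R x) + norm t\<close>.\<close>
  define K where "K = 1 + (1 + norm t) / \<bar>c\<bar>"
  have K: "0 \<le> K" "1 + norm x \<le> K * (1 + norm (t + c *\<^sub>R x))" for x
  proof -
    show "0 \<le> K" by (auto simp: K_def intro!: add_nonneg_nonneg divide_nonneg_nonneg)
    have "\<bar>c\<bar> * norm x \<le> norm (t + c *\<^sub>R x) + norm t"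
      using norm_triangle_ineq4[of "t + c *\<^sub>R x" t] by simp
    also have "\<dots> \<le> (1 + norm t) * (1 + norm (t + c *\<^sub>R x))" by (simp add: algebra_simps)
    finally have "norm x \<le> (1 + norm t) / \<bar>c\<bar> * (1 + norm (t + c *\<^sub>R x))"
      using c by (simp add: field_simps)
    then show "1 + norm x \<le> K * (1 + norm (t + c *\<^sub>R x))"
      using norm_ge_zero[of "t + c *\<^sub>R x"] unfolding K_def distrib_right mult_1 by linarith
  qed
  have rapid: "g \<in> rapid"
    unfolding rapid_def
  proof (intro CollectI allI)
    fix k
    obtain C where C: "\<And>x. (1 + norm x) ^ k * cmod (f x) \<le> C"
      using smooth_classD(1)[OF f[unfolded schwartz_eq]] by (auto simp: rapid_def)
    have "(1 + norm x) ^ k * cmod (g x) \<le> K ^ k * C" for x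
    proof -
      have "(1 + norm x) ^ k * cmod (g x) \<le> (K * (1 + norm (t + c *\<^sub>R x))) ^ k * cmod (g x)"
        using K by (intro mult_right_mono power_mono) auto
      also have "\<dots> = K ^ k * ((1 + norm (t + c *\<^sub>R x)) ^ k * cmod (f (t + c *\<^sub>R x)))"
        by (simp add: g power_mult_distrib)
      also have "\<dots> \<le> K ^ k * C" using K(1) by (intro mult_left_mono C) auto
      finally show ?thesis .
    qed
    then show "\<exists>C. \<forall>x. (1 + norm x) ^ k * cmod (g x) \<le> C" by blast
  qed
  have "((\<lambda>x. t + c *\<^sub>R x) has_derivative (\<lambda>h. c *\<^sub>R h)) (at x)" for x :: 'a
    by (auto intro!: derivative_eq_intros)
  note der = has_derivative_compose[OF this schwartz_has_derivative[OF f]]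
  have "(\<lambda>x. frechet_derivative f (at (t + c *\<^sub>R x)) (c *\<^sub>R b)) \<in> X" if "b \<in> Basis" for b
  proof -
    have "frechet_derivative f (at (t + c *\<^sub>R x)) (c *\<^sub>R b) = complex_of_real c * dir_deriv b f (t + c *\<^sub>R x)" for x
      using has_derivative_bounded_linear[OF schwartz_has_derivative[OF f]]
      by (simp add: dir_deriv_def linear_simps(5) scaleR_conv_of_real)
    then show ?thesis
      unfolding X_def by (intro CollectI exI[of _ "\<lambda>x. complex_of_real c * dir_deriv b f x"] conjI)
        (simp_all add: schwartz_cmult schwartz_dir_deriv f that)
  qed
  with rapid der show "g \<in> rapid \<and> (\<exists>f'. (\<forall>x. (g has_derivative f' x) (at x)) \<and> (\<forall>b\<in>Basis. (\<lambda>x. f' x b) \<in> X))"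
    unfolding g by (rule smooth_class_stepI)
qed

text \<open>The difference quotients integrate to zero by translation invariance.\<close>

lemma integral_dir_deriv:
  fixes f :: "'a::euclidean_space \<Rightarrow> complex"
  assumes f: "f \<in> schwartz" and b: "b \<in> Basis"
  shows "(\<integral>x. dir_deriv b f x \<partial>lborel) = 0"
proof -
  define h where "h n = 1 / real (Suc n)" for n
  define q where "q n x = (f (x + h n *\<^sub>R b) - f x) / complex_of_real (h n)" for n x
  have h: "0 < h n" "h n \<le> 1" for n by (auto simp: h_def)
  have h0: "h \<longlonglongrightarrow> 0"
    using LIMSEQ_inverse_real_of_nat by (simp add: h_def[abs_def] inverse_eq_divide)
  have [measurable]: "f \<in> borel_measurable borel" using f by (rule schwartz_measurable)
  have [measurable]: "dir_deriv b f \<in> borel_measurable borel"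
    using schwartz_dir_deriv[OF f b] by (rule schwartz_measurable)
  have line: "((\<lambda>t. f (x + t *\<^sub>R b)) has_derivative (\<lambda>t. t *\<^sub>R dir_deriv b f (x + s *\<^sub>R b))) (at s)" for x s
  proof -
    have "((\<lambda>t. x + t *\<^sub>R b) has_derivative (\<lambda>t. t *\<^sub>R b)) (at s)"
      by (auto intro!: derivative_eq_intros)
    from has_derivative_compose[OF this schwartz_has_derivative[OF f]]
    show ?thesis
      using has_derivative_bounded_linear[OF schwartz_has_derivative[OF f]]
      by (simp add: dir_deriv_def linear_simps(5))
  qed
  obtain C where C: "0 \<le> C" "\<And>x. cmod (dir_deriv b f x) \<le> C * inverse ((1 + norm x) ^ (2 * DIM('a)))"
    using schwartz_decay[OF schwartz_dir_deriv[OF f b], of "2 * DIM('a)"] by metis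
  \<comment> \<open>By the mean value theorem the quotient is bounded by the derivative at a point
    within distance 1 of \<open>x\<close>. Moving there changes the weight \<open>1 + norm x\<close>
    by a factor of at most 2, which is raised to the power \<open>2 * DIM('a)\<close>.\<close>
  define B where "B x = C * 2 ^ (2 * DIM('a)) * inverse ((1 + norm x) ^ (2 * DIM('a)))" for x :: 'a
  have qB: "cmod (q n x) \<le> B x" for n x
  proof -
    have cont: "continuous_on {0..h n} (\<lambda>t. f (x + t *\<^sub>R b))"
      by (rule has_derivative_continuous_on[OF has_derivative_at_withinI[OF line]])
    obtain s where s: "0 < s" "s < h n"
      "cmod (f (x + h n *\<^sub>R b) - f (x + 0 *\<^sub>R b)) \<le> cmod ((h n - 0) *\<^sub>R dir_deriv b f (x + s *\<^sub>R b))"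
      using mvt_general[OF h(1)[of n] cont, where f' = "\<lambda>s t. t *\<^sub>R dir_deriv b f (x + s *\<^sub>R b)"] line[of x]
      by (meson greaterThanLessThan_iff)
    have "norm x \<le> norm (x + s *\<^sub>R b) + norm (s *\<^sub>R b)"
      using norm_triangle_ineq4[of "x + s *\<^sub>R b" "s *\<^sub>R b"] by simp
    moreover have "norm (s *\<^sub>R b) \<le> 1" using s h(2)[of n] b by simp
    ultimately have "1 + norm x \<le> 2 * (1 + norm (x + s *\<^sub>R b))"
      using norm_ge_zero[of "x + s *\<^sub>R b"] unfolding distrib_left by linarith
    then have "(1 + norm x) ^ (2 * DIM('a)) \<le> 2 ^ (2 * DIM('a)) * (1 + norm (x + s *\<^sub>R b)) ^ (2 * DIM('a))"
      unfolding power_mult_distrib[symmetric] by (intro power_mono) auto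
    then have "inverse ((1 + norm (x + s *\<^sub>R b)) ^ (2 * DIM('a))) \<le> 2 ^ (2 * DIM('a)) * inverse ((1 + norm x) ^ (2 * DIM('a)))"
      by (simp add: divide_simps add_pos_nonneg)
    then have "C * inverse ((1 + norm (x + s *\<^sub>R b)) ^ (2 * DIM('a))) \<le> B x"
      unfolding B_def mult.assoc using C by (intro mult_left_mono)
    with C(2)[of "x + s *\<^sub>R b"] have "cmod (dir_deriv b f (x + s *\<^sub>R b)) \<le> B x" by linarith
    then have "h n * cmod (dir_deriv b f (x + s *\<^sub>R b)) \<le> h n * B x"
      using h(1)[of n] by (intro mult_left_mono) auto
    moreover have "cmod (f (x + h n *\<^sub>R b) - f x) \<le> h n * cmod (dir_deriv b f (x + s *\<^sub>R b))"
      using s(3) h(1)[of n] by simp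
    ultimately have "cmod (f (x + h n *\<^sub>R b) - f x) \<le> h n * B x" by (rule order_trans[rotated])
    then show ?thesis using h(1)[of n] by (simp add: q_def norm_divide field_simps)
  qed
  have "(\<lambda>n. \<integral>x. q n x \<partial>lborel) \<longlonglongrightarrow> (\<integral>x. dir_deriv b f x \<partial>lborel)"
  proof (rule integral_dominated_convergence[where w = B])
    show "integrable lborel B"
      unfolding B_def by (intro integrable_mult_right integrable_inverse_power_norm)
    show "AE x in lborel. (\<lambda>n. q n x) \<longlonglongrightarrow> dir_deriv b f x"
    proof (rule AE_I2)
      fix x
      have "filterlim h (at 0) sequentially"
        using h0 h(1) by (auto simp: filterlim_at less_imp_neq[symmetric])
      moreover have "((\<lambda>t. cmod (f (x + t *\<^sub>R b) - f x - t *\<^sub>R dir_deriv b f x) / norm t) \<longlongrightarrow> 0) (at 0)"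
        using line[of x 0] by (simp add: has_derivative_at)
      ultimately have "(\<lambda>n. cmod (f (x + h n *\<^sub>R b) - f x - h n *\<^sub>R dir_deriv b f x) / norm (h n)) \<longlonglongrightarrow> 0"
        by (rule filterlim_compose[rotated])
      moreover have "cmod (f (x + h n *\<^sub>R b) - f x - h n *\<^sub>R dir_deriv b f x) / norm (h n)
          = cmod (q n x - dir_deriv b f x)" for n
      proof -
        have "q n x - dir_deriv b f x
            = (f (x + h n *\<^sub>R b) - f x - h n *\<^sub>R dir_deriv b f x) / complex_of_real (h n)"
          using h(1)[of n] by (simp add: q_def scaleR_conv_of_real diff_divide_distrib)
        then show ?thesis by (simp add: norm_divide)
      qed
      ultimately show "(\<lambda>n. q n x) \<longlonglongrightarrow> dir_deriv b f x"
        by (simp add: tendsto_norm_zero_iff LIM_zero_iff)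
    qed
  qed (auto simp: q_def[abs_def] qB[unfolded q_def])
  moreover have "(\<integral>x. q n x \<partial>lborel) = 0" for n
  proof -
    have i: "integrable lborel (\<lambda>x. f (x + h n *\<^sub>R b))"
      using schwartz_integrable[OF schwartz_affine[OF f, of 1 "h n *\<^sub>R b"]] by (simp add: add.commute)
    show ?thesis
      unfolding q_def using i schwartz_integrable[OF f]
      by (simp add: lborel_integral_translate)
  qed
  ultimately show ?thesis using LIMSEQ_unique[OF _ tendsto_const] by simp
qed

section \<open>Fourier inversion\<close>

text \<open>The quadratic remainder lets the Fourier integral be differentiated by a direct
  estimate.\<close>

lemma cmod_cis_Taylor: "cmod (cis (- (a + b)) - cis (- a) - (- \<i> * b * cis (- a))) \<le> b\<^sup>2"
proof -
  have "cis (- (a + b)) - cis (- a) - (- \<i> * b * cis (- a)) = cis (- a) * (cis (- b) - (1 + \<i> * (- b)))"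
    by (simp add: algebra_simps cis_mult)
  then have "cmod (cis (- (a + b)) - cis (- a) - (- \<i> * b * cis (- a))) = cmod (cis (- b) - (1 + \<i> * (- b)))"
    by (simp add: norm_mult)
  also have "\<dots> \<le> \<bar>- b\<bar> ^ 2 / 2"
    using iexp_approx1[of "- b" 1] by (simp add: cis_conv_exp power2_eq_square)
  also have "\<dots> \<le> b\<^sup>2" by simp
  finally show ?thesis .
qed

lemma moderate_smooth_sum:
  assumes "\<And>i. i \<in> I \<Longrightarrow> f i \<in> smooth_class moderate"
  shows "(\<lambda>x. \<Sum>i\<in>I. f i x) \<in> smooth_class moderate"
  using assms
proof (induction I rule: infinite_finite_induct)
  case (insert i I)
  then have "(\<lambda>x. f i x + (\<Sum>i\<in>I. f i x)) \<in> smooth_class moderate"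
    by (intro moderate_smooth_add) auto
  with insert show ?case by simp
qed (simp_all add: moderate_smooth_const)

lemma fourier_integrable: "f \<in> schwartz \<Longrightarrow> integrable lborel (\<lambda>x. cis (- (\<xi> \<bullet> x)) * f x)"
  by (intro schwartz_integrable schwartz_mult moderate_smooth_cis)

lemma fourier_cmult: "fourier (\<lambda>x. c * f x) \<xi> = c * fourier f \<xi>"
proof -
  have "fourier (\<lambda>x. c * f x) \<xi> = (\<integral>x. c * (cis (- (\<xi> \<bullet> x)) * f x) \<partial>lborel)"
    by (simp add: fourier_def mult.left_commute)
  also have "\<dots> = c * fourier f \<xi>" by (simp add: fourier_def)
  finally show ?thesis .
qed

lemma fourier_norm_le:
  "cmod (fourier f \<xi>) \<le> (\<integral>x. cmod (f x) \<partial>lborel)"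
  unfolding fourier_def by (rule order_trans[OF integral_norm_bound]) (simp add: norm_mult)

text \<open>The Taylor bound for the phase, with increment \<open>h \<bullet> x\<close>, integrates
  to a remainder of at most \<open>K * (norm h)\<^sup>2\<close>, where \<open>K\<close> is the
  second absolute moment of \<open>f\<close>.\<close>

lemma fourier_has_derivative:
  assumes f: "f \<in> schwartz"
  shows "(fourier f has_derivative (\<lambda>h. \<integral>x. - \<i> * complex_of_real (h \<bullet> x) * cis (- (\<xi> \<bullet> x)) * f x \<partial>lborel)) (at \<xi>)"
    (is "(_ has_derivative ?D) _")
proof -
  have int: "integrable lborel (\<lambda>x. - \<i> * complex_of_real (h \<bullet> x) * cis (- (\<xi> \<bullet> x)) * f x)" for h
    by (intro schwartz_integrable schwartz_mult moderate_smooth_mult moderate_smooth_const moderate_smooth_cis f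
        moderate_smooth_inner[of h, unfolded inner_commute[of _ h]])
  \<comment> \<open>Writing the squared norm as a sum of products of coordinates makes it a moderate
    multiplier, so the second moment is finite.\<close>
  define sq where "sq x = (\<Sum>b\<in>Basis. complex_of_real (x \<bullet> b) * complex_of_real (x \<bullet> b))" for x :: 'a
  have sq: "sq x = complex_of_real ((norm x)\<^sup>2)" for x
    unfolding sq_def power2_norm_eq_inner by (subst euclidean_inner) simp
  have "(\<lambda>x. sq x * f x) \<in> schwartz"
  proof (rule schwartz_mult[OF _ f])
    show "sq \<in> smooth_class moderate"
      unfolding sq_def[abs_def]
      by (rule moderate_smooth_sum[OF moderate_smooth_mult[OF moderate_smooth_inner moderate_smooth_inner]])
  qed
  then have "integrable lborel (\<lambda>x. cmod (sq x * f x))"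
    by (intro integrable_norm schwartz_integrable)
  then have intn: "integrable lborel (\<lambda>x. (norm x)\<^sup>2 * cmod (f x))"
    by (simp add: sq norm_mult norm_power del: of_real_power)
  define K where "K = (\<integral>x. (norm x)\<^sup>2 * cmod (f x) \<partial>lborel)"
  have K: "0 \<le> K" unfolding K_def by (intro Bochner_Integration.integral_nonneg) simp
  have "linear ?D"
  proof (rule linearI)
    fix h k :: 'a and r :: real
    show "?D (h + k) = ?D h + ?D k"
      by (subst Bochner_Integration.integral_add[symmetric, OF int int])
        (simp add: inner_add_left algebra_simps)
    have "?D (r *\<^sub>R h) = (\<integral>x. r *\<^sub>R (- \<i> * complex_of_real (h \<bullet> x) * cis (- (\<xi> \<bullet> x)) * f x) \<partial>lborel)"
      by (intro Bochner_Integration.integral_cong) (simp_all add: scaleR_conv_of_real)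
    also have "\<dots> = r *\<^sub>R ?D h" by (rule integral_scaleR_right)
    finally show "?D (r *\<^sub>R h) = r *\<^sub>R ?D h" .
  qed
  then have bl: "bounded_linear ?D" by (simp only: linear_conv_bounded_linear)
  have rem: "cmod (fourier f (\<xi> + h) - fourier f \<xi> - ?D h) \<le> K * (norm h)\<^sup>2" for h
  proof -
    have "fourier f (\<xi> + h) - fourier f \<xi> - ?D h
        = (\<integral>x. cis (- ((\<xi> + h) \<bullet> x)) * f x - cis (- (\<xi> \<bullet> x)) * f x - (- \<i> * complex_of_real (h \<bullet> x) * cis (- (\<xi> \<bullet> x)) * f x) \<partial>lborel)"
      unfolding fourier_def using fourier_integrable[OF f] int by simp
    also have "cmod \<dots> \<le> (\<integral>x. (norm h)\<^sup>2 * ((norm x)\<^sup>2 * cmod (f x)) \<partial>lborel)"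
    proof (rule Bochner_Integration.integral_norm_bound_integral)
      fix x
      have "cis (- ((\<xi> + h) \<bullet> x)) * f x - cis (- (\<xi> \<bullet> x)) * f x - (- \<i> * complex_of_real (h \<bullet> x) * cis (- (\<xi> \<bullet> x)) * f x)
        = (cis (- (\<xi> \<bullet> x + h \<bullet> x)) - cis (- (\<xi> \<bullet> x)) - (- \<i> * (h \<bullet> x) * cis (- (\<xi> \<bullet> x)))) * f x"
        by (simp add: inner_add_left algebra_simps)
      also have "cmod \<dots> \<le> (h \<bullet> x)\<^sup>2 * cmod (f x)"
        unfolding norm_mult by (intro mult_right_mono cmod_cis_Taylor) auto
      also have "\<dots> \<le> (norm h * norm x)\<^sup>2 * cmod (f x)"
        using Cauchy_Schwarz_ineq2[of h x] by (intro mult_right_mono) (auto simp: abs_le_square_iff[symmetric])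
      finally show "cmod (cis (- ((\<xi> + h) \<bullet> x)) * f x - cis (- (\<xi> \<bullet> x)) * f x - (- \<i> * complex_of_real (h \<bullet> x) * cis (- (\<xi> \<bullet> x)) * f x))
          \<le> (norm h)\<^sup>2 * ((norm x)\<^sup>2 * cmod (f x))"
        by (simp add: power_mult_distrib mult_ac)
    qed (intro Bochner_Integration.integrable_diff fourier_integrable f int integrable_mult_right intn)+
    also have "\<dots> = K * (norm h)\<^sup>2" by (simp add: K_def)
    finally show ?thesis .
  qed
  show ?thesis
    unfolding has_derivative_at
  proof (intro conjI bl)
    have "((\<lambda>h. K * norm h) \<longlongrightarrow> 0) (at (0 :: 'a))"
      by (auto intro!: tendsto_eq_intros)
    then show "((\<lambda>h. cmod (fourier f (\<xi> + h) - fourier f \<xi> - ?D h) / norm h) \<longlongrightarrow> 0) (at 0)"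
    proof (rule Lim_null_comparison[rotated])
      show "eventually (\<lambda>h. norm (cmod (fourier f (\<xi> + h) - fourier f \<xi> - ?D h) / norm h) \<le> K * norm h) (at 0)"
        using rem by (intro always_eventually allI) (auto simp: divide_simps power2_eq_square mult.assoc K)
    qed
  qed
qed

lemma dir_deriv_fourier:
  "f \<in> schwartz \<Longrightarrow> dir_deriv b (fourier f) = fourier (\<lambda>x. (- \<i> * complex_of_real (x \<bullet> b)) * f x)"
  by (subst dir_deriv_eqI[OF fourier_has_derivative])
    (auto simp: fourier_def[abs_def] fun_eq_iff inner_commute mult_ac)

text \<open>Integration by parts: the phase times \<open>f\<close> is again a Schwartz function, and
  its directional derivative integrates to zero.\<close>

lemma fourier_dir_deriv:
  assumes f: "f \<in> schwartz" and b: "b \<in> Basis"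
  shows "fourier (dir_deriv b f) \<xi> = \<i> * complex_of_real (\<xi> \<bullet> b) * fourier f \<xi>"
proof -
  define g where "g x = cis (- (\<xi> \<bullet> x)) * f x" for x
  have g: "g \<in> schwartz"
    unfolding g_def[abs_def] by (intro schwartz_mult moderate_smooth_cis f)
  have "((\<lambda>x. cis (- (\<xi> \<bullet> x))) has_derivative (\<lambda>h. - \<i> * (\<xi> \<bullet> h) * cis (- (\<xi> \<bullet> x)))) (at x)" for x
  proof -
    have "((\<lambda>x. \<i> * complex_of_real (- (\<xi> \<bullet> x))) has_derivative (\<lambda>h. \<i> * complex_of_real (- (\<xi> \<bullet> h)))) (at x)"
      by (auto intro!: derivative_eq_intros)
    from has_derivative_compose[OF this DERIV_exp[unfolded has_field_derivative_def]]
    show ?thesis by (simp add: cis_conv_exp mult_ac)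
  qed
  from has_derivative_mult[OF this schwartz_has_derivative[OF f]]
  have "dir_deriv b g = (\<lambda>x. cis (- (\<xi> \<bullet> x)) * frechet_derivative f (at x) b + - \<i> * (\<xi> \<bullet> b) * cis (- (\<xi> \<bullet> x)) * f x)"
    unfolding g_def[abs_def] by (rule dir_deriv_eqI)
  then have "(\<integral>x. cis (- (\<xi> \<bullet> x)) * dir_deriv b f x + (- \<i> * (\<xi> \<bullet> b)) * (cis (- (\<xi> \<bullet> x)) * f x) \<partial>lborel) = 0"
    using integral_dir_deriv[OF g b] by (simp add: dir_deriv_def mult.assoc)
  then have "fourier (dir_deriv b f) \<xi> + (- \<i> * (\<xi> \<bullet> b)) * fourier f \<xi> = 0"
    using fourier_integrable[OF f] fourier_integrable[OF schwartz_dir_deriv[OF f b]]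
    by (subst (asm) Bochner_Integration.integral_add) (auto simp: fourier_def)
  then show ?thesis by simp
qed

text \<open>Each power of \<open>norm \<xi>\<close> is at most the sum of the
  \<open>\<bar>\<xi> \<bullet> b\<bar>\<close>, and a factor \<open>\<xi> \<bullet> b\<close> is
  traded for a derivative of \<open>f\<close>; so the induction on the power has to range over all
  Schwartz functions.\<close>

lemma fourier_rapid:
  fixes f :: "'a::euclidean_space \<Rightarrow> complex"
  assumes "f \<in> schwartz"
  shows "fourier f \<in> rapid"
proof -
  have "\<exists>C. \<forall>\<xi>. norm \<xi> ^ k * cmod (fourier f \<xi>) \<le> C" for k
    using assms
  proof (induction k arbitrary: f)
    case 0
    then show ?case using fourier_norm_le by auto
  next
    case (Suc k)
    have "\<forall>b\<in>Basis. \<exists>C. \<forall>\<xi>. norm \<xi> ^ k * cmod (fourier (dir_deriv b f) \<xi>) \<le> C"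
      using Suc schwartz_dir_deriv by blast
    then obtain C where C: "\<And>b \<xi>. b \<in> Basis \<Longrightarrow> norm \<xi> ^ k * cmod (fourier (dir_deriv b f) \<xi>) \<le> C b"
      by metis
    have "norm \<xi> ^ Suc k * cmod (fourier f \<xi>) \<le> sum C Basis" for \<xi>
    proof -
      have "norm \<xi> ^ Suc k * cmod (fourier f \<xi>) = norm \<xi> * (norm \<xi> ^ k * cmod (fourier f \<xi>))"
        by simp
      also have "\<dots> \<le> (\<Sum>b\<in>Basis. \<bar>\<xi> \<bullet> b\<bar>) * (norm \<xi> ^ k * cmod (fourier f \<xi>))"
        by (intro mult_right_mono norm_le_l1) auto
      also have "\<dots> = (\<Sum>b\<in>Basis. norm \<xi> ^ k * cmod (fourier (dir_deriv b f) \<xi>))"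
        unfolding sum_distrib_right
        by (intro sum.cong) (auto simp: fourier_dir_deriv[OF Suc.prems] norm_mult)
      also have "\<dots> \<le> sum C Basis" by (intro sum_mono C)
      finally show ?thesis .
    qed
    then show ?case by blast
  qed
  then show ?thesis unfolding rapid_iff bounded_iff by (simp add: abs_mult)
qed

text \<open>The image of the Schwartz functions is itself invariant under differentiation: a
  derivative of the transform is the transform of \<open>f\<close> times a coordinate, up to a
  constant.\<close>

lemma fourier_schwartz:
  assumes "f \<in> schwartz"
  shows "fourier f \<in> schwartz"
  unfolding schwartz_eq
proof (rule smooth_class_coinduct)
  show "fourier f \<in> fourier ` schwartz" using assms by blast
  fix g :: "'a \<Rightarrow> complex" assume "g \<in> fourier ` schwartz"
  then obtain f where g: "g = fourier f" and f: "f \<in> schwartz" by blast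
  have "(\<lambda>\<xi>. \<integral>x. - \<i> * complex_of_real (b \<bullet> x) * cis (- (\<xi> \<bullet> x)) * f x \<partial>lborel) \<in> fourier ` schwartz" for b
  proof -
    have "(\<lambda>x. (- \<i> * complex_of_real (x \<bullet> b)) * f x) \<in> schwartz"
      by (intro schwartz_mult moderate_smooth_mult moderate_smooth_const moderate_smooth_inner f)
    moreover have "(\<lambda>\<xi>. \<integral>x. - \<i> * complex_of_real (b \<bullet> x) * cis (- (\<xi> \<bullet> x)) * f x \<partial>lborel)
        = fourier (\<lambda>x. (- \<i> * complex_of_real (x \<bullet> b)) * f x)"
      by (auto simp: fourier_def[abs_def] fun_eq_iff inner_commute mult_ac)
    ultimately show ?thesis by simp
  qed
  then show "g \<in> rapid \<and> (\<exists>f'. (\<forall>x. (g has_derivative f' x) (at x)) \<and> (\<forall>b\<in>Basis. (\<lambda>x. f' x b) \<in> fourier ` schwartz))"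
    unfolding g by (intro smooth_class_stepI[OF fourier_rapid[OF f] fourier_has_derivative[OF f]])
qed

section \<open>The Gaussian and the inversion theorem\<close>

lemma borel_measurable_cis [measurable]: "cis \<in> borel_measurable borel"
  by (intro borel_measurable_continuous_onI continuous_intros)

text \<open>For the kernel \<open>cis (- (\<xi> \<bullet> x))\<close> this is the width at which the
  Gaussian is an eigenfunction of the transform.\<close>

definition gauss :: "'a::euclidean_space \<Rightarrow> complex" where
  "gauss x = complex_of_real (exp (- (norm x)\<^sup>2 / 2))"

lemma gauss_schwartz: "gauss \<in> schwartz"
  using gaussian_schwartz[of "1 / 2" 0] by (simp add: gauss_def[abs_def])

lemma gauss_has_derivative: "(gauss has_derivative (\<lambda>h. - complex_of_real (x \<bullet> h) * gauss x)) (at x)"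
proof -
  have "((\<lambda>x. exp (- (x \<bullet> x) / 2)) has_derivative (\<lambda>h. - (x \<bullet> h) * exp (- (x \<bullet> x) / 2))) (at x)"
    by (auto intro!: derivative_eq_intros simp: fun_eq_iff algebra_simps inner_commute)
  from has_derivative_of_real[OF this, where 'a = complex] show ?thesis
    by (simp add: gauss_def[abs_def] power2_norm_eq_inner)
qed

text \<open>The one-dimensional value is read off from the total mass 1 of the standard normal
  density; the general case is a product over coordinates.\<close>

lemma integral_gauss:
  "(\<integral>x. gauss x \<partial>(lborel :: 'a::euclidean_space measure)) = complex_of_real (sqrt (2 * pi) ^ DIM('a))"
proof -
  have nn1: "(\<integral>\<^sup>+t. ennreal (exp (- t\<^sup>2 / 2)) \<partial>(lborel :: real measure)) = ennreal (sqrt (2 * pi))"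
  proof -
    have "(\<integral>\<^sup>+t. ennreal (normal_density 0 1 t) \<partial>(lborel :: real measure)) = 1"
      using prob_space.emeasure_space_1[OF prob_space_normal_density[of 1 0]]
      by (simp add: emeasure_density)
    then have "ennreal (sqrt (2 * pi)) = (\<integral>\<^sup>+t. ennreal (sqrt (2 * pi)) * ennreal (normal_density 0 1 t) \<partial>(lborel :: real measure))"
      by (simp add: nn_integral_cmult)
    also have "\<dots> = (\<integral>\<^sup>+t. ennreal (exp (- t\<^sup>2 / 2)) \<partial>(lborel :: real measure))"
      by (intro nn_integral_cong) (simp add: ennreal_mult'[symmetric] normal_density_def)
    finally show ?thesis by simp
  qed
  have prod: "exp (- (norm x)\<^sup>2 / 2) = (\<Prod>b\<in>Basis. exp (- (x \<bullet> b)\<^sup>2 / 2))" for x :: 'a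
  proof -
    have "(norm x)\<^sup>2 = (\<Sum>b\<in>Basis. (x \<bullet> b)\<^sup>2)"
      unfolding power2_norm_eq_inner by (subst euclidean_inner) (simp add: power2_eq_square)
    then have "- (norm x)\<^sup>2 / 2 = (\<Sum>b\<in>Basis. - (x \<bullet> b)\<^sup>2 / 2)"
      by (simp add: sum_negf sum_divide_distrib)
    then show ?thesis by (simp only: exp_sum finite_Basis)
  qed
  have "(\<integral>\<^sup>+x. ennreal (exp (- (norm x)\<^sup>2 / 2)) \<partial>(lborel :: 'a measure))
      = (\<integral>\<^sup>+x. (\<Prod>b\<in>Basis. ennreal (exp (- (x \<bullet> b)\<^sup>2 / 2))) \<partial>(lborel :: 'a measure))"
    unfolding prod by (simp add: prod_ennreal)
  also have "\<dots> = (\<Prod>b\<in>(Basis :: 'a set). ennreal (sqrt (2 * pi)))"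
    by (subst nn_integral_lborel_prod) (auto simp: nn1[simplified])
  also have "\<dots> = ennreal (sqrt (2 * pi) ^ DIM('a))" by (simp add: ennreal_power)
  finally have "(\<integral>x. exp (- (norm x)\<^sup>2 / 2) \<partial>(lborel :: 'a measure)) = sqrt (2 * pi) ^ DIM('a)"
    by (subst integral_eq_nn_integral) auto
  then show ?thesis by (simp add: gauss_def[abs_def])
qed

text \<open>The quotient of the Fourier transform by the Gaussian has vanishing gradient.\<close>

lemma fourier_gauss:
  "fourier gauss \<xi> = complex_of_real (sqrt (2 * pi) ^ DIM('a)) * gauss \<xi>" for \<xi> :: "'a::euclidean_space"
proof -
  define E where "E \<xi> = complex_of_real (exp ((norm \<xi>)\<^sup>2 / 2))" for \<xi> :: 'a
  have E: "E \<xi> * gauss \<xi> = 1" for \<xi>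
    by (simp add: E_def gauss_def flip: of_real_mult exp_add)
  have dE: "(E has_derivative (\<lambda>h. complex_of_real (x \<bullet> h) * E x)) (at x)" for x
  proof -
    have "((\<lambda>x. exp ((x \<bullet> x) / 2)) has_derivative (\<lambda>h. (x \<bullet> h) * exp ((x \<bullet> x) / 2))) (at x)"
      by (auto intro!: derivative_eq_intros simp: fun_eq_iff algebra_simps inner_commute)
    from has_derivative_of_real[OF this, where 'a = complex] show ?thesis
      by (simp add: E_def[abs_def] power2_norm_eq_inner)
  qed
  let ?F = "fourier (gauss :: 'a \<Rightarrow> complex)"
  \<comment> \<open>The transform satisfies the same first order equation as \<open>gauss\<close>:
    differentiating it brings down \<open>- \<i> * (x \<bullet> b)\<close>, which on
    \<open>gauss\<close> is \<i> times a derivative, and that derivative becomes a factor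
    \<open>\<i> * (\<xi> \<bullet> b)\<close>.\<close>
  have dir: "dir_deriv b ?F \<xi> = - complex_of_real (\<xi> \<bullet> b) * ?F \<xi>" if "b \<in> Basis" for b \<xi>
  proof -
    have "dir_deriv b (gauss :: 'a \<Rightarrow> complex) = (\<lambda>x. - complex_of_real (x \<bullet> b) * gauss x)"
      by (rule dir_deriv_eqI) (rule gauss_has_derivative)
    then have "(\<lambda>x. (- \<i> * complex_of_real (x \<bullet> b)) * gauss x) = (\<lambda>x. \<i> * dir_deriv b (gauss :: 'a \<Rightarrow> complex) x)"
      by (simp add: fun_eq_iff)
    then have "dir_deriv b ?F \<xi> = \<i> * fourier (dir_deriv b gauss) \<xi>"
      by (simp only: dir_deriv_fourier[OF gauss_schwartz] fourier_cmult)
    also have "\<dots> = \<i> * (\<i> * complex_of_real (\<xi> \<bullet> b) * ?F \<xi>)"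
      by (simp only: fourier_dir_deriv[OF gauss_schwartz that])
    finally show ?thesis by (simp add: mult.assoc[symmetric])
  qed
  have dF: "(?F has_derivative (\<lambda>h. - complex_of_real (\<xi> \<bullet> h) * ?F \<xi>)) (at \<xi>)" for \<xi>
  proof -
    let ?D = "frechet_derivative ?F (at \<xi>)"
    have der: "(?F has_derivative ?D) (at \<xi>)"
      by (intro schwartz_has_derivative fourier_schwartz gauss_schwartz)
    have "?D = (\<lambda>h. - complex_of_real (\<xi> \<bullet> h) * ?F \<xi>)"
    proof (rule linear_eq_stdbasis)
      show "linear ?D" using der by (rule has_derivative_linear)
      show "linear (\<lambda>h. - complex_of_real (\<xi> \<bullet> h) * ?F \<xi>)"
        by (rule linearI) (simp_all add: inner_add_right algebra_simps scaleR_conv_of_real)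
      fix b :: 'a assume "b \<in> Basis"
      then show "?D b = - complex_of_real (\<xi> \<bullet> b) * ?F \<xi>"
        using dir[of b \<xi>] by (simp add: dir_deriv_def)
    qed
    with der show ?thesis by simp
  qed
  have "((\<lambda>x. E x * ?F x) has_derivative (\<lambda>h. 0)) (at x within UNIV)" for x
    using has_derivative_mult[OF dE dF, of x] by (simp add: mult_ac)
  then obtain c where c: "\<And>x. E x * ?F x = c"
    using has_derivative_zero_constant[of UNIV "\<lambda>x. E x * ?F x"] by auto
  have "c = ?F 0" using c[of 0] by (simp add: E_def)
  also have "\<dots> = complex_of_real (sqrt (2 * pi) ^ DIM('a))"
    using integral_gauss[where 'a = 'a] by (simp add: fourier_def)
  finally show ?thesis using c[of \<xi>] E[of \<xi>]
    by (metis mult.commute mult.left_commute mult.right_neutral)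
qed

text \<open>Fubini's theorem for a kernel that is symmetric in the two variables.\<close>

lemma fourier_pairing:
  assumes f: "f \<in> schwartz" and g: "g \<in> schwartz"
  shows "(\<integral>x. fourier f x * g x \<partial>lborel) = (\<integral>x. f x * fourier g x \<partial>lborel)"
proof -
  have [measurable]: "f \<in> borel_measurable borel" "g \<in> borel_measurable borel"
    using f g schwartz_measurable by auto
  have int: "integrable (lborel \<Otimes>\<^sub>M lborel) (\<lambda>(x, y). cis (- (x \<bullet> y)) * f y * g x)"
  proof (rule lborel_pair.Fubini_integrable)
    show "integrable lborel (\<lambda>x. \<integral>y. norm (case (x, y) of (x, y) \<Rightarrow> cis (- (x \<bullet> y)) * f y * g x) \<partial>lborel)"
      using schwartz_integrable[OF g] by (simp add: norm_mult integrable_norm)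
    show "AE x in lborel. integrable lborel (\<lambda>y. case (x, y) of (x, y) \<Rightarrow> cis (- (x \<bullet> y)) * f y * g x)"
      using fourier_integrable[OF f] by simp
  qed measurable
  have "(\<integral>x. fourier f x * g x \<partial>lborel) = (\<integral>x. (\<integral>y. cis (- (x \<bullet> y)) * f y * g x \<partial>lborel) \<partial>lborel)"
    by (simp add: fourier_def)
  also have "\<dots> = (\<integral>y. (\<integral>x. cis (- (x \<bullet> y)) * f y * g x \<partial>lborel) \<partial>lborel)"
    using lborel_pair.Fubini_integral[OF int] by simp
  also have "\<dots> = (\<integral>y. f y * fourier g y \<partial>lborel)"
  proof (rule Bochner_Integration.integral_cong[OF refl])
    fix y
    have "(\<integral>x. cis (- (x \<bullet> y)) * f y * g x \<partial>lborel) = (\<integral>x. f y * (cis (- (y \<bullet> x)) * g x) \<partial>lborel)"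
      by (simp add: inner_commute mult_ac)
    then show "(\<integral>x. cis (- (x \<bullet> y)) * f y * g x \<partial>lborel) = f y * fourier g y"
      by (simp add: fourier_def)
  qed
  finally show ?thesis .
qed

lemma inverse_fourier_eq:
  "inverse_fourier f x = fourier f (- x) / complex_of_real ((2 * pi) ^ DIM('a))" for x :: "'a::euclidean_space"
  by (simp add: inverse_fourier_def fourier_def inner_commute)

lemma inverse_fourier_schwartz:
  fixes f :: "'a::euclidean_space \<Rightarrow> complex"
  assumes "f \<in> schwartz"
  shows "inverse_fourier f \<in> schwartz"
proof -
  have "(\<lambda>x. (1 / complex_of_real ((2 * pi) ^ DIM('a))) * fourier f (0 + (- 1) *\<^sub>R x)) \<in> schwartz"
    by (intro schwartz_cmult schwartz_affine fourier_schwartz assms) simp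
  then show ?thesis by (simp add: inverse_fourier_eq[abs_def])
qed

text \<open>
  Pair the Fourier transform of \<open>z \<mapsto> f (x + \<epsilon> z)\<close> with the Gaussian and let \<open>\<epsilon>\<close> tend to zero.
\<close>

lemma fourier_inversion:
  fixes f :: "'a::euclidean_space \<Rightarrow> complex"
  assumes f: "f \<in> schwartz"
  shows "inverse_fourier (fourier f) = f"
proof (rule ext)
  fix x :: 'a
  define c where "c = complex_of_real (sqrt (2 * pi) ^ DIM('a))"
  have c2: "c * c = complex_of_real ((2 * pi) ^ DIM('a))"
  proof -
    have "sqrt (2 * pi) ^ DIM('a) * sqrt (2 * pi) ^ DIM('a) = (sqrt (2 * pi) * sqrt (2 * pi)) ^ DIM('a)"
      by (rule power_mult_distrib[symmetric])
    also have "sqrt (2 * pi) * sqrt (2 * pi) = 2 * pi" by simp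
    finally show ?thesis by (simp only: c_def of_real_mult[symmetric])
  qed
  define h where "h n = 1 / real (Suc n)" for n
  have h: "0 < h n" for n by (simp add: h_def)
  have h0: "h \<longlonglongrightarrow> 0"
    using LIMSEQ_inverse_real_of_nat by (simp add: h_def[abs_def] inverse_eq_divide)
  have [measurable]: "f \<in> borel_measurable borel" "gauss \<in> borel_measurable borel" "fourier f \<in> borel_measurable borel"
    using f gauss_schwartz fourier_schwartz[OF f] schwartz_measurable by auto
  have id: "(\<integral>\<xi>. cis (\<xi> \<bullet> x) * fourier f \<xi> * gauss (h n *\<^sub>R \<xi>) \<partial>lborel) = c * (\<integral>z. f (x + h n *\<^sub>R z) * gauss z \<partial>lborel)" for n
  proof -
    define fn where "fn z = f (x + h n *\<^sub>R z)" for z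
    have fn: "fn \<in> schwartz" using schwartz_affine[OF f, of "h n" x] h[of n] by (simp add: fn_def[abs_def])
    \<comment> \<open>Translation by \<open>x\<close> produces the phase and dilation the factor
      \<open>\<bar>h n\<bar> ^ DIM('a)\<close>; the latter cancels when the pairing with
      \<open>gauss\<close> is rescaled.\<close>
    have F: "fourier fn (h n *\<^sub>R \<xi>) = cis (\<xi> \<bullet> x) * fourier f \<xi> / complex_of_real (\<bar>h n\<bar> ^ DIM('a))" for \<xi>
    proof -
      have "fourier fn (h n *\<^sub>R \<xi>) = (\<integral>z. cis (- (\<xi> \<bullet> ((x + h n *\<^sub>R z) - x))) * f (x + h n *\<^sub>R z) \<partial>lborel)"
        by (simp add: fourier_def fn_def)
      also have "\<dots> = (\<integral>y. cis (- (\<xi> \<bullet> (y - x))) * f y \<partial>lborel) / complex_of_real (\<bar>h n\<bar> ^ DIM('a))"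
        using h[of n] by (intro lborel_integral_affine) auto
      also have "(\<integral>y. cis (- (\<xi> \<bullet> (y - x))) * f y \<partial>lborel) = (\<integral>y. cis (\<xi> \<bullet> x) * (cis (- (\<xi> \<bullet> y)) * f y) \<partial>lborel)"
        by (intro Bochner_Integration.integral_cong)
          (simp_all add: inner_diff_right mult.assoc[symmetric] cis_mult)
      finally show ?thesis by (simp add: fourier_def)
    qed
    have "(\<integral>\<xi>. cis (\<xi> \<bullet> x) * fourier f \<xi> * gauss (h n *\<^sub>R \<xi>) \<partial>lborel)
        = (\<integral>\<xi>. complex_of_real (\<bar>h n\<bar> ^ DIM('a)) * (fourier fn (0 + h n *\<^sub>R \<xi>) * gauss (0 + h n *\<^sub>R \<xi>)) \<partial>lborel)"
      using h[of n] by (simp add: F)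
    also have "\<dots> = complex_of_real (\<bar>h n\<bar> ^ DIM('a)) * (\<integral>\<xi>. fourier fn (0 + h n *\<^sub>R \<xi>) * gauss (0 + h n *\<^sub>R \<xi>) \<partial>lborel)"
      by (rule integral_mult_right_zero)
    also have "\<dots> = (\<integral>\<eta>. fourier fn \<eta> * gauss \<eta> \<partial>lborel)"
      using h[of n] schwartz_measurable[OF fourier_schwartz[OF fn]]
      by (subst lborel_integral_affine) auto
    also have "\<dots> = (\<integral>z. fn z * fourier gauss z \<partial>lborel)"
      by (rule fourier_pairing[OF fn gauss_schwartz])
    also have "\<dots> = (\<integral>z. c * (fn z * gauss z) \<partial>lborel)"
      by (simp add: fourier_gauss c_def mult_ac)
    also have "\<dots> = c * (\<integral>z. fn z * gauss z \<partial>lborel)" by (rule integral_mult_right_zero)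
    finally show ?thesis by (simp add: fn_def)
  qed
  have gauss_le: "cmod (gauss y) \<le> 1" for y :: 'a by (simp add: gauss_def)
  have gauss0: "gauss (0 :: 'a) = 1" by (simp add: gauss_def)
  have gauss_cont: "(\<lambda>n. gauss (h n *\<^sub>R \<xi>)) \<longlonglongrightarrow> gauss (0 *\<^sub>R \<xi>)" for \<xi> :: 'a
    by (rule continuous_on_tendsto_compose[OF schwartz_continuous[OF gauss_schwartz, of UNIV]
          tendsto_scaleR[OF h0 tendsto_const]]) auto
  obtain B where B: "\<And>x. cmod (f x) \<le> B"
    using schwartz_decay[OF f, of 0] by auto
  have lim1: "(\<lambda>n. \<integral>\<xi>. cis (\<xi> \<bullet> x) * fourier f \<xi> * gauss (h n *\<^sub>R \<xi>) \<partial>lborel) \<longlonglongrightarrow> (\<integral>\<xi>. cis (\<xi> \<bullet> x) * fourier f \<xi> \<partial>lborel)"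
  proof (rule integral_dominated_convergence[where w = "\<lambda>\<xi>. cmod (fourier f \<xi>)"])
    show "integrable lborel (\<lambda>\<xi>. cmod (fourier f \<xi>))"
      by (intro integrable_norm schwartz_integrable fourier_schwartz f)
    show "AE \<xi> in lborel. (\<lambda>n. cis (\<xi> \<bullet> x) * fourier f \<xi> * gauss (h n *\<^sub>R \<xi>)) \<longlonglongrightarrow> cis (\<xi> \<bullet> x) * fourier f \<xi>"
    proof (rule AE_I2)
      fix \<xi>
      have "(\<lambda>n. cis (\<xi> \<bullet> x) * fourier f \<xi> * gauss (h n *\<^sub>R \<xi>)) \<longlonglongrightarrow> cis (\<xi> \<bullet> x) * fourier f \<xi> * gauss (0 *\<^sub>R \<xi>)"
        by (intro tendsto_mult tendsto_const gauss_cont)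
      then show "(\<lambda>n. cis (\<xi> \<bullet> x) * fourier f \<xi> * gauss (h n *\<^sub>R \<xi>)) \<longlonglongrightarrow> cis (\<xi> \<bullet> x) * fourier f \<xi>"
        by (simp add: gauss0)
    qed
  qed (auto simp: norm_mult intro!: mult_left_le gauss_le)
  have lim2: "(\<lambda>n. c * (\<integral>z. f (x + h n *\<^sub>R z) * gauss z \<partial>lborel)) \<longlonglongrightarrow> c * (\<integral>z. f x * gauss z \<partial>(lborel :: 'a measure))"
  proof (intro tendsto_mult tendsto_const integral_dominated_convergence[where w = "\<lambda>z. B * cmod (gauss z)"])
    show "integrable lborel (\<lambda>z :: 'a. B * cmod (gauss z))"
      by (intro integrable_mult_right integrable_norm schwartz_integrable gauss_schwartz)
    have "(\<lambda>n. f (x + h n *\<^sub>R z)) \<longlonglongrightarrow> f (x + 0 *\<^sub>R z)" for z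
      by (rule continuous_on_tendsto_compose[OF schwartz_continuous[OF f, of UNIV]
            tendsto_add[OF tendsto_const tendsto_scaleR[OF h0 tendsto_const]]]) auto
    then show "AE z in lborel. (\<lambda>n. f (x + h n *\<^sub>R z) * gauss z) \<longlonglongrightarrow> f x * gauss z"
      by (intro AE_I2 tendsto_mult tendsto_const) simp
  qed (auto simp: norm_mult intro!: mult_right_mono B)
  have val: "(\<integral>z. f x * gauss z \<partial>(lborel :: 'a measure)) = f x * c"
    by (simp add: integral_gauss c_def)
  have "(\<integral>\<xi>. cis (\<xi> \<bullet> x) * fourier f \<xi> \<partial>lborel) = c * (f x * c)"
    using LIMSEQ_unique[OF lim1[unfolded id] lim2] unfolding val .
  then have "(\<integral>\<xi>. cis (\<xi> \<bullet> x) * fourier f \<xi> \<partial>lborel) = f x * complex_of_real ((2 * pi) ^ DIM('a))"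
    unfolding c2[symmetric] by simp
  then show "inverse_fourier (fourier f) x = f x"
    by (simp add: inverse_fourier_def)
qed

text \<open>The two transforms differ by a reflection and a constant, so the substitution of
  \<open>- x\<close> for \<open>x\<close> reduces this order of composition to the other
  one.\<close>

lemma fourier_inverse_fourier:
  fixes f :: "'a::euclidean_space \<Rightarrow> complex"
  assumes f: "f \<in> schwartz"
  shows "fourier (inverse_fourier f) = f"
proof (rule ext)
  fix \<xi> :: 'a
  define k where "k = complex_of_real ((2 * pi) ^ DIM('a))"
  have [measurable]: "fourier f \<in> borel_measurable borel"
    using fourier_schwartz[OF f] schwartz_measurable by auto
  have "fourier (inverse_fourier f) \<xi> = (\<integral>x. cis (\<xi> \<bullet> (0 + (- 1) *\<^sub>R x)) * fourier f (0 + (- 1) *\<^sub>R x) / k \<partial>lborel)"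
    by (simp add: fourier_def[of "inverse_fourier f"] inverse_fourier_eq k_def)
  also have "\<dots> = (\<integral>x. cis (\<xi> \<bullet> x) * fourier f x / k \<partial>lborel)"
    by (subst lborel_integral_affine[of "- 1" "\<lambda>x. cis (\<xi> \<bullet> x) * fourier f x / k"]) auto
  also have "\<dots> = inverse_fourier (fourier f) \<xi>"
    by (simp add: inverse_fourier_def k_def inner_commute)
  also have "\<dots> = f \<xi>" by (simp add: fourier_inversion[OF f])
  finally show "fourier (inverse_fourier f) \<xi> = f \<xi>" .
qed

section \<open>The bracket operators on Schwartz functions\<close>

lemma bracket_nabla_fun_schwartz:
  assumes "f \<in> schwartz"
  shows "bracket_nabla_fun s f \<in> schwartz"
  unfolding bracket_nabla_fun_def
  by (intro inverse_fourier_schwartz schwartz_mult moderate_smooth_bracket fourier_schwartz assms)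

text \<open>Both orders of inversion occur: \<open>fourier\<close> after
  \<open>inverse_fourier\<close> cancels in the middle, the symbols multiply to 1, and
  \<open>inverse_fourier\<close> after \<open>fourier\<close> remains.\<close>

lemma bracket_nabla_fun_inverse:
  fixes f :: "'a::euclidean_space \<Rightarrow> complex"
  assumes f: "f \<in> schwartz"
  shows "bracket_nabla_fun s (bracket_nabla_fun (- s) f) = f"
proof -
  define m where "m s \<xi> = complex_of_real ((1 + (norm \<xi>)\<^sup>2) powr (s / 2))" for s and \<xi> :: 'a
  have mm: "m s \<xi> * m (- s) \<xi> = 1" for \<xi>
  proof -
    have "0 < 1 + (norm \<xi>)\<^sup>2" by (simp add: add_pos_nonneg)
    then show ?thesis by (simp add: m_def powr_minus flip: of_real_mult)
  qed
  have "fourier (bracket_nabla_fun (- s) f) = (\<lambda>\<xi>. m (- s) \<xi> * fourier f \<xi>)"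
    unfolding bracket_nabla_fun_def m_def
    by (intro fourier_inverse_fourier schwartz_mult moderate_smooth_bracket fourier_schwartz f)
  then have "bracket_nabla_fun s (bracket_nabla_fun (- s) f) = inverse_fourier (\<lambda>\<xi>. m s \<xi> * (m (- s) \<xi> * fourier f \<xi>))"
    by (simp add: bracket_nabla_fun_def[of s] m_def)
  then show ?thesis
    by (simp add: mult.assoc[symmetric] mm fourier_inversion[OF f])
qed

section \<open>Square integrable functions as distributions\<close>

text \<open>The positive and negative parts are densities of finite measures that agree on boxes.
  Boxes generate the Borel sets and are stable under intersection, so the measures coincide, and
  densities are unique almost everywhere.\<close>

lemma AE_zero_if_box_integrals_zero_real:
  fixes w :: "'a::euclidean_space \<Rightarrow> real"
  assumes w: "integrable lborel w"
    and box: "\<And>a b. (\<integral>x. indicator (box a b) x * w x \<partial>lborel) = 0"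
  shows "AE x in lborel. w x = 0"
proof -
  have [measurable]: "w \<in> borel_measurable borel" using w by simp
  define p where "p x = max 0 (w x)" for x
  define q where "q x = max 0 (- w x)" for x
  have pq: "0 \<le> p x" "0 \<le> q x" "p x - q x = w x" for x by (auto simp: p_def q_def)
  have int: "integrable lborel p" "integrable lborel q"
    unfolding p_def q_def using w by (auto intro!: integrable_max)
  have [measurable]: "p \<in> borel_measurable borel" "q \<in> borel_measurable borel" using int by simp_all
  have int_ind: "integrable lborel (\<lambda>x. indicator (box a b) x * p x)"
    "integrable lborel (\<lambda>x. indicator (box a b) x * q x)" for a b
    using integrable_mult_indicator[OF _ int(1), of "box a b"]
      integrable_mult_indicator[OF _ int(2), of "box a b"] by simp_all
  have emeas: "emeasure (density lborel (\<lambda>x. ennreal (f x))) (box a b)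
      = ennreal (\<integral>x. indicator (box a b) x * f x \<partial>lborel)"
    if "integrable lborel (\<lambda>x. indicator (box a b) x * f x)" "\<And>x. 0 \<le> f x" "f \<in> borel_measurable borel"
    for f :: "'a \<Rightarrow> real" and a b
    using that by (subst nn_integral_eq_integral[symmetric])
      (auto simp: emeasure_density intro!: nn_integral_cong split: split_indicator)
  have "density lborel (\<lambda>x. ennreal (p x)) = density lborel (\<lambda>x. ennreal (q x))"
  proof (rule measure_eqI_generator_eq)
    let ?E = "range (\<lambda>(a, b). box a b :: 'a set)"
    show "Int_stable ?E" by (auto simp: Int_stable_def box_Int_box)
    show "sets (density lborel (\<lambda>x. ennreal (p x))) = sigma_sets UNIV ?E"
      "sets (density lborel (\<lambda>x. ennreal (q x))) = sigma_sets UNIV ?E"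
      by (simp_all add: borel_eq_box)
    show "range (\<lambda>n :: nat. box (- (real n *\<^sub>R One)) (real n *\<^sub>R One)) \<subseteq> ?E" by auto
    show "(\<Union>n :: nat. box (- (real n *\<^sub>R One)) (real n *\<^sub>R One)) = (UNIV :: 'a set)"
      by (rule UN_box_eq_UNIV)
    show "emeasure (density lborel (\<lambda>x. ennreal (p x))) (box (- (real n *\<^sub>R One)) (real n *\<^sub>R One)) \<noteq> \<infinity>" for n :: nat
      by (simp add: emeas[OF int_ind(1) pq(1)])
    fix X assume "X \<in> ?E"
    then obtain a b where X: "X = box a b" by auto
    have "(\<integral>x. indicator (box a b) x * p x \<partial>lborel) - (\<integral>x. indicator (box a b) x * q x \<partial>lborel)
        = (\<integral>x. indicator (box a b) x * w x \<partial>lborel)"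
      by (subst Bochner_Integration.integral_diff[symmetric, OF int_ind])
        (simp add: pq(3) flip: right_diff_distrib)
    then show "emeasure (density lborel (\<lambda>x. ennreal (p x))) X = emeasure (density lborel (\<lambda>x. ennreal (q x))) X"
      by (simp add: X emeas int_ind pq box)
  qed simp_all
  moreover have "(\<integral>\<^sup>+x. ennreal (p x) \<partial>lborel) \<noteq> \<infinity>"
    by (subst nn_integral_eq_integral[OF int(1)]) (simp_all add: pq)
  ultimately have "AE x in lborel. ennreal (p x) = ennreal (q x)"
    by (subst (asm) finite_density_unique) auto
  then show ?thesis
    by eventually_elim (metis pq ennreal_inj diff_self)
qed

lemma AE_zero_if_box_integrals_zero:
  fixes w :: "'a::euclidean_space \<Rightarrow> complex"
  assumes w: "integrable lborel w"
    and box: "\<And>a b. (\<integral>x. indicator (box a b) x *\<^sub>R w x \<partial>lborel) = 0"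
  shows "AE x in lborel. w x = 0"
proof -
  have int: "integrable lborel (\<lambda>x. indicator (box a b) x *\<^sub>R w x)" for a b
    using w by (intro integrable_mult_indicator) auto
  have "AE x in lborel. Re (w x) = 0"
  proof (rule AE_zero_if_box_integrals_zero_real)
    show "(\<integral>x. indicator (box a b) x * Re (w x) \<partial>lborel) = 0" for a b
      using arg_cong[OF box[of a b], of Re] integral_Re[OF int[of a b]] by simp
  qed (use w in simp)
  moreover have "AE x in lborel. Im (w x) = 0"
  proof (rule AE_zero_if_box_integrals_zero_real)
    show "(\<integral>x. indicator (box a b) x * Im (w x) \<partial>lborel) = 0" for a b
      using arg_cong[OF box[of a b], of Im] integral_Im[OF int[of a b]] by simp
  qed (use w in simp)
  ultimately show ?thesis by eventually_elim (simp add: complex_eq_iff)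
qed

lemma schwartz_moderate_smooth: "f \<in> schwartz \<Longrightarrow> f \<in> smooth_class moderate"
proof -
  have "g \<in> moderate" if "g \<in> rapid" for g :: "'a \<Rightarrow> complex"
  proof -
    from that obtain C where "\<And>x. (1 + norm x) ^ 0 * cmod (g x) \<le> C" unfolding rapid_def by blast
    then show ?thesis unfolding moderate_def by (intro CollectI exI[of _ C] exI[of _ 0]) simp
  qed
  then show "f \<in> schwartz \<Longrightarrow> f \<in> smooth_class moderate"
    unfolding schwartz_eq smooth_class_def by blast
qed

lemma schwartz_square_integrable: "f \<in> schwartz \<Longrightarrow> square_integrable f"
proof -
  assume f: "f \<in> schwartz"
  then have "integrable lborel (\<lambda>x. cmod (f x * f x))"
    by (intro integrable_norm schwartz_integrable schwartz_mult schwartz_moderate_smooth)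
  with schwartz_measurable[OF f] show ?thesis
    by (simp add: square_integrable_def norm_mult power2_eq_square)
qed

lemma square_integrable_mult_integrable:
  assumes "square_integrable f" "square_integrable g"
  shows "integrable lborel (\<lambda>x. f x * g x)"
proof -
  have "square_integrable (\<lambda>x. cnj (f x))"
    using assms(1) by (auto simp: square_integrable_def)
  from integrable_cnj_mult[OF this assms(2)] show ?thesis by simp
qed

text \<open>The boundary is where the smoothed indicators of a box may fail to approach a multiple
  of the indicator.\<close>

lemma box_boundary_null: "cbox a b - box a b \<in> null_sets (lborel :: 'a::euclidean_space measure)"
proof -
  have "emeasure lborel (cbox a b - box a b) = emeasure lborel (cbox a b) - emeasure lborel (box a b)"
    by (rule emeasure_Diff) (use emeasure_lborel_box_finite[of a b] in \<open>auto simp: box_subset_cbox\<close>)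
  then show ?thesis
    by (auto simp: emeasure_lborel_cbox_eq emeasure_lborel_box_eq)
qed

text \<open>
  Integrating the Gaussians of width \<open>h n\<close> over their centres in a box gives functions that tend
  to a multiple of the indicator of the box.
\<close>

lemma square_integrable_zero_if_annihilates_schwartz:
  fixes H :: "'a::euclidean_space \<Rightarrow> complex"
  assumes H: "square_integrable H" and zero: "\<And>\<phi>. \<phi> \<in> schwartz \<Longrightarrow> (\<integral>x. H x * \<phi> x \<partial>lborel) = 0"
  shows "AE x in lborel. H x = 0"
proof -
  have [measurable]: "H \<in> borel_measurable borel" using H by (simp add: square_integrable_def)
  have [measurable]: "(gauss :: 'a \<Rightarrow> complex) \<in> borel_measurable borel"
    using gauss_schwartz schwartz_measurable by auto
  \<comment> \<open>Multiplying by a Schwartz function makes \<open>H\<close> integrable and keeps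
    its pairings with Schwartz functions zero; since \<open>gauss\<close> has no zeros, nothing is
    lost on returning to \<open>H\<close>.\<close>
  define w where "w x = H x * gauss x" for x
  have w: "integrable lborel w"
    unfolding w_def by (intro square_integrable_mult_integrable H schwartz_square_integrable gauss_schwartz)
  have [measurable]: "w \<in> borel_measurable borel" unfolding w_def by measurable
  define h where "h n = 1 / real (Suc n)" for n
  have h: "0 < h n" for n by (simp add: h_def)
  have h0: "h \<longlonglongrightarrow> 0"
    using LIMSEQ_inverse_real_of_nat by (simp add: h_def[abs_def] inverse_eq_divide)
  have gauss_le: "cmod (gauss y) \<le> 1" for y :: 'a by (simp add: gauss_def)
  have wG: "(\<integral>x. w x * gauss ((y - x) /\<^sub>R h n) \<partial>lborel) = 0" for y n
  proof -
    have "gauss ((y - x) /\<^sub>R h n) = complex_of_real (exp (- (1 / (2 * (h n)\<^sup>2)) * (norm (x - y))\<^sup>2))" for x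
    proof -
      have "norm ((y - x) /\<^sub>R h n) = norm (x - y) / h n"
        using h[of n] by (simp add: norm_minus_commute divide_inverse)
      then show ?thesis by (simp add: gauss_def power_divide)
    qed
    then have "(\<lambda>x. gauss ((y - x) /\<^sub>R h n)) \<in> schwartz"
      using gaussian_schwartz[of "1 / (2 * (h n)\<^sup>2)" y] h[of n] by simp
    then have "(\<lambda>x. gauss x * gauss ((y - x) /\<^sub>R h n)) \<in> schwartz"
      by (intro schwartz_mult schwartz_moderate_smooth gauss_schwartz)
    from zero[OF this] show ?thesis by (simp add: w_def mult.assoc)
  qed
  have "(\<integral>x. indicator (box a b) x *\<^sub>R w x \<partial>lborel) = 0" for a b
  proof -
    define I where "I x = (indicator (box a b) x :: complex)" for x
    have [measurable]: "I \<in> borel_measurable borel" unfolding I_def by measurable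
    have I_le: "cmod (I x) \<le> 1" for x by (simp add: I_def split: split_indicator)
    have intI: "integrable lborel (\<lambda>x. cmod (I x))"
    proof -
      have "integrable lborel (indicator (box a b) :: 'a \<Rightarrow> real)"
        by (intro integrable_real_indicator) (use emeasure_lborel_box_finite[of a b] in auto)
      moreover have "cmod (I x) = indicator (box a b) x" for x by (simp add: I_def split: split_indicator)
      ultimately show ?thesis by (simp cong: Bochner_Integration.integrable_cong)
    qed
    define k where "k n x = (\<integral>z. I (x + h n *\<^sub>R z) * gauss z \<partial>lborel)" for n x
    have inner: "(\<integral>y. I y * gauss ((y - x) /\<^sub>R h n) \<partial>lborel) = k n x * complex_of_real (h n ^ DIM('a))" for x n
    proof -
      have "k n x = (\<integral>z. I (x + h n *\<^sub>R z) * gauss (((x + h n *\<^sub>R z) - x) /\<^sub>R h n) \<partial>lborel)"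
        using h[of n] by (simp add: k_def)
      also have "\<dots> = (\<integral>y. I y * gauss ((y - x) /\<^sub>R h n) \<partial>lborel) / complex_of_real (\<bar>h n\<bar> ^ DIM('a))"
        using h[of n] by (intro lborel_integral_affine) auto
      finally show ?thesis using h[of n] by simp
    qed
    have wk: "(\<integral>x. w x * k n x \<partial>lborel) = 0" for n
    proof -
      \<comment> \<open>A product of two integrable functions of separate variables, which dominates
        the Fubini integrand because \<open>gauss\<close> is at most 1 in modulus.\<close>
      have int2: "integrable (lborel \<Otimes>\<^sub>M lborel) (\<lambda>(x, y). w x * I y)"
      proof (rule lborel_pair.Fubini_integrable)
        show "integrable lborel (\<lambda>x. \<integral>y. norm (case (x, y) of (x, y) \<Rightarrow> w x * I y) \<partial>lborel)"
          using w by (simp add: norm_mult integrable_norm)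
        show "AE x in lborel. integrable lborel (\<lambda>y. case (x, y) of (x, y) \<Rightarrow> w x * I y)"
          using intI by (auto simp: integrable_norm_iff)
      qed measurable
      have int: "integrable (lborel \<Otimes>\<^sub>M lborel) (\<lambda>(x, y). w x * I y * gauss ((y - x) /\<^sub>R h n))"
        by (rule Bochner_Integration.integrable_bound[OF int2])
          (auto simp: norm_mult intro!: AE_I2 mult_left_le gauss_le)
      have "(\<integral>x. w x * k n x \<partial>lborel) * complex_of_real (h n ^ DIM('a))
          = (\<integral>x. (\<integral>y. w x * I y * gauss ((y - x) /\<^sub>R h n) \<partial>lborel) \<partial>lborel)"
        by (simp add: mult.assoc inner flip: integral_mult_left_zero)
      also have "\<dots> = (\<integral>y. (\<integral>x. w x * I y * gauss ((y - x) /\<^sub>R h n) \<partial>lborel) \<partial>lborel)"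
        using lborel_pair.Fubini_integral[OF int] by simp
      also have "\<dots> = (\<integral>y. I y * (\<integral>x. w x * gauss ((y - x) /\<^sub>R h n) \<partial>lborel) \<partial>(lborel :: 'a measure))"
        by (intro Bochner_Integration.integral_cong refl, subst integral_mult_right_zero[symmetric])
          (simp add: mult_ac)
      also have "\<dots> = 0" by (simp add: wG)
      finally show ?thesis using h[of n] by simp
    qed
    define c where "c = (\<integral>z. gauss z \<partial>(lborel :: 'a measure))"
    have c: "c \<noteq> 0" by (simp add: c_def integral_gauss)
    define C where "C = (\<integral>z. cmod (gauss z) \<partial>(lborel :: 'a measure))"
    have gint: "integrable lborel (\<lambda>z :: 'a. cmod (gauss z))"
      by (intro integrable_norm schwartz_integrable gauss_schwartz)
    have I_gauss_le: "cmod (I y * gauss z) \<le> cmod (gauss z)" for y z :: 'a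
      by (simp add: norm_mult mult_left_le_one_le I_le)
    have k_le: "cmod (k n x) \<le> C" for n x
      unfolding k_def C_def
    proof (rule Bochner_Integration.integral_norm_bound_integral[OF _ gint I_gauss_le])
      show "integrable lborel (\<lambda>z. I (x + h n *\<^sub>R z) * gauss z)"
        by (rule Bochner_Integration.integrable_bound[OF gint]) (use I_gauss_le in auto)
    qed
    have k_lim: "(\<lambda>n. k n x) \<longlonglongrightarrow> I x * c" if x: "x \<notin> cbox a b - box a b" for x
    proof -
      have "(\<lambda>n. k n x) \<longlonglongrightarrow> (\<integral>z. I x * gauss z \<partial>(lborel :: 'a measure))"
        unfolding k_def
      proof (rule integral_dominated_convergence[where w = "\<lambda>z. cmod (gauss z)"])
        show "AE z in lborel. (\<lambda>n. I (x + h n *\<^sub>R z) * gauss z) \<longlonglongrightarrow> I x * gauss z"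
        proof (intro AE_I2 tendsto_mult tendsto_const)
          fix z
          have lim: "(\<lambda>n. x + h n *\<^sub>R z) \<longlonglongrightarrow> x"
            using tendsto_add[OF tendsto_const tendsto_scaleR[OF h0 tendsto_const], of x z] by simp
          \<comment> \<open>Off the boundary, \<open>x\<close> lies in one of two open sets, the
            open box or the complement of the closed box, and \<open>I\<close> is constant on
            each.\<close>
          have "eventually (\<lambda>n. I (x + h n *\<^sub>R z) = I x) sequentially"
          proof (cases "x \<in> box a b")
            case True
            then show ?thesis
              using topological_tendstoD[OF lim open_box True] by (auto simp: I_def elim!: eventually_mono)
          next
            case False
            then have "x \<in> - cbox a b" using x by auto
            then have "eventually (\<lambda>n. x + h n *\<^sub>R z \<in> - cbox a b) sequentially"
              by (intro topological_tendstoD[OF lim]) (auto simp: closed_cbox)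
            then show ?thesis
              using False box_subset_cbox[of a b] by (auto simp: I_def elim!: eventually_mono split: split_indicator)
          qed
          then show "(\<lambda>n. I (x + h n *\<^sub>R z)) \<longlonglongrightarrow> I x" by (rule tendsto_eventually)
        qed
      qed (use gint I_gauss_le in auto)
      then show ?thesis by (simp add: c_def)
    qed
    have "(\<lambda>n. \<integral>x. w x * k n x \<partial>lborel) \<longlonglongrightarrow> (\<integral>x. w x * (I x * c) \<partial>lborel)"
    proof (rule integral_dominated_convergence[where w = "\<lambda>x. cmod (w x) * C"])
      show "integrable lborel (\<lambda>x. cmod (w x) * C)"
        using w by (intro integrable_mult_left integrable_norm)
      show "AE x in lborel. (\<lambda>n. w x * k n x) \<longlonglongrightarrow> w x * (I x * c)"
        using AE_not_in[OF box_boundary_null[of a b]]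
        by eventually_elim (intro tendsto_mult tendsto_const k_lim)
      show "(\<lambda>x. w x * k n x) \<in> borel_measurable lborel" for n
        unfolding k_def by measurable
    qed (auto simp: norm_mult intro!: mult_left_mono k_le)
    then have "(\<integral>x. w x * (I x * c) \<partial>lborel) = 0"
      by (simp add: wk LIMSEQ_const_iff)
    then have "(\<integral>x. (I x * w x) * c \<partial>lborel) = 0" by (simp add: mult_ac)
    then have "(\<integral>x. I x * w x \<partial>lborel) = 0" using c by simp
    moreover have "I x * w x = indicator (box a b) x *\<^sub>R w x" for x
      by (simp add: I_def split: split_indicator)
    ultimately show ?thesis by simp
  qed
  with w have "AE x in lborel. w x = 0" by (rule AE_zero_if_box_integrals_zero)
  then show ?thesis by eventually_elim (simp add: w_def gauss_def)
qed

lemma L2_distribution_apply: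
  "\<phi> \<in> schwartz \<Longrightarrow> L2_distribution f \<phi> = (\<integral>x. rep_L2 f x * \<phi> x \<partial>lborel)"
  by (simp add: L2_distribution_def)

lemma inj_L2_distribution: "inj L2_distribution"
proof (rule injI)
  fix f g :: "'a L2" assume eq: "L2_distribution f = L2_distribution g"
  define H where "H x = rep_L2 f x + (- 1) * rep_L2 g x" for x
  have "square_integrable H"
    unfolding H_def by (intro square_integrable_add square_integrable_cmult square_integrable_rep_L2)
  moreover have "(\<integral>x. H x * \<phi> x \<partial>lborel) = 0" if "\<phi> \<in> schwartz" for \<phi>
  proof -
    have int: "integrable lborel (\<lambda>x. rep_L2 k x * \<phi> x)" for k
      by (intro square_integrable_mult_integrable square_integrable_rep_L2 schwartz_square_integrable that)
    have "(\<integral>x. H x * \<phi> x \<partial>lborel) = (\<integral>x. rep_L2 f x * \<phi> x \<partial>lborel) - (\<integral>x. rep_L2 g x * \<phi> x \<partial>lborel)"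
      by (subst Bochner_Integration.integral_diff[symmetric, OF int int]) (simp add: H_def algebra_simps)
    also have "\<dots> = 0"
      using eq L2_distribution_apply[OF that, of f] L2_distribution_apply[OF that, of g] by simp
    finally show ?thesis .
  qed
  ultimately have "AE x in lborel. H x = 0" by (rule square_integrable_zero_if_annihilates_schwartz)
  then have "AE x in lborel. ennreal ((cmod (rep_L2 f x - rep_L2 g x))\<^sup>2) = 0"
    by eventually_elim (simp add: H_def)
  then have "(\<integral>\<^sup>+x. ennreal ((cmod (rep_L2 f x - rep_L2 g x))\<^sup>2) \<partial>lborel) = (\<integral>\<^sup>+x. 0 \<partial>(lborel :: 'a measure))"
    by (rule nn_integral_cong_AE)
  then have "ennreal ((norm (f - g))\<^sup>2) = 0" by (simp add: ennreal_norm_diff_square)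
  then show "f = g" by simp
qed

text \<open>Transposition reverses the order, so the test function meets the exponent
  \<open>s\<close> first and \<open>- s\<close> second. Equality also holds outside
  \<open>schwartz\<close>, as both sides are restricted functions with the value
  \<open>undefined\<close> there.\<close>

lemma bracket_nabla_inverse: "\<langle>\<nabla>\<rangle> s (\<langle>\<nabla>\<rangle> (- s) (L2_distribution f)) = L2_distribution f"
proof -
  have "\<langle>\<nabla>\<rangle> s (\<langle>\<nabla>\<rangle> (- s) (L2_distribution f)) = (\<lambda>\<phi>\<in>schwartz. L2_distribution f \<phi>)"
    unfolding bracket_nabla_def
    by (intro restrict_ext)
      (simp add: bracket_nabla_fun_schwartz bracket_nabla_fun_inverse[where s = "- s", simplified])
  also have "\<dots> = L2_distribution f"
    by (auto simp: L2_distribution_def fun_eq_iff)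
  finally show ?thesis .
qed

text \<open>Valid for every \<open>\<omega>\<close>: even where the series diverges,
  \<open>randomize\<close> is some bounded operator. The inner pair of brackets cancels before
  \<open>inv L2_distribution\<close> is applied, so the inverse is taken only on the range.\<close>

lemma acts_as_randomized_data:
  fixes u v :: "nat \<Rightarrow> 'a::euclidean_space L2"
  shows "acts_as (\<langle>\<nabla>\<rangle> \<sigma> \<circ> randomized_data \<sigma> g a u v \<omega> \<circ> \<langle>\<nabla>\<rangle> \<sigma>) (randomize g a u v \<omega>)"
  unfolding acts_as_def
proof
  fix f :: "'a L2"
  have "\<langle>\<nabla>\<rangle> (- \<sigma>) (\<langle>\<nabla>\<rangle> \<sigma> (L2_distribution f)) = L2_distribution f"
    using bracket_nabla_inverse[of "- \<sigma>"] by simp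
  then show "(\<langle>\<nabla>\<rangle> \<sigma> \<circ> randomized_data \<sigma> g a u v \<omega> \<circ> \<langle>\<nabla>\<rangle> \<sigma>) (L2_distribution f)
      = L2_distribution (randomize g a u v \<omega> f)"
    by (simp add: randomized_data_def on_distributions_def bracket_nabla_inverse inv_f_f inj_L2_distribution)
qed

text \<open>This allows \<open>X \<notin> Schatten r\<close> to be read off from a single operator
  that \<open>X\<close> acts as.\<close>

lemma acts_as_unique:
  assumes "acts_as X A" "acts_as X B"
  shows "A = B"
proof (rule blinfun_eqI)
  fix f
  have "L2_distribution (A f) = L2_distribution (B f)" using assms by (metis acts_as_def)
  then show "A f = B f" by (rule injD[OF inj_L2_distribution])
qed

lemma Schatten_iff: "acts_as X A \<Longrightarrow> X \<in> Schatten r \<longleftrightarrow> A \<in> schatten r"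
  unfolding Schatten_def using acts_as_unique by blast

theorem proposition2p4:
  fixes M :: "'w measure" and g :: "nat \<Rightarrow> 'w \<Rightarrow> real"
    and \<gamma>\<^sub>0 :: "'a::euclidean_space distribution \<Rightarrow> 'a distribution"
    and a :: "nat \<Rightarrow> real" and u v :: "nat \<Rightarrow> 'a L2"
    and \<alpha> \<beta> \<sigma> :: real
  assumes "prob_space M"
    and "prob_space.indep_vars M (\<lambda>_. borel) g UNIV"
    and "\<And>n. integrable M (g n)" and "\<And>n. (\<integral>\<omega>. g n \<omega> \<partial>M) = 0"
    and "\<exists>C\<^sub>0>0. \<forall>n \<zeta>. (\<integral>\<^sup>+x. ennreal (exp (\<zeta> * x)) \<partial>distr M borel (g n)) \<le> ennreal (exp (C\<^sub>0 * \<zeta>\<^sup>2))"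
    and "\<exists>c>0. limsup (\<lambda>n. ereal (measure M {\<omega> \<in> space M. \<bar>g n \<omega>\<bar> \<le> c})) < 1"
    and "1 \<le> \<beta>" and "\<beta> \<le> \<alpha>"
    and "\<langle>\<nabla>\<rangle> \<sigma> \<circ> \<gamma>\<^sub>0 \<circ> \<langle>\<nabla>\<rangle> \<sigma> \<in> Schatten \<alpha> - Schatten \<beta>"
    and "has_svd (\<langle>\<nabla>\<rangle> \<sigma> \<circ> \<gamma>\<^sub>0 \<circ> \<langle>\<nabla>\<rangle> \<sigma>) a u v"
  shows "AE \<omega> in M. \<langle>\<nabla>\<rangle> \<sigma> \<circ> randomized_data \<sigma> g a u v \<omega> \<circ> \<langle>\<nabla>\<rangle> \<sigma> \<in> Schatten \<alpha> - Schatten \<beta>"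
proof -
  interpret prob_space M by fact
  obtain C\<^sub>0 where C: "\<forall>n \<zeta>. (\<integral>\<^sup>+x. ennreal (exp (\<zeta> * x)) \<partial>distr M borel (g n)) \<le> ennreal (exp (C\<^sub>0 * \<zeta>\<^sup>2))"
    using assms(5) by blast
  obtain c where c: "0 < c" "limsup (\<lambda>n. ereal (prob {\<omega> \<in> space M. \<bar>g n \<omega>\<bar> \<le> c})) < 1"
    using assms(6) by blast
  have g [measurable]: "g n \<in> borel_measurable M" for n
    using assms(3) by (rule borel_measurable_integrable)
  have mgf: "(\<integral>\<^sup>+\<omega>. ennreal (exp (\<zeta> * g n \<omega>)) \<partial>M) \<le> ennreal (exp (C\<^sub>0 * \<zeta>\<^sup>2))" for n \<zeta>
    using C[rule_format, of n \<zeta>] by (simp add: nn_integral_distr)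
  have r: "0 < \<alpha>" "0 < \<beta>" using assms(7,8) by auto
  obtain A where A: "acts_as (\<langle>\<nabla>\<rangle> \<sigma> \<circ> \<gamma>\<^sub>0 \<circ> \<langle>\<nabla>\<rangle> \<sigma>) A" "is_svd A a u v"
    using assms(10) by (auto simp: has_svd_def)
  then have a: "orthonormal_on u UNIV" "orthonormal_on v UNIV" "diag_series a u v sums A"
    by (auto simp: is_svd_iff)
  have A_mem: "A \<in> schatten \<alpha>" "A \<notin> schatten \<beta>"
    using assms(9) Schatten_iff[OF A(1)] by auto
  have sum_\<alpha>: "summable (\<lambda>n. \<bar>a n\<bar> powr \<alpha>)"
    by (rule schatten_diagD[OF a(3,1,2) r(1) A_mem(1)])
  have sum_\<beta>: "\<not> summable (\<lambda>n. \<bar>a n\<bar> powr \<beta>)"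
    using schatten_diagI[OF a(3,1,2) r(2)] A_mem(2) by blast
  have "Bseq a"
    using diag_coefficients_tendsto_0[OF a(3,1,2)] by (intro convergent_imp_Bseq convergentI)
  have "AE \<omega> in M. summable (\<lambda>n. \<bar>a n * g n \<omega>\<bar> powr \<alpha>)"
    by (rule AE_summable_random_coefficients[OF g mgf sum_\<alpha> r(1)])
  moreover have "AE \<omega> in M. \<not> summable (\<lambda>n. \<bar>a n * g n \<omega>\<bar> powr \<beta>)"
    by (rule AE_not_summable_random_coefficients[OF assms(2) c sum_\<beta> \<open>Bseq a\<close> r(2)])
  ultimately show ?thesis
  proof eventually_elim
    fix \<omega>
    assume s: "summable (\<lambda>n. \<bar>a n * g n \<omega>\<bar> powr \<alpha>)" "\<not> summable (\<lambda>n. \<bar>a n * g n \<omega>\<bar> powr \<beta>)"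
    define b where "b n = a n * g n \<omega>" for n
    \<comment> \<open>Summability for \<alpha> makes the powers tend to 0, hence also the random
      coefficients. So the series in \<open>randomize\<close> converges in operator norm for this
      \<open>\<omega>\<close> and its value is the intended one.\<close>
    have "(\<lambda>n. (\<bar>b n\<bar> powr \<alpha>) powr (1 / \<alpha>)) \<longlonglongrightarrow> 0"
      using r(1) unfolding b_def
      by (intro tendsto_zero_powrI[OF summable_LIMSEQ_zero[OF s(1)] tendsto_const]) auto
    then have "b \<longlonglongrightarrow> 0"
      using r(1) by (simp add: powr_powr tendsto_rabs_zero_iff)
    then have ds: "diag_series b u v sums randomize g a u v \<omega>"
      using summable_sums[OF diag_series_summable[OF a(1,2)]]
      by (simp add: randomize_def diag_series_def[abs_def] b_def[abs_def])
    have "randomize g a u v \<omega> \<in> schatten \<alpha>" "randomize g a u v \<omega> \<notin> schatten \<beta>"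
      using schatten_diagI[OF ds a(1,2) r(1)] schatten_diagD[OF ds a(1,2) r(2)] s
      by (auto simp: b_def)
    then show "\<langle>\<nabla>\<rangle> \<sigma> \<circ> randomized_data \<sigma> g a u v \<omega> \<circ> \<langle>\<nabla>\<rangle> \<sigma> \<in> Schatten \<alpha> - Schatten \<beta>"
      by (simp add: Schatten_iff[OF acts_as_randomized_data])
  qed
qed

end
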